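(* Let $(M,g)$ be a smooth $n$-dimensional Riemannian manifold of positive constant sectional curvature $c$, with $n\geq 2$. Let $A,B\in\mathbf{R}$ with $A\geq 0$ and $B\geq 0$, and let $v:(0,\infty)\to\mathbf{R}$ be the function $$v(t)=\frac{(n-2)\sqrt{c}}{n\sqrt{2}}\,t^{-\frac12}+A\,t^{-\frac{n+1}{2}}+B.$$ Let $G$ be the Riemannian metric and $J$ the almost complex structure on the nonzero cotangent bundle $T^*_0M$ determined by $c$ and $v$ as defined in the context. Then $(T^*_0M,G,J)$ is a Kähler Einstein manifold.
   Context: Let $\pi:T^*M\to M$ be the cotangent bundle and $T^*_0M$ the complement of the zero section in $T^*M$. A local chart $(U,x^1,\dots,x^n)$ on $M$ induces a local chart $(\pi^{-1}(U),q^1,\dots,q^n,p_1,\dots,p_n)$ on $T^*M$, where $q^i=x^i\circ\pi$ and $p=p_i\,dx^i_{\pi(p)}$. The summation convention is used. Let $g_{ij}$ be the components of $g$, $(g^{kl})$ the inverse matrix of $(g_{ij})$, $\Gamma^k_{ij}$ the Christoffel symbols of the Levi-Civita connection of $g$, and put $g^{0i}=p_hg^{hi}$ and $\Gamma^0_{ih}=p_k\Gamma^k_{ih}$. The energy density is $t=\frac12 g^{ik}p_ip_k$; it takes values in $(0,\infty)$ on $T^*_0M$. The adapted local frame on $T^*_0M$ is $\left(\frac{\delta}{\delta q^1},\dots,\frac{\delta}{\delta q^n},\frac{\partial}{\partial p_1},\dots,\frac{\partial}{\partial p_n}\right)$ with $\frac{\delta}{\delta q^i}=\frac{\partial}{\partial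 q^i}+\Gamma^0_{ih}\frac{\partial}{\partial p_h}$. Its dual frame is $(dq^i,Dp_i)$ with $Dp_i=dp_i-\Gamma^0_{ij}dq^j$. Given $c>0$ and a smooth function $v$ on $(0,\infty)$ with $v(t)>-\sqrt{\frac{c}{2t}}$ (a condition satisfied under the hypotheses of the claim), define $$G_{ij}=\sqrt{2ct}\,g_{ij}+v(t)p_ip_j,\qquad H^{kl}=\frac{1}{\sqrt{2ct}}g^{kl}-\frac{v}{2t(c+\sqrt{2ct}\,v)}g^{0k}g^{0l};$$ the matrix $(G_{ij})$ is positive definite with inverse $(H^{kl})$. The Riemannian metric is $G=G_{ij}dq^idq^j+H^{ij}Dp_iDp_j$, i.e. $G(\frac{\delta}{\delta q^i},\frac{\delta}{\delta q^j})=G_{ij}$, $G(\frac{\partial}{\partial p_i},\frac{\partial}{\partial p_j})=H^{ij}$, $G(\frac{\partial}{\partial p_i},\frac{\delta}{\delta q^j})=0$. The almost complex structure is given by $J\frac{\delta}{\delta q^i}=G_{ik}\frac{\partial}{\partial p_k}$, $J\frac{\partial}{\partial p_i}=-H^{ik}\frac{\delta}{\delta q^k}$. These definitions are independent of the chart. Kähler Einstein means that $(T^*_0M,G,J)$ is a Kähler manifold and the Ricci tensor of $G$ is a constant multiple of $G$. *)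

theory Defs
  imports "HOL-Analysis.Analysis"
begin

section \<open>Smooth maps between open subsets of Euclidean spaces\<close>

definition partial_deriv :: "'k \<Rightarrow> (real^'k \<Rightarrow> 'b::real_normed_vector) \<Rightarrow> real^'k \<Rightarrow> 'b" where
  "partial_deriv i f x = frechet_derivative f (at x) (axis i 1)"

primrec Ck_on :: "nat \<Rightarrow> (real^'k) set \<Rightarrow> (real^'k \<Rightarrow> 'b::real_normed_vector) \<Rightarrow> bool" where
  "Ck_on 0 S f \<longleftrightarrow> continuous_on S f"
| "Ck_on (Suc m) S f \<longleftrightarrow>
     (\<forall>x\<in>S. f differentiable (at x)) \<and> (\<forall>i. Ck_on m S (partial_deriv i f))"

definition smooth_on :: "(real^'k) set \<Rightarrow> (real^'k \<Rightarrow> 'b::real_normed_vector) \<Rightarrow> bool" where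
  "smooth_on S f \<longleftrightarrow> open S \<and> (\<forall>m. Ck_on m S f)"


section \<open>Smooth manifolds\<close>

text \<open>
  A manifold is given by an atlas, i.e. a family of charts indexed by a set. The underlying set is
  the union of the chart domains, and its topology is the one determined by the charts. The value
  of a chart map outside its chart domain is irrelevant. The dimension is the cardinality of the
  index type \<open>'k\<close> of the coordinates.
\<close>

record ('i, 'a, 'k::finite) atlas =
  index :: "'i set"
  chart_dom :: "'i \<Rightarrow> 'a set"
  chart_map :: "'i \<Rightarrow> 'a \<Rightarrow> real^'k"

definition points :: "('i, 'a, 'k::finite) atlas \<Rightarrow> 'a set" where
  "points M = (\<Union>i\<in>index M. chart_dom M i)"

definition coord_range :: "('i, 'a, 'k::finite) atlas \<Rightarrow> 'i \<Rightarrow> (real^'k) set" where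
  "coord_range M i = chart_map M i ` chart_dom M i"

definition overlap :: "('i, 'a, 'k::finite) atlas \<Rightarrow> 'i \<Rightarrow> 'i \<Rightarrow> (real^'k) set" where
  "overlap M i j = chart_map M i ` (chart_dom M i \<inter> chart_dom M j)"

definition transition :: "('i, 'a, 'k::finite) atlas \<Rightarrow> 'i \<Rightarrow> 'i \<Rightarrow> real^'k \<Rightarrow> real^'k" where
  "transition M i j y = chart_map M j (inv_into (chart_dom M i) (chart_map M i) y)"

definition transition_jacobian :: "('i, 'a, 'k::finite) atlas \<Rightarrow> 'i \<Rightarrow> 'i \<Rightarrow> real^'k \<Rightarrow> real^'k^'k" where
  "transition_jacobian M i j y = matrix (frechet_derivative (transition M i j) (at y))"

definition smooth_atlas :: "('i, 'a, 'k::finite) atlas \<Rightarrow> bool" where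
  "smooth_atlas M \<longleftrightarrow>
     (\<forall>i\<in>index M. inj_on (chart_map M i) (chart_dom M i) \<and> open (coord_range M i)) \<and>
     (\<forall>i\<in>index M. \<forall>j\<in>index M. open (overlap M i j) \<and> smooth_on (overlap M i j) (transition M i j))"

definition manifold_topology :: "('i, 'a, 'k::finite) atlas \<Rightarrow> 'a topology" where
  "manifold_topology M = topology (\<lambda>W. W \<subseteq> points M \<and>
     (\<forall>i\<in>index M. open (chart_map M i ` (W \<inter> chart_dom M i))))"

lemma openin_manifold_topology:
  assumes "smooth_atlas M"
  shows "openin (manifold_topology M) W \<longleftrightarrow> W \<subseteq> points M \<and>
     (\<forall>i\<in>index M. open (chart_map M i ` (W \<inter> chart_dom M i)))"
proof -
  have "istopology (\<lambda>W. W \<subseteq> points M \<and>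
     (\<forall>i\<in>index M. open (chart_map M i ` (W \<inter> chart_dom M i))))"
    unfolding istopology_def
  proof (intro conjI allI impI ballI)
    fix S T i
    assume S: "S \<subseteq> points M \<and> (\<forall>i\<in>index M. open (chart_map M i ` (S \<inter> chart_dom M i)))"
      and T: "T \<subseteq> points M \<and> (\<forall>i\<in>index M. open (chart_map M i ` (T \<inter> chart_dom M i)))"
    show "S \<inter> T \<subseteq> points M"
      using S by blast
    assume i: "i \<in> index M"
    then have "inj_on (chart_map M i) (chart_dom M i)"
      using assms by (simp add: smooth_atlas_def)
    then have "chart_map M i ` (S \<inter> T \<inter> chart_dom M i) =
        chart_map M i ` (S \<inter> chart_dom M i) \<inter> chart_map M i ` (T \<inter> chart_dom M i)"
      unfolding inj_on_def by blast
    then show "open (chart_map M i ` (S \<inter> T \<inter> chart_dom M i))"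
      using S T i by auto
  next
    fix K i
    assume K: "\<forall>W\<in>K. W \<subseteq> points M \<and> (\<forall>i\<in>index M. open (chart_map M i ` (W \<inter> chart_dom M i)))"
    show "\<Union>K \<subseteq> points M"
      using K by blast
    assume i: "i \<in> index M"
    have "chart_map M i ` (\<Union>K \<inter> chart_dom M i) = (\<Union>W\<in>K. chart_map M i ` (W \<inter> chart_dom M i))"
      by blast
    then show "open (chart_map M i ` (\<Union>K \<inter> chart_dom M i))"
      using K i by auto
  qed
  then show ?thesis
    unfolding manifold_topology_def by (simp add: topology_inverse')
qed

definition smooth_manifold :: "('i, 'a, 'k::finite) atlas \<Rightarrow> bool" where
  "smooth_manifold M \<longleftrightarrow> smooth_atlas M \<and>
     Hausdorff_space (manifold_topology M) \<and> second_countable (manifold_topology M)"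


section \<open>Riemannian metrics and curvature\<close>

text \<open>
  A tensor field is given by its components in each chart, as functions of the coordinates, subject
  to the transformation law on overlaps. In this section \<open>g y $ i $ j\<close> stands for the
  component $g_{ij}$ at the point with coordinates \<open>y\<close>.
\<close>

definition riemannian_metric ::
  "('i, 'a, 'k::finite) atlas \<Rightarrow> ('i \<Rightarrow> real^'k \<Rightarrow> real^'k^'k) \<Rightarrow> bool" where
  "riemannian_metric M g \<longleftrightarrow>
     (\<forall>i\<in>index M. smooth_on (coord_range M i) (g i) \<and>
        (\<forall>y\<in>coord_range M i. transpose (g i y) = g i y \<and> (\<forall>X. X \<noteq> 0 \<longrightarrow> X \<bullet> (g i y *v X) > 0))) \<and>
     (\<forall>i\<in>index M. \<forall>j\<in>index M. \<forall>y\<in>overlap M i j.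
        g i y = transpose (transition_jacobian M i j y) ** g j (transition M i j y)
                  ** transition_jacobian M i j y)"

text \<open>The Christoffel symbol $\Gamma^k_{ij}$ of the Levi-Civita connection is
  \<open>christoffel g k i j\<close>.\<close>

definition christoffel :: "(real^'k \<Rightarrow> real^'k^'k) \<Rightarrow> 'k \<Rightarrow> 'k \<Rightarrow> 'k \<Rightarrow> real^'k \<Rightarrow> real" where
  "christoffel g k i j y = 1/2 * (\<Sum>l\<in>UNIV. matrix_inv (g y) $ k $ l *
     (partial_deriv i (\<lambda>z. g z $ j $ l) y + partial_deriv j (\<lambda>z. g z $ i $ l) y
        - partial_deriv l (\<lambda>z. g z $ i $ j) y))"

text \<open>\<open>riemann g l k i j\<close> is $R^l_{kij}$, where
  $R(\partial_i, \partial_j)\partial_k = R^l_{kij}\partial_l$ and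
  $R(X,Y) = [\nabla_X, \nabla_Y] - \nabla_{[X,Y]}$.\<close>

definition riemann :: "(real^'k \<Rightarrow> real^'k^'k) \<Rightarrow> 'k \<Rightarrow> 'k \<Rightarrow> 'k \<Rightarrow> 'k \<Rightarrow> real^'k \<Rightarrow> real" where
  "riemann g l k i j y =
     partial_deriv i (christoffel g l j k) y - partial_deriv j (christoffel g l i k) y
     + (\<Sum>m\<in>UNIV. christoffel g l i m y * christoffel g m j k y
                  - christoffel g l j m y * christoffel g m i k y)"

definition curvature_operator ::
  "(real^'k \<Rightarrow> real^'k^'k) \<Rightarrow> real^'k \<Rightarrow> real^'k \<Rightarrow> real^'k \<Rightarrow> real^'k \<Rightarrow> real^'k" where
  "curvature_operator g y X Y Z =
     (\<chi> l. \<Sum>i\<in>UNIV. \<Sum>j\<in>UNIV. \<Sum>k\<in>UNIV. riemann g l k i j y * X $ i * Y $ j * Z $ k)"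

definition sectional_curvature ::
  "(real^'k \<Rightarrow> real^'k^'k) \<Rightarrow> real^'k \<Rightarrow> real^'k \<Rightarrow> real^'k \<Rightarrow> real" where
  "sectional_curvature g y X Y =
     (X \<bullet> (g y *v curvature_operator g y X Y Y)) /
     ((X \<bullet> (g y *v X)) * (Y \<bullet> (g y *v Y)) - (X \<bullet> (g y *v Y))\<^sup>2)"

definition constant_sectional_curvature ::
  "('i, 'a, 'k::finite) atlas \<Rightarrow> ('i \<Rightarrow> real^'k \<Rightarrow> real^'k^'k) \<Rightarrow> real \<Rightarrow> bool" where
  "constant_sectional_curvature M g c \<longleftrightarrow>
     (\<forall>i\<in>index M. \<forall>y\<in>coord_range M i. \<forall>X Y. X \<noteq> Y \<and> independent {X, Y} \<longrightarrow>
        sectional_curvature (g i) y X Y = c)"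

text \<open>$\mathrm{Ric}(Y,Z)$ is the trace of $X \mapsto R(X,Y)Z$.\<close>

definition ricci :: "(real^'k \<Rightarrow> real^'k^'k) \<Rightarrow> real^'k \<Rightarrow> real^'k^'k" where
  "ricci g y = (\<chi> j k. \<Sum>i\<in>UNIV. riemann g i k i j y)"

definition einstein_metric ::
  "('i, 'a, 'k::finite) atlas \<Rightarrow> ('i \<Rightarrow> real^'k \<Rightarrow> real^'k^'k) \<Rightarrow> bool" where
  "einstein_metric M g \<longleftrightarrow>
     (\<exists>lam::real. \<forall>i\<in>index M. \<forall>y\<in>coord_range M i. ricci (g i) y = lam *\<^sub>R g i y)"


section \<open>Kaehler manifolds\<close>

text \<open>A $(1,1)$-tensor field is represented by the matrices of its endomorphisms with respect to
  the coordinate frame: \<open>J y $ a $ b\<close> is the component $J^a_b$ in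
  $J\partial_b = J^a_b\partial_a$.\<close>

definition almost_complex_structure ::
  "('i, 'a, 'k::finite) atlas \<Rightarrow> ('i \<Rightarrow> real^'k \<Rightarrow> real^'k^'k) \<Rightarrow> bool" where
  "almost_complex_structure M J \<longleftrightarrow>
     (\<forall>i\<in>index M. smooth_on (coord_range M i) (J i) \<and>
        (\<forall>y\<in>coord_range M i. J i y ** J i y = - mat 1)) \<and>
     (\<forall>i\<in>index M. \<forall>j\<in>index M. \<forall>y\<in>overlap M i j.
        transition_jacobian M i j y ** J i y = J j (transition M i j y) ** transition_jacobian M i j y)"

definition lie_bracket :: "(real^'k \<Rightarrow> real^'k) \<Rightarrow> (real^'k \<Rightarrow> real^'k) \<Rightarrow> real^'k \<Rightarrow> real^'k" where
  "lie_bracket X Y y = frechet_derivative Y (at y) (X y) - frechet_derivative X (at y) (Y y)"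

definition nijenhuis ::
  "(real^'k \<Rightarrow> real^'k^'k) \<Rightarrow> (real^'k \<Rightarrow> real^'k) \<Rightarrow> (real^'k \<Rightarrow> real^'k) \<Rightarrow> real^'k \<Rightarrow> real^'k" where
  "nijenhuis J X Y y =
     lie_bracket (\<lambda>z. J z *v X z) (\<lambda>z. J z *v Y z) y
     - J y *v lie_bracket (\<lambda>z. J z *v X z) Y y
     - J y *v lie_bracket X (\<lambda>z. J z *v Y z) y
     - lie_bracket X Y y"

text \<open>Integrability is the vanishing of the Nijenhuis tensor, expressed through its components,
  i.e. its values on the coordinate vector fields.\<close>

definition integrable_structure ::
  "('i, 'a, 'k::finite) atlas \<Rightarrow> ('i \<Rightarrow> real^'k \<Rightarrow> real^'k^'k) \<Rightarrow> bool" where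
  "integrable_structure M J \<longleftrightarrow>
     (\<forall>i\<in>index M. \<forall>y\<in>coord_range M i. \<forall>a b. nijenhuis (J i) (\<lambda>_. axis a 1) (\<lambda>_. axis b 1) y = 0)"

definition hermitian_metric :: "('i, 'a, 'k::finite) atlas \<Rightarrow>
    ('i \<Rightarrow> real^'k \<Rightarrow> real^'k^'k) \<Rightarrow> ('i \<Rightarrow> real^'k \<Rightarrow> real^'k^'k) \<Rightarrow> bool" where
  "hermitian_metric M g J \<longleftrightarrow> riemannian_metric M g \<and>
     (\<forall>i\<in>index M. \<forall>y\<in>coord_range M i. \<forall>X Y.
        (J i y *v X) \<bullet> (g i y *v (J i y *v Y)) = X \<bullet> (g i y *v Y))"

text \<open>The fundamental form $\Omega(X,Y) = g(X, JY)$.\<close>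

definition fundamental_form ::
  "(real^'k \<Rightarrow> real^'k^'k) \<Rightarrow> (real^'k \<Rightarrow> real^'k^'k) \<Rightarrow> real^'k \<Rightarrow> real^'k^'k" where
  "fundamental_form g J y = g y ** J y"

definition closed_two_form ::
  "('i, 'a, 'k::finite) atlas \<Rightarrow> ('i \<Rightarrow> real^'k \<Rightarrow> real^'k^'k) \<Rightarrow> bool" where
  "closed_two_form M w \<longleftrightarrow> (\<forall>i\<in>index M. \<forall>y\<in>coord_range M i. \<forall>a b d.
     partial_deriv a (\<lambda>z. w i z $ b $ d) y + partial_deriv b (\<lambda>z. w i z $ d $ a) y
       + partial_deriv d (\<lambda>z. w i z $ a $ b) y = 0)"

definition kaehler_manifold :: "('i, 'a, 'k::finite) atlas \<Rightarrow>
    ('i \<Rightarrow> real^'k \<Rightarrow> real^'k^'k) \<Rightarrow> ('i \<Rightarrow> real^'k \<Rightarrow> real^'k^'k) \<Rightarrow> bool" where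
  "kaehler_manifold M g J \<longleftrightarrow> smooth_manifold M \<and>
     almost_complex_structure M J \<and> integrable_structure M J \<and>
     hermitian_metric M g J \<and> closed_two_form M (\<lambda>i. fundamental_form (g i) (J i))"

definition kaehler_einstein_manifold :: "('i, 'a, 'k::finite) atlas \<Rightarrow>
    ('i \<Rightarrow> real^'k \<Rightarrow> real^'k^'k) \<Rightarrow> ('i \<Rightarrow> real^'k \<Rightarrow> real^'k^'k) \<Rightarrow> bool" where
  "kaehler_einstein_manifold M g J \<longleftrightarrow> kaehler_manifold M g J \<and> einstein_metric M g"


section \<open>The nonzero cotangent bundle\<close>

text \<open>
  A covector at \<open>x\<close> is the family of its components $p_h$ in all charts around \<open>x\<close>, which satisfy
  $p_h = \frac{\partial x'^k}{\partial x^h} p'_k$; the entries for the other indices are set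
  to \<open>0\<close>, so that the zero covector is the family \<open>0\<close>.
\<close>

definition covectors :: "('i, 'a, 'n::finite) atlas \<Rightarrow> 'a \<Rightarrow> ('i \<Rightarrow> real^'n) set" where
  "covectors M x = {w.
     (\<forall>i. \<not> (i \<in> index M \<and> x \<in> chart_dom M i) \<longrightarrow> w i = 0) \<and>
     (\<forall>i\<in>index M. \<forall>j\<in>index M. x \<in> chart_dom M i \<and> x \<in> chart_dom M j \<longrightarrow>
        w i = transpose (transition_jacobian M i j (chart_map M i x)) *v w j)}"

text \<open>The induced charts have coordinates indexed by \<open>'n + 'n\<close>: $q^i$ has index \<open>Inl i\<close> and
  $p_i$ has index \<open>Inr i\<close>.\<close>

definition cotangent0 ::
  "('i, 'a, 'n::finite) atlas \<Rightarrow> ('i, 'a \<times> ('i \<Rightarrow> real^'n), 'n + 'n) atlas" where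
  "cotangent0 M = \<lparr>
     index = index M,
     chart_dom = (\<lambda>i. {(x, w). x \<in> chart_dom M i \<and> w \<in> covectors M x \<and> w \<noteq> (\<lambda>_. 0)}),
     chart_map = (\<lambda>i (x, w). \<chi> a. case a of Inl h \<Rightarrow> chart_map M i x $ h | Inr h \<Rightarrow> w i $ h) \<rparr>"

definition q_part :: "real^('n + 'n) \<Rightarrow> real^'n" where
  "q_part z = (\<chi> i. z $ Inl i)"

definition p_part :: "real^('n + 'n) \<Rightarrow> real^'n" where
  "p_part z = (\<chi> i. z $ Inr i)"

definition energy :: "(real^'n \<Rightarrow> real^'n^'n) \<Rightarrow> real^('n + 'n) \<Rightarrow> real" where
  "energy g z = 1/2 * (\<Sum>i\<in>UNIV. \<Sum>k\<in>UNIV.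
     matrix_inv (g (q_part z)) $ i $ k * p_part z $ i * p_part z $ k)"

text \<open>$g^{0i} = p_h g^{hi}$ and $\Gamma^0_{ih} = p_k\Gamma^k_{ih}$.\<close>

definition g0 :: "(real^'n \<Rightarrow> real^'n^'n) \<Rightarrow> real^('n + 'n) \<Rightarrow> 'n \<Rightarrow> real" where
  "g0 g z i = (\<Sum>h\<in>UNIV. p_part z $ h * matrix_inv (g (q_part z)) $ h $ i)"

definition Gamma0 :: "(real^'n \<Rightarrow> real^'n^'n) \<Rightarrow> real^('n + 'n) \<Rightarrow> 'n \<Rightarrow> 'n \<Rightarrow> real" where
  "Gamma0 g z i h = (\<Sum>k\<in>UNIV. p_part z $ k * christoffel g k i h (q_part z))"

text \<open>The adapted frame $\frac{\delta}{\delta q^i}, \frac{\partial}{\partial p_i}$ and the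
  component $Dp_i(X)$, where $Dp_i = dp_i - \Gamma^0_{ij}dq^j$.\<close>

definition delta_q :: "(real^'n \<Rightarrow> real^'n^'n) \<Rightarrow> real^('n + 'n) \<Rightarrow> 'n \<Rightarrow> real^('n + 'n)" where
  "delta_q g z i = axis (Inl i) 1 + (\<Sum>h\<in>UNIV. Gamma0 g z i h *\<^sub>R axis (Inr h) 1)"

definition partial_p :: "'n::finite \<Rightarrow> real^('n + 'n)" where
  "partial_p i = axis (Inr i) 1"

definition dq :: "'n::finite \<Rightarrow> real^('n + 'n) \<Rightarrow> real" where
  "dq i X = X $ Inl i"

definition Dp :: "(real^'n \<Rightarrow> real^'n^'n) \<Rightarrow> real^('n + 'n) \<Rightarrow> 'n \<Rightarrow> real^('n + 'n) \<Rightarrow> real" where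
  "Dp g z i X = X $ Inr i - (\<Sum>j\<in>UNIV. Gamma0 g z i j * X $ Inl j)"

definition G_low ::
  "real \<Rightarrow> (real \<Rightarrow> real) \<Rightarrow> (real^'n \<Rightarrow> real^'n^'n) \<Rightarrow> real^('n + 'n) \<Rightarrow> 'n \<Rightarrow> 'n \<Rightarrow> real" where
  "G_low c v g z i j =
     sqrt (2 * c * energy g z) * g (q_part z) $ i $ j
     + v (energy g z) * p_part z $ i * p_part z $ j"

definition H_up ::
  "real \<Rightarrow> (real \<Rightarrow> real) \<Rightarrow> (real^'n \<Rightarrow> real^'n^'n) \<Rightarrow> real^('n + 'n) \<Rightarrow> 'n \<Rightarrow> 'n \<Rightarrow> real" where
  "H_up c v g z k l = (let t = energy g z in
     1 / sqrt (2 * c * t) * matrix_inv (g (q_part z)) $ k $ l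
     - v t / (2 * t * (c + sqrt (2 * c * t) * v t)) * g0 g z k * g0 g z l)"

text \<open>The components, in the induced charts, of $G = G_{ij}dq^idq^j + H^{ij}Dp_iDp_j$ and of the
  endomorphism $J$ with $J\frac{\delta}{\delta q^i} = G_{ik}\frac{\partial}{\partial p_k}$ and
  $J\frac{\partial}{\partial p_i} = -H^{ik}\frac{\delta}{\delta q^k}$.\<close>

definition metric_G :: "real \<Rightarrow> (real \<Rightarrow> real) \<Rightarrow> ('i \<Rightarrow> real^'n \<Rightarrow> real^'n^'n) \<Rightarrow>
    'i \<Rightarrow> real^('n + 'n) \<Rightarrow> real^('n + 'n)^('n + 'n)" where
  "metric_G c v g i z = (\<chi> a b. let X = axis a 1; Y = axis b 1 in
     (\<Sum>h\<in>UNIV. \<Sum>k\<in>UNIV. G_low c v (g i) z h k * dq h X * dq k Y)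
     + (\<Sum>h\<in>UNIV. \<Sum>k\<in>UNIV. H_up c v (g i) z h k * Dp (g i) z h X * Dp (g i) z k Y))"

definition structure_J :: "real \<Rightarrow> (real \<Rightarrow> real) \<Rightarrow> ('i \<Rightarrow> real^'n \<Rightarrow> real^'n^'n) \<Rightarrow>
    'i \<Rightarrow> real^('n + 'n) \<Rightarrow> real^('n + 'n)^('n + 'n)" where
  "structure_J c v g i z = matrix (\<lambda>X.
     (\<Sum>h\<in>UNIV. dq h X *\<^sub>R (\<Sum>k\<in>UNIV. G_low c v (g i) z h k *\<^sub>R partial_p k))
     + (\<Sum>h\<in>UNIV. Dp (g i) z h X *\<^sub>R (- (\<Sum>k\<in>UNIV. H_up c v (g i) z h k *\<^sub>R delta_q (g i) z k))))"

lemma dq_delta_q: "dq i (delta_q g z j) = (if i = j then 1 else 0)"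
  and dq_partial_p: "dq i (partial_p j) = 0"
  and Dp_partial_p: "Dp g z i (partial_p j) = (if i = j then 1 else 0)"
  by (auto simp: dq_def Dp_def delta_q_def partial_p_def axis_def)

lemma Dp_delta_q:
  assumes "\<And>h k. Gamma0 g z h k = Gamma0 g z k h"
  shows "Dp g z i (delta_q g z j) = 0"
proof -
  have "(\<Sum>k\<in>UNIV. Gamma0 g z i k * axis (Inl j) 1 $ Inl k) = (\<Sum>k\<in>UNIV. if k = j then Gamma0 g z i k else 0)"
    by (intro sum.cong) (auto simp: axis_def)
  moreover have "(\<Sum>h\<in>UNIV. Gamma0 g z j h * axis (Inr h) 1 $ Inr i) = (\<Sum>h\<in>UNIV. if h = i then Gamma0 g z j h else 0)"
    by (intro sum.cong) (auto simp: axis_def)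
  ultimately show ?thesis
    using assms[of i j] by (simp add: Dp_def delta_q_def axis_def[of _ "1::real"] sum.delta)
qed

lemma structure_J_mult:
  fixes g :: "'i \<Rightarrow> real^'n \<Rightarrow> real^'n^'n"
  shows "structure_J c v g i z *v X =
     (\<Sum>h\<in>UNIV. dq h X *\<^sub>R (\<Sum>k\<in>UNIV. G_low c v (g i) z h k *\<^sub>R partial_p k))
     + (\<Sum>h\<in>UNIV. Dp (g i) z h X *\<^sub>R (- (\<Sum>k\<in>UNIV. H_up c v (g i) z h k *\<^sub>R delta_q (g i) z k)))"
proof -
  have dq: "linear (dq h)" for h :: 'n
    by (auto simp: linear_iff dq_def)
  have Dp: "linear (Dp (g i) z h)" for h
    by (auto simp: linear_iff Dp_def algebra_simps sum.distrib sum_distrib_left)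
  have sc: "linear (\<lambda>X. f X *\<^sub>R b)" if "linear f"
    for f :: "real^('n + 'n) \<Rightarrow> real" and b :: "real^('n + 'n)"
    using that by (auto simp: linear_iff scaleR_left_distrib)
  have "linear (\<lambda>X.
     (\<Sum>h\<in>UNIV. dq h X *\<^sub>R (\<Sum>k\<in>UNIV. G_low c v (g i) z h k *\<^sub>R partial_p k))
     + (\<Sum>h\<in>UNIV. Dp (g i) z h X *\<^sub>R (- (\<Sum>k\<in>UNIV. H_up c v (g i) z h k *\<^sub>R delta_q (g i) z k))))"
    by (intro linear_compose_add linear_compose_sum ballI sc dq Dp)
  then show ?thesis
    unfolding structure_J_def by (simp add: matrix_vector_mul)
qed

end

theory Submission
  imports Defs
begin

text \<open>
  Everything except the passage between charts is a computation in one chart \<open>(q, p)\<close> of the bundle, with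
  tangent vectors \<open>X\<close> described by \<open>q(X)\<close> and \<open>Dp(X)\<close>. There \<open>J\<close> interchanges the horizontal and the vertical
  space by means of the inverse matrices \<open>(G\<^sub>i\<^sub>j)\<close> and \<open>(H\<^sup>k\<^sup>l)\<close>, which makes the metric Hermitian, and the
  fundamental form becomes the canonical symplectic form up to sign (\<open>fundamental_form_canonical\<close>). Its
  components are constant, so it is closed.

  Integrability needs to be checked on horizontal vectors only. As \<open>g\<close>, \<open>p\<close> and \<open>t\<close> are parallel along
  horizontal directions, so is \<open>(G\<^sub>i\<^sub>j)\<close>, and the Nijenhuis tensor reduces to the difference between
  \<open>G\<^sub>i\<^sub>k \<partial>G\<^sub>j\<^sub>l / \<partial>p\<^sub>k - G\<^sub>j\<^sub>k \<partial>G\<^sub>i\<^sub>l / \<partial>p\<^sub>k\<close> and the curvature of the base contracted with \<open>p\<close>. For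
  constant curvature \<open>c\<close> both are \<open>c (p\<^sub>i g\<^sub>j\<^sub>l - p\<^sub>j g\<^sub>i\<^sub>l)\<close> (\<open>nijenhuis_horizontal\<close>).

  The Einstein equation comes from a trace of the connection. On any Kaehler manifold
  \<open>J\<close> is parallel (\<open>nabla_J_eq_0\<close>), the Ricci tensor satisfies \<open>2 Ric(Y, Z) = trace (J R(Y, JZ))\<close> (\<open>ricci_trace\<close>), and
  the two-form \<open>trace (J R)\<close> is the exterior derivative of a one-form obtained from the connection and a
  Lagrangian subbundle, here the vertical one (\<open>trace_J_curvature\<close>). By the Koszul formula this one-form is a
  function of \<open>t\<close> times the canonical form \<open>p\<^sub>i dq\<^sup>i\<close> (\<open>ricci_potential\<close>), namely
  \<open>c (2 - n) / sqrt (2 c t) + 2 t v' + (n + 1) v\<close>. If the function is a constant, the Ricci form is a multiple of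
  the canonical symplectic form, that is, of the fundamental form (\<open>ricci_eq_metric\<close>). The function \<open>v\<close> of the
  theorem is a solution of the resulting linear differential equation, with Einstein constant
  \<open>- (n + 1) B / 2\<close>.

  Globally, the Christoffel symbols of the base transform with the second derivatives of the coordinate
  change that also occur in the differential of the induced change of the \<open>p\<^sub>i\<close>. Hence \<open>Dp\<close>, and with it \<open>G\<close>
  and \<open>J\<close>, are tensorial. The topological conditions are inherited from the base.
\<close>

section \<open>Calculus with partial derivatives\<close>

lemma frechet_derivative_eq:
  "(f has_derivative f') (at x) \<Longrightarrow> frechet_derivative f (at x) = f'"
  using frechet_derivative_at by metis

lemma partial_deriv_eq:
  "(f has_derivative f') (at x) \<Longrightarrow> partial_deriv i f x = f' (axis i 1)"
  by (simp add: partial_deriv_def frechet_derivative_eq)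

lemma differentiable_has_derivative:
  "f differentiable (at x) \<Longrightarrow> (f has_derivative frechet_derivative f (at x)) (at x)"
  by (simp add: frechet_derivative_works[symmetric])

lemma frechet_derivative_partials:
  fixes f :: "real^'k \<Rightarrow> 'b::real_normed_vector"
  assumes "f differentiable (at x)"
  shows "frechet_derivative f (at x) X = (\<Sum>i\<in>UNIV. X $ i *\<^sub>R partial_deriv i f x)"
proof -
  interpret linear "frechet_derivative f (at x)"
    using assms by (rule linear_frechet_derivative)
  have "X = (\<Sum>i\<in>UNIV. X $ i *\<^sub>R axis i 1)"
    by (simp add: basis_expansion flip: scalar_mult_eq_scaleR)
  then have "frechet_derivative f (at x) X = frechet_derivative f (at x) (\<Sum>i\<in>UNIV. X $ i *\<^sub>R axis i 1)"
    by simp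
  then show ?thesis
    by (simp add: sum scaleR partial_deriv_def)
qed

lemma partial_deriv_cong_open:
  assumes "open S" "x \<in> S" "\<And>y. y \<in> S \<Longrightarrow> f y = g y" 
  shows "partial_deriv i f x = partial_deriv i g x"
proof -
  have "(f has_derivative f') (at x) \<longleftrightarrow> (g has_derivative f') (at x)" for f'
    using assms has_derivative_transform_within_open[of f f' x UNIV S g]
      has_derivative_transform_within_open[of g f' x UNIV S f] by auto
  then show ?thesis
    by (simp add: partial_deriv_def frechet_derivative_def)
qed

lemma frechet_derivative_cong_open:
  assumes "open S" "x \<in> S" "\<And>y. y \<in> S \<Longrightarrow> f y = g y" 
  shows "frechet_derivative f (at x) = frechet_derivative g (at x)"
proof -
  have "(f has_derivative f') (at x) \<longleftrightarrow> (g has_derivative f') (at x)" for f'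
    using assms has_derivative_transform_within_open[of f f' x UNIV S g]
      has_derivative_transform_within_open[of g f' x UNIV S f] by auto
  then show ?thesis
    by (simp add: frechet_derivative_def)
qed

lemma differentiable_cong_open:
  assumes "open S" "x \<in> S" "\<And>y. y \<in> S \<Longrightarrow> f y = g y"
  shows "f differentiable (at x) \<longleftrightarrow> g differentiable (at x)"
  using assms has_derivative_transform_within_open[of f _ x UNIV S g]
      has_derivative_transform_within_open[of g _ x UNIV S f] unfolding differentiable_def by metis

lemma differentiable_bilinear:
  assumes "bounded_bilinear bl" "f differentiable (at x)" "g differentiable (at x)"
  shows "(\<lambda>x. bl (f x) (g x)) differentiable (at x)"
  using bounded_bilinear.FDERIV[OF assms(1) differentiable_has_derivative[OF assms(2)]
      differentiable_has_derivative[OF assms(3)]] by (rule differentiableI)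

lemma frechet_derivative_bilinear:
  assumes "bounded_bilinear bl" "f differentiable (at x)" "g differentiable (at x)"
  shows "frechet_derivative (\<lambda>x. bl (f x) (g x)) (at x) X =
    bl (frechet_derivative f (at x) X) (g x) + bl (f x) (frechet_derivative g (at x) X)"
  by (simp add: frechet_derivative_eq[OF bounded_bilinear.FDERIV[OF assms(1)
        differentiable_has_derivative[OF assms(2)] differentiable_has_derivative[OF assms(3)]]])

lemma partial_deriv_bilinear:
  assumes "bounded_bilinear bl" "f differentiable (at x)" "g differentiable (at x)"
  shows "partial_deriv i (\<lambda>x. bl (f x) (g x)) x =
    bl (partial_deriv i f x) (g x) + bl (f x) (partial_deriv i g x)"
  by (simp add: partial_deriv_def frechet_derivative_bilinear[OF assms])

lemma differentiable_bounded_linear: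
  assumes "bounded_linear L" "f differentiable (at x)"
  shows "(\<lambda>x. L (f x)) differentiable (at x)"
  using bounded_linear.has_derivative[OF assms(1) differentiable_has_derivative[OF assms(2)]]
  by (rule differentiableI)

lemma frechet_derivative_bounded_linear:
  assumes "bounded_linear L" "f differentiable (at x)"
  shows "frechet_derivative (\<lambda>x. L (f x)) (at x) X = L (frechet_derivative f (at x) X)"
  by (simp add: frechet_derivative_eq[OF bounded_linear.has_derivative[OF assms(1)
        differentiable_has_derivative[OF assms(2)]]])

lemma partial_deriv_bounded_linear:
  assumes "bounded_linear L" "f differentiable (at x)"
  shows "partial_deriv i (\<lambda>x. L (f x)) x = L (partial_deriv i f x)"
  by (simp add: partial_deriv_def frechet_derivative_bounded_linear[OF assms])

lemma frechet_derivative_add: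
  assumes "f differentiable (at x)" "g differentiable (at x)"
  shows "frechet_derivative (\<lambda>x. f x + g x) (at x) X =
    frechet_derivative f (at x) X + frechet_derivative g (at x) X"
  by (simp add: frechet_derivative_eq[OF has_derivative_add[OF
        differentiable_has_derivative[OF assms(1)] differentiable_has_derivative[OF assms(2)]]])

lemma frechet_derivative_diff:
  assumes "f differentiable (at x)" "g differentiable (at x)"
  shows "frechet_derivative (\<lambda>x. f x - g x) (at x) X =
    frechet_derivative f (at x) X - frechet_derivative g (at x) X"
  by (simp add: frechet_derivative_eq[OF has_derivative_diff[OF
        differentiable_has_derivative[OF assms(1)] differentiable_has_derivative[OF assms(2)]]])

lemma frechet_derivative_sum:
  assumes "\<And>i. i \<in> I \<Longrightarrow> f i differentiable (at x)"
  shows "frechet_derivative (\<lambda>x. \<Sum>i\<in>I. f i x) (at x) X =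
    (\<Sum>i\<in>I. frechet_derivative (f i) (at x) X)"
  by (subst frechet_derivative_eq[OF has_derivative_sum])
    (auto intro!: differentiable_has_derivative assms)

lemma partial_deriv_add:
  assumes "f differentiable (at x)" "g differentiable (at x)"
  shows "partial_deriv i (\<lambda>x. f x + g x) x = partial_deriv i f x + partial_deriv i g x"
  by (simp add: partial_deriv_def frechet_derivative_add[OF assms])

lemma partial_deriv_diff:
  assumes "f differentiable (at x)" "g differentiable (at x)"
  shows "partial_deriv i (\<lambda>x. f x - g x) x = partial_deriv i f x - partial_deriv i g x"
  by (simp add: partial_deriv_def frechet_derivative_diff[OF assms])

lemma partial_deriv_const [simp]: "partial_deriv i (\<lambda>x. c) x = 0"
  by (simp add: partial_deriv_def)

lemma partial_deriv_vec_nth: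
  fixes f :: "real^'k \<Rightarrow> 'b::euclidean_space^'l"
  assumes "f differentiable (at x)"
  shows "partial_deriv i (\<lambda>x. f x $ j) x = partial_deriv i f x $ j"
  by (rule partial_deriv_bounded_linear[OF bounded_linear_vec_nth assms])

lemma differentiable_vec_nth:
  fixes f :: "real^'k \<Rightarrow> 'b::euclidean_space^'l"
  shows "f differentiable (at x) \<Longrightarrow> (\<lambda>x. f x $ j) differentiable (at x)"
  by (rule differentiable_bounded_linear[OF bounded_linear_vec_nth])

text \<open>The bilinear and linear operations of matrix algebra are bounded, as the spaces are
  finite-dimensional; this makes the product rule available for all of them.\<close>

lemma bounded_bilinear_matrix_mult:
  "bounded_bilinear ((**) :: real^'l^'m \<Rightarrow> real^'k^'l \<Rightarrow> real^'k^'m)"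
  unfolding bilinear_conv_bounded_bilinear[symmetric] bilinear_def linear_iff
  by (auto simp: 
      matrix_matrix_mult_def vec_eq_iff sum.distrib sum_distrib_left algebra_simps)

lemma bounded_bilinear_matrix_vector_mult:
  "bounded_bilinear ((*v) :: real^'l^'m \<Rightarrow> real^'l \<Rightarrow> real^'m)"
  unfolding bilinear_conv_bounded_bilinear[symmetric] bilinear_def linear_iff
  by (auto simp: matrix_vector_mult_def vec_eq_iff sum.distrib sum_distrib_left algebra_simps)

lemma bounded_linear_transpose: "bounded_linear (transpose :: real^'l^'m \<Rightarrow> real^'m^'l)"
  unfolding linear_conv_bounded_linear[symmetric] linear_iff
  by (auto simp: transpose_def vec_eq_iff)

lemma bounded_linear_trace: "bounded_linear (trace :: real^'l^'l \<Rightarrow> real)"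
  unfolding linear_conv_bounded_linear[symmetric] linear_iff
  by (auto simp: trace_def sum.distrib sum_distrib_left)

section \<open>Smooth functions\<close>

lemma Ck_on_cong:
  assumes "open S" "\<And>x. x \<in> S \<Longrightarrow> f x = g x"
  shows "Ck_on m S f = Ck_on m S g"
  using assms(2)
proof (induction m arbitrary: f g)
  case 0
  then show ?case by (simp cong: continuous_on_cong)
next
  case (Suc m)
  have "Ck_on m S (partial_deriv i f) = Ck_on m S (partial_deriv i g)" for i
    by (rule Suc.IH) (use partial_deriv_cong_open[OF assms(1)] Suc.prems in blast)
  moreover have "f differentiable (at x) \<longleftrightarrow> g differentiable (at x)" if "x \<in> S" for x
    using differentiable_cong_open[OF assms(1) that] Suc.prems by blast
  ultimately show ?case by simp
qed

lemma Ck_on_Suc: "Ck_on (Suc m) S f \<Longrightarrow> Ck_on m S f"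
proof (induction m arbitrary: f)
  case 0
  then show ?case
    by (auto intro!: continuous_at_imp_continuous_on differentiable_imp_continuous_within)
qed auto

lemma Ck_on_const: "Ck_on m S (\<lambda>x. c)"
proof (induction m arbitrary: c)
  case (Suc m)
  then show ?case
    unfolding Ck_on.simps partial_deriv_const[abs_def] by auto
qed simp

lemma Ck_on_add:
  assumes "open S" "Ck_on m S f" "Ck_on m S g"
  shows "Ck_on m S (\<lambda>x. f x + g x)"
  using assms(2,3)
proof (induction m arbitrary: f g)
  case (Suc m)
  have "Ck_on m S (partial_deriv i (\<lambda>x. f x + g x))" for i
  proof (subst Ck_on_cong[OF assms(1)])
    show "x \<in> S \<Longrightarrow> partial_deriv i (\<lambda>x. f x + g x) x = partial_deriv i f x + partial_deriv i g x" for x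
      using Suc.prems by (auto simp: partial_deriv_add)
  qed (use Suc in auto)
  then show ?case using Suc.prems by auto
qed (auto intro: continuous_intros)

lemma Ck_on_bounded_linear:
  assumes "open S" "bounded_linear L" "Ck_on m S f"
  shows "Ck_on m S (\<lambda>x. L (f x))"
  using assms(3)
proof (induction m arbitrary: f)
  case 0
  then show ?case
    using bounded_linear.continuous_on[OF assms(2)] by auto
next
  case (Suc m)
  have "Ck_on m S (partial_deriv i (\<lambda>x. L (f x)))" for i
  proof (subst Ck_on_cong[OF assms(1)])
    show "x \<in> S \<Longrightarrow> partial_deriv i (\<lambda>x. L (f x)) x = L (partial_deriv i f x)" for x
      using Suc.prems by (auto simp: partial_deriv_bounded_linear[OF assms(2)])
  qed (use Suc in auto)
  then show ?case using Suc.prems by (auto intro: differentiable_bounded_linear[OF assms(2)])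
qed

lemma Ck_on_bilinear:
  assumes "open S" "bounded_bilinear bl" "Ck_on m S f" "Ck_on m S g"
  shows "Ck_on m S (\<lambda>x. bl (f x) (g x))"
  using assms(3,4)
proof (induction m arbitrary: f g)
  case 0
  then show ?case
    using bounded_bilinear.continuous_on[OF assms(2)] by auto
next
  case (Suc m)
  have "Ck_on m S (partial_deriv i (\<lambda>x. bl (f x) (g x)))" for i
  proof (subst Ck_on_cong[OF assms(1)])
    show "x \<in> S \<Longrightarrow> partial_deriv i (\<lambda>x. bl (f x) (g x)) x =
        bl (partial_deriv i f x) (g x) + bl (f x) (partial_deriv i g x)" for x
      using Suc.prems by (auto simp: partial_deriv_bilinear[OF assms(2)])
    show "Ck_on m S (\<lambda>x. bl (partial_deriv i f x) (g x) + bl (f x) (partial_deriv i g x))"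
      using Suc.prems Suc.prems[THEN Ck_on_Suc] by (intro Ck_on_add[OF assms(1)] Suc.IH) auto
  qed
  then show ?case using Suc.prems by (auto intro: differentiable_bilinear[OF assms(2)])
qed

lemma Ck_on_sum:
  assumes "open S" "\<And>i. i \<in> I \<Longrightarrow> Ck_on m S (f i)"
  shows "Ck_on m S (\<lambda>x. \<Sum>i\<in>I. f i x)"
  using assms(2)
proof (induction I rule: infinite_finite_induct)
  case (insert i I)
  then show ?case by (simp add: Ck_on_add[OF assms(1)])
qed (auto simp: Ck_on_const)

lemma Ck_on_inverse:
  fixes f :: "real^'k \<Rightarrow> real"
  assumes "open S" "Ck_on m S f" "\<And>x. x \<in> S \<Longrightarrow> f x \<noteq> 0"
  shows "Ck_on m S (\<lambda>x. inverse (f x))"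
  using assms(2)
proof (induction m)
  case 0
  then show ?case using assms(3) by (auto intro!: continuous_intros)
next
  case (Suc m)
  have D: "((\<lambda>x. inverse (f x)) has_derivative
      (\<lambda>X. - (inverse (f x) * frechet_derivative f (at x) X * inverse (f x)))) (at x)" if "x \<in> S" for x
    by (rule Deriv.has_derivative_inverse) (use that assms(3) Suc.prems differentiable_has_derivative in auto)
  have "Ck_on m S (partial_deriv i (\<lambda>x. inverse (f x)))" for i
  proof (subst Ck_on_cong[OF assms(1)])
    show "x \<in> S \<Longrightarrow> partial_deriv i (\<lambda>x. inverse (f x)) x =
        (- 1) *\<^sub>R ((inverse (f x) * partial_deriv i f x) * inverse (f x))" for x
      by (simp add: partial_deriv_eq[OF D]) (simp add: partial_deriv_def)
    show "Ck_on m S (\<lambda>x. (- 1) *\<^sub>R ((inverse (f x) * partial_deriv i f x) * inverse (f x)))"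
      using Suc Suc.prems[THEN Ck_on_Suc]
      by (intro Ck_on_bilinear[OF assms(1) bounded_bilinear_mult]
          Ck_on_bounded_linear[OF assms(1) bounded_linear_scaleR_right]) auto
  qed
  then show ?case using D by (auto simp: differentiable_def)
qed

lemma Ck_on_powr:
  fixes f :: "real^'k \<Rightarrow> real"
  assumes "open S" "Ck_on m S f" "\<And>x. x \<in> S \<Longrightarrow> f x > 0"
  shows "Ck_on m S (\<lambda>x. f x powr a)"
  using assms(2)
proof (induction m arbitrary: a)
  case 0
  then show ?case using assms(3) by (auto intro!: continuous_on_powr dest: less_imp_neq) (metis less_irrefl)
next
  case (Suc m)
  have D: "((\<lambda>x. f x powr a) has_derivative
      (\<lambda>X. a * f x powr (a - 1) * frechet_derivative f (at x) X)) (at x)" if "x \<in> S" for x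
  proof -
    have "((\<lambda>y. y powr a) has_real_derivative a * f x powr (a - 1)) (at (f x))"
      using assms(3)[OF that] by (auto intro!: derivative_eq_intros)
    then have "((\<lambda>y. y powr a) has_derivative (*) (a * f x powr (a - 1))) (at (f x))"
      by (simp add: has_field_derivative_def)
    from diff_chain_at[OF differentiable_has_derivative[of f x] this] show ?thesis
      using Suc.prems that by (auto simp: o_def)
  qed
  have "Ck_on m S (partial_deriv i (\<lambda>x. f x powr a))" for i
  proof (subst Ck_on_cong[OF assms(1)])
    show "x \<in> S \<Longrightarrow> partial_deriv i (\<lambda>x. f x powr a) x =
        a *\<^sub>R (f x powr (a - 1) * partial_deriv i f x)" for x
      by (simp add: partial_deriv_eq[OF D]) (simp add: partial_deriv_def)
    show "Ck_on m S (\<lambda>x. a *\<^sub>R (f x powr (a - 1) * partial_deriv i f x))"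
      using Suc Suc.prems[THEN Ck_on_Suc]
      by (intro Ck_on_bilinear[OF assms(1) bounded_bilinear_mult]
          Ck_on_bounded_linear[OF assms(1) bounded_linear_scaleR_right]) auto
  qed
  then show ?case using D by (auto simp: differentiable_def)
qed

lemma Ck_on_compose:
  fixes h :: "real^'k \<Rightarrow> real^'l"
  assumes "open S" "h ` S \<subseteq> T" "Ck_on m T f" "Ck_on m S h"
  shows "Ck_on m S (\<lambda>x. f (h x))"
  using assms(3,4)
proof (induction m arbitrary: f)
  case 0
  then show ?case using assms(2) by (auto intro: continuous_on_compose2)
next
  case (Suc m)
  have D: "((\<lambda>x. f (h x)) has_derivative
      (\<lambda>X. frechet_derivative f (at (h x)) (frechet_derivative h (at x) X))) (at x)" if "x \<in> S" for x
    using diff_chain_at[OF differentiable_has_derivative[of h x] differentiable_has_derivative[of f "h x"]]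
      that Suc.prems assms(2) by (auto simp: o_def)
  have "Ck_on m S (partial_deriv i (\<lambda>x. f (h x)))" for i
  proof (subst Ck_on_cong[OF assms(1)])
    show "x \<in> S \<Longrightarrow> partial_deriv i (\<lambda>x. f (h x)) x =
        (\<Sum>j\<in>UNIV. partial_deriv i h x $ j *\<^sub>R partial_deriv j f (h x))" for x
      using Suc.prems assms(2)
      by (simp add: partial_deriv_eq[OF D] image_subset_iff frechet_derivative_partials[of f]
          flip: partial_deriv_def)
    show "Ck_on m S (\<lambda>x. \<Sum>j\<in>UNIV. partial_deriv i h x $ j *\<^sub>R partial_deriv j f (h x))"
      using Suc Suc.prems[THEN Ck_on_Suc]
      by (intro Ck_on_sum[OF assms(1)] Ck_on_bilinear[OF assms(1) bounded_bilinear_scaleR]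
          Ck_on_bounded_linear[OF assms(1) bounded_linear_vec_nth]) auto
  qed
  then show ?case using D by (auto simp: differentiable_def)
qed

lemma smooth_on_open: "smooth_on S f \<Longrightarrow> open S"
  by (simp add: smooth_on_def)

lemma smooth_on_differentiable: "smooth_on S f \<Longrightarrow> x \<in> S \<Longrightarrow> f differentiable (at x)"
  unfolding smooth_on_def using Ck_on.simps(2)[of 0 S f] by blast

lemma smooth_on_continuous: "smooth_on S f \<Longrightarrow> continuous_on S f"
  unfolding smooth_on_def using Ck_on.simps(1) by blast

lemma smooth_on_cong:
  assumes "smooth_on S g" "\<And>x. x \<in> S \<Longrightarrow> f x = g x"
  shows "smooth_on S f"
  using assms Ck_on_cong[of S f g] by (simp add: smooth_on_def)

named_theorems smooth_intros

lemma smooth_on_partial_deriv [smooth_intros]: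
  "smooth_on S f \<Longrightarrow> smooth_on S (partial_deriv i f)"
  unfolding smooth_on_def using Ck_on.simps(2) by blast

lemma smooth_on_const [smooth_intros]: "open S \<Longrightarrow> smooth_on S (\<lambda>x. c)"
  by (simp add: smooth_on_def Ck_on_const)

lemma smooth_on_bounded_linear:
  "bounded_linear L \<Longrightarrow> smooth_on S f \<Longrightarrow> smooth_on S (\<lambda>x. L (f x))"
  by (simp add: smooth_on_def Ck_on_bounded_linear)

lemma smooth_on_bilinear:
  "bounded_bilinear bl \<Longrightarrow> smooth_on S f \<Longrightarrow> smooth_on S g \<Longrightarrow> smooth_on S (\<lambda>x. bl (f x) (g x))"
  by (simp add: smooth_on_def Ck_on_bilinear)

lemmas smooth_on_mult [smooth_intros] = smooth_on_bilinear[OF bounded_bilinear_mult]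
  and smooth_on_scaleR [smooth_intros] = smooth_on_bilinear[OF bounded_bilinear_scaleR]
  and smooth_on_inner [smooth_intros] = smooth_on_bilinear[OF bounded_bilinear_inner]
  and smooth_on_matrix_vector_mult [smooth_intros] =
    smooth_on_bilinear[OF bounded_bilinear_matrix_vector_mult]
  and smooth_on_minus [smooth_intros] = smooth_on_bounded_linear[OF bounded_linear_minus[OF bounded_linear_ident]]

lemma smooth_on_vec_nth [smooth_intros]:
  fixes f :: "real^'k \<Rightarrow> 'b::euclidean_space^'l"
  shows "smooth_on S f \<Longrightarrow> smooth_on S (\<lambda>x. f x $ i)"
  by (rule smooth_on_bounded_linear[OF bounded_linear_vec_nth])

lemma smooth_on_add [smooth_intros]:
  "smooth_on S f \<Longrightarrow> smooth_on S g \<Longrightarrow> smooth_on S (\<lambda>x. f x + g x)"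
  by (simp add: smooth_on_def Ck_on_add)

lemma smooth_on_diff [smooth_intros]:
  "smooth_on S f \<Longrightarrow> smooth_on S g \<Longrightarrow> smooth_on S (\<lambda>x. f x - g x)"
  using smooth_on_add[of S f "\<lambda>x. - g x"] smooth_on_minus[of S g] by simp

lemma smooth_on_sum [smooth_intros]:
  "open S \<Longrightarrow> (\<And>i. i \<in> I \<Longrightarrow> smooth_on S (f i)) \<Longrightarrow> smooth_on S (\<lambda>x. \<Sum>i\<in>I. f i x)"
  by (simp add: smooth_on_def Ck_on_sum)

lemma smooth_on_inverse [smooth_intros]:
  fixes f :: "real^'k \<Rightarrow> real"
  shows "smooth_on S f \<Longrightarrow> (\<And>x. x \<in> S \<Longrightarrow> f x \<noteq> 0) \<Longrightarrow> smooth_on S (\<lambda>x. inverse (f x))"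
  by (simp add: smooth_on_def Ck_on_inverse)

lemma smooth_on_divide [smooth_intros]:
  fixes f :: "real^'k \<Rightarrow> real"
  shows "smooth_on S f \<Longrightarrow> smooth_on S g \<Longrightarrow> (\<And>x. x \<in> S \<Longrightarrow> g x \<noteq> 0) \<Longrightarrow> smooth_on S (\<lambda>x. f x / g x)"
  using smooth_on_mult[of S f "\<lambda>x. inverse (g x)"] smooth_on_inverse[of S g]
  by (simp add: divide_inverse)

lemma smooth_on_powr [smooth_intros]:
  fixes f :: "real^'k \<Rightarrow> real"
  shows "smooth_on S f \<Longrightarrow> (\<And>x. x \<in> S \<Longrightarrow> f x > 0) \<Longrightarrow> smooth_on S (\<lambda>x. f x powr a)"
  by (simp add: smooth_on_def Ck_on_powr)

lemma smooth_on_sqrt [smooth_intros]: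
  fixes f :: "real^'k \<Rightarrow> real"
  assumes "smooth_on S f" "\<And>x. x \<in> S \<Longrightarrow> f x > 0"
  shows "smooth_on S (\<lambda>x. sqrt (f x))"
  by (rule smooth_on_cong[OF smooth_on_powr[OF assms, where a="1/2"]])
    (use assms(2) in \<open>auto simp: powr_half_sqrt less_imp_le\<close>)

lemma smooth_on_compose:
  fixes h :: "real^'k \<Rightarrow> real^'l"
  assumes "smooth_on T f" "smooth_on S h" "h ` S \<subseteq> T"
  shows "smooth_on S (\<lambda>x. f (h x))"
  using assms Ck_on_compose[of S h T _ f] by (simp add: smooth_on_def)

lemma smooth_on_ident: "open S \<Longrightarrow> smooth_on S (\<lambda>x::real^'k. x)"
proof -
  have "partial_deriv i (\<lambda>x::real^'k. x) = (\<lambda>x. axis i 1)" for i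
    by (simp add: partial_deriv_def fun_eq_iff)
  then have "Ck_on m S (\<lambda>x::real^'k. x)" for m
    by (cases m) (auto simp: Ck_on_const)
  then show "open S \<Longrightarrow> ?thesis" by (simp add: smooth_on_def)
qed

lemma smooth_on_linear:
  fixes L :: "real^'k \<Rightarrow> 'b::real_normed_vector"
  shows "bounded_linear L \<Longrightarrow> open S \<Longrightarrow> smooth_on S L"
  using smooth_on_bounded_linear[of L S "\<lambda>x. x"] smooth_on_ident by blast

lemma smooth_on_vec:
  fixes f :: "real^'k \<Rightarrow> 'b::euclidean_space^'l"
  assumes "\<And>i. smooth_on S (\<lambda>x. f x $ i)"
  shows "smooth_on S f"
proof -
  have L: "bounded_linear (axis i :: 'b \<Rightarrow> 'b^'l)" for i
    unfolding linear_conv_bounded_linear[symmetric] linear_iff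
    by (auto simp: axis_def vec_eq_iff)
  have "f = (\<lambda>x. \<Sum>i\<in>UNIV. axis i (f x $ i))"
    by (auto simp: fun_eq_iff vec_eq_iff axis_def sum.delta' sum.delta if_distrib cong: if_cong)
  moreover have "smooth_on S (\<lambda>x. \<Sum>i\<in>UNIV. axis i (f x $ i))"
    using smooth_on_open[OF assms] by (intro smooth_on_sum smooth_on_bounded_linear[OF L] assms)
  ultimately show ?thesis by simp
qed

lemma smooth_on_vec_lambda [smooth_intros]:
  fixes f :: "'l::finite \<Rightarrow> real^'k \<Rightarrow> 'b::euclidean_space"
  shows "(\<And>i. smooth_on S (f i)) \<Longrightarrow> smooth_on S (\<lambda>x. \<chi> i. f i x)"
  by (rule smooth_on_vec) simp

lemma smooth_on_prod [smooth_intros]: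
  fixes f :: "'i \<Rightarrow> real^'k \<Rightarrow> real"
  assumes "open S"
  shows "(\<And>i. i \<in> I \<Longrightarrow> smooth_on S (f i)) \<Longrightarrow> smooth_on S (\<lambda>x. \<Prod>i\<in>I. f i x)"
  by (induction I rule: infinite_finite_induct)
    (auto intro: smooth_on_const smooth_on_mult assms)

lemma smooth_on_det [smooth_intros]:
  fixes A :: "real^'k \<Rightarrow> real^'l^'l"
  shows "smooth_on S A \<Longrightarrow> smooth_on S (\<lambda>x. det (A x))"
  unfolding det_def using smooth_on_open by (auto intro!: smooth_intros)

lemma matrix_inv_inverse:
  fixes A :: "real^'l^'l"
  assumes "invertible A"
  shows "A ** matrix_inv A = mat 1" "matrix_inv A ** A = mat 1"
  using someI_ex[OF assms[unfolded invertible_def]] by (auto simp: matrix_inv_def)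

lemma matrix_inv_cramer:
  fixes A :: "real^'l^'l"
  assumes "invertible A"
  shows "matrix_inv A $ k $ l = det (\<chi> i j. if j = k then axis l 1 $ i else A $ i $ j) / det A"
proof -
  have "A *v (matrix_inv A *v axis l 1) = axis l 1"
    using assms by (simp add: matrix_vector_mul_assoc matrix_inv_inverse)
  moreover have "det A \<noteq> 0"
    using assms by (simp add: invertible_det_nz)
  ultimately have "matrix_inv A *v axis l 1 =
      (\<chi> k. det (\<chi> i j. if j = k then axis l 1 $ i else A $ i $ j) / det A)"
    using cramer by blast
  then have "(matrix_inv A *v axis l 1) $ k = 
      det (\<chi> i j. if j = k then axis l 1 $ i else A $ i $ j) / det A"
    by (simp add: vec_eq_iff)
  then show ?thesis
    by (simp add: matrix_vector_mult_basis column_def)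
qed

text \<open>Cramer's rule expresses the entries of the inverse as quotients of determinants, hence
  as smooth functions.\<close>

lemma smooth_on_matrix_inv [smooth_intros]:
  fixes A :: "real^'k \<Rightarrow> real^'l^'l"
  assumes "smooth_on S A" "\<And>x. x \<in> S \<Longrightarrow> invertible (A x)"
  shows "smooth_on S (\<lambda>x. matrix_inv (A x))"
proof (intro smooth_on_vec)
  fix k l
  have "smooth_on S (\<lambda>x. if j = k then axis l 1 $ i else A x $ i $ j)" for i j
    using assms(1) smooth_on_open by (cases "j = k") (auto intro!: smooth_intros)
  then have "smooth_on S (\<lambda>x. det (\<chi> i j. if j = k then axis l 1 $ i else A x $ i $ j) / det (A x))"
    using assms by (intro smooth_intros) (auto simp: invertible_det_nz)
  then show "smooth_on S (\<lambda>x. matrix_inv (A x) $ k $ l)"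
    by (rule smooth_on_cong) (simp add: matrix_inv_cramer assms(2))
qed

section \<open>Symmetry of second derivatives\<close>

lemma second_difference_mvt:
  fixes f :: "real^'k \<Rightarrow> real"
  assumes f: "smooth_on S f" and h: "h > 0"
    and S: "\<And>s t. 0 \<le> s \<Longrightarrow> s \<le> h \<Longrightarrow> 0 \<le> t \<Longrightarrow> t \<le> h \<Longrightarrow> x + s *\<^sub>R axis i 1 + t *\<^sub>R axis j 1 \<in> S"
  shows "\<exists>y. dist y x \<le> 2 * h \<and>
    f (x + h *\<^sub>R axis i 1 + h *\<^sub>R axis j 1) - f (x + h *\<^sub>R axis i 1) - f (x + h *\<^sub>R axis j 1) + f x
      = h * h * partial_deriv j (partial_deriv i f) y"
proof -
  have line: "((\<lambda>s. F (a + s *\<^sub>R axis l 1)) has_real_derivative partial_deriv l F (a + s *\<^sub>R axis l 1)) (at s)"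
    if "smooth_on S F" "a + s *\<^sub>R axis l 1 \<in> S" for F :: "real^'k \<Rightarrow> real" and a s l
  proof -
    have 1: "((\<lambda>s. a + s *\<^sub>R axis l 1) has_derivative (\<lambda>t. t *\<^sub>R axis l 1)) (at s)"
      by (auto intro!: derivative_eq_intros)
    have D: "F differentiable at (a + s *\<^sub>R axis l 1)"
      using that smooth_on_differentiable by blast
    from diff_chain_at[OF 1 differentiable_has_derivative[OF D]]
    have "((\<lambda>s. F (a + s *\<^sub>R axis l 1)) has_derivative
        (\<lambda>t. frechet_derivative F (at (a + s *\<^sub>R axis l 1)) (t *\<^sub>R axis l 1))) (at s)"
      by (simp add: o_def)
    also have "(\<lambda>t. frechet_derivative F (at (a + s *\<^sub>R axis l 1)) (t *\<^sub>R axis l 1)) =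
        (*) (partial_deriv l F (a + s *\<^sub>R axis l 1))"
      using linear_frechet_derivative[OF D] by (auto simp: partial_deriv_def linear_scale fun_eq_iff)
    finally show ?thesis by (simp add: has_field_derivative_def)
  qed
  define u where "u s = f (x + s *\<^sub>R axis i 1 + h *\<^sub>R axis j 1) - f (x + s *\<^sub>R axis i 1)" for s
  have "(u has_real_derivative partial_deriv i f (x + s *\<^sub>R axis i 1 + h *\<^sub>R axis j 1)
      - partial_deriv i f (x + s *\<^sub>R axis i 1)) (at s)" if "0 \<le> s" "s \<le> h" for s
    unfolding u_def
    using line[OF f, of "x + h *\<^sub>R axis j 1" s i] line[OF f, of x s i] S[of s 0] S[of s h] h that
    by (intro DERIV_diff) (auto simp: algebra_simps)
  from MVT2[OF h this] obtain s where s: "0 < s" "s < h" and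
    us: "u h - u 0 = (h - 0) * (partial_deriv i f (x + s *\<^sub>R axis i 1 + h *\<^sub>R axis j 1)
      - partial_deriv i f (x + s *\<^sub>R axis i 1))"
    by auto
  have "((\<lambda>t. partial_deriv i f (x + s *\<^sub>R axis i 1 + t *\<^sub>R axis j 1)) has_real_derivative
      partial_deriv j (partial_deriv i f) (x + s *\<^sub>R axis i 1 + t *\<^sub>R axis j 1)) (at t)"
    if "0 \<le> t" "t \<le> h" for t
    using S[of s t] s that by (intro line smooth_on_partial_deriv f) auto
  from MVT2[OF h this] obtain t where t: "0 < t" "t < h" and
    ut: "partial_deriv i f (x + s *\<^sub>R axis i 1 + h *\<^sub>R axis j 1)
      - partial_deriv i f (x + s *\<^sub>R axis i 1 + 0 *\<^sub>R axis j 1) =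
      (h - 0) * partial_deriv j (partial_deriv i f) (x + s *\<^sub>R axis i 1 + t *\<^sub>R axis j 1)"
    by auto
  have "dist (x + s *\<^sub>R axis i 1 + t *\<^sub>R axis j 1) x \<le> norm (s *\<^sub>R axis i (1::real)) + norm (t *\<^sub>R axis j (1::real))"
    using norm_triangle_ineq[of "s *\<^sub>R axis i (1::real)" "t *\<^sub>R axis j (1::real)"] by (simp add: dist_norm add.assoc)
  also have "\<dots> \<le> 2 * h" using s t by simp
  finally show ?thesis
    using us ut by (intro exI[of _ "x + s *\<^sub>R axis i 1 + t *\<^sub>R axis j 1"]) (simp add: u_def)
qed

text \<open>The second difference over a small square equals either mixed derivative at a nearby point,
  by two applications of the mean value theorem; continuity then makes them agree at the corner.\<close>

lemma partial_deriv_commute_real: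
  fixes f :: "real^'k \<Rightarrow> real"
  assumes f: "smooth_on S f" and x: "x \<in> S"
  shows "partial_deriv i (partial_deriv j f) x = partial_deriv j (partial_deriv i f) x"
proof (rule ccontr)
  let ?F = "partial_deriv j (partial_deriv i f)" and ?G = "partial_deriv i (partial_deriv j f)"
  assume neq: "\<not> ?thesis"
  define e where "e = \<bar>?F x - ?G x\<bar> / 2"
  have e: "e > 0" using neq by (simp add: e_def)
  have "open S" using f by (rule smooth_on_open)
  then have cont: "isCont (partial_deriv a (partial_deriv b f)) x" for a b
    using x smooth_on_continuous[OF smooth_on_partial_deriv[OF smooth_on_partial_deriv[OF f]]]
    by (simp add: continuous_on_eq_continuous_at)
  then obtain d1 d2 where d: "d1 > 0" "d2 > 0" and
    d1: "\<And>y. dist y x < d1 \<Longrightarrow> dist (?F y) (?F x) < e" and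
    d2: "\<And>y. dist y x < d2 \<Longrightarrow> dist (?G y) (?G x) < e"
    using e cont[of i j] cont[of j i] unfolding continuous_at_eps_delta by metis
  obtain r where r: "r > 0" "ball x r \<subseteq> S"
    using \<open>open S\<close> x open_contains_ball by blast
  define h where "h = min r (min d1 d2) / 3"
  have h: "h > 0" "2 * h < r" "2 * h < d1" "2 * h < d2" using r d by (auto simp: h_def)
  have inS: "x + s *\<^sub>R axis a 1 + t *\<^sub>R axis b 1 \<in> S"
    if "0 \<le> s" "s \<le> h" "0 \<le> t" "t \<le> h" for s t a b
  proof -
    have "dist (x + s *\<^sub>R axis a 1 + t *\<^sub>R axis b 1) x \<le> norm (s *\<^sub>R axis a (1::real)) + norm (t *\<^sub>R axis b (1::real))"
      using norm_triangle_ineq[of "s *\<^sub>R axis a (1::real)" "t *\<^sub>R axis b (1::real)"] by (simp add: dist_norm add.assoc)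
    also have "\<dots> < r" using that h by simp
    finally show ?thesis using r by (auto simp: dist_commute subset_iff)
  qed
  obtain y where y: "dist y x \<le> 2 * h" and
    Fy: "f (x + h *\<^sub>R axis i 1 + h *\<^sub>R axis j 1) - f (x + h *\<^sub>R axis i 1) - f (x + h *\<^sub>R axis j 1) + f x
      = h * h * ?F y"
    using second_difference_mvt[OF f h(1), of x i j] inS by auto
  obtain y' where y': "dist y' x \<le> 2 * h" and
    Gy: "f (x + h *\<^sub>R axis j 1 + h *\<^sub>R axis i 1) - f (x + h *\<^sub>R axis j 1) - f (x + h *\<^sub>R axis i 1) + f x
      = h * h * ?G y'"
    using second_difference_mvt[OF f h(1), of x j i] inS by auto
  have "h * h * ?F y = h * h * ?G y'"
    using Fy Gy by (simp add: algebra_simps)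
  then have "?F y = ?G y'" using h by simp
  moreover have "dist (?F y) (?F x) < e" "dist (?G y') (?G x) < e"
    using d1[of y] d2[of y'] y y' h by auto
  ultimately have "dist (?F x) (?G x) < e + e"
    using dist_triangle3[of "?F x" "?G x" "?F y"] by simp
  then show False by (simp add: e_def dist_real_def)
qed

lemma partial_deriv_commute:
  fixes f :: "real^'k \<Rightarrow> 'b::euclidean_space"
  assumes f: "smooth_on S f" and x: "x \<in> S"
  shows "partial_deriv i (partial_deriv j f) x = partial_deriv j (partial_deriv i f) x"
proof (rule euclidean_eqI)
  fix b :: 'b
  have L: "bounded_linear (\<lambda>v. v \<bullet> b)" by (rule bounded_linear_inner_left)
  have "partial_deriv i (partial_deriv j f) x \<bullet> b = partial_deriv i (partial_deriv j (\<lambda>x. f x \<bullet> b)) x" for i j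
  proof -
    have "partial_deriv i (partial_deriv j f) x \<bullet> b = partial_deriv i (\<lambda>x. partial_deriv j f x \<bullet> b) x"
      using f x by (intro partial_deriv_bounded_linear[OF L, symmetric] smooth_on_differentiable[of S] smooth_intros)
    also have "\<dots> = partial_deriv i (partial_deriv j (\<lambda>x. f x \<bullet> b)) x"
      using f x by (intro partial_deriv_cong_open[OF smooth_on_open[OF f]])
        (auto simp: partial_deriv_bounded_linear[OF L] smooth_on_differentiable)
    finally show ?thesis .
  qed
  then show "partial_deriv i (partial_deriv j f) x \<bullet> b = partial_deriv j (partial_deriv i f) x \<bullet> b"
    using partial_deriv_commute_real[OF smooth_on_bounded_linear[OF L f] x] by metis
qed

section \<open>Local Riemannian geometry\<close>

lemma matrix_add_rdistrib: "((A::real^'l^'m) + B) ** C = A ** C + B ** C"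
  by (simp add: matrix_matrix_mult_def vec_eq_iff sum.distrib sum_subtractf sum_negf sum_distrib_left algebra_simps)

lemma matrix_diff_ldistrib: "(A::real^'l^'m) ** (B - C) = A ** B - A ** C"
  by (simp add: matrix_matrix_mult_def vec_eq_iff sum.distrib sum_subtractf sum_negf sum_distrib_left algebra_simps)

lemma matrix_diff_rdistrib: "((A::real^'l^'m) - B) ** C = A ** C - B ** C"
  by (simp add: matrix_matrix_mult_def vec_eq_iff sum.distrib sum_subtractf sum_negf sum_distrib_left algebra_simps)

lemma matrix_minus_left: "(- (A::real^'l^'m)) ** B = - (A ** B)"
  by (simp add: matrix_matrix_mult_def vec_eq_iff sum.distrib sum_subtractf sum_negf sum_distrib_left algebra_simps)

lemma matrix_minus_right: "(A::real^'l^'m) ** (- B) = - (A ** B)"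
  by (simp add: matrix_matrix_mult_def vec_eq_iff sum.distrib sum_subtractf sum_negf sum_distrib_left algebra_simps)

lemma matrix_scaleR_left: "(r *\<^sub>R (A::real^'l^'m)) ** B = r *\<^sub>R (A ** B)"
  by (simp add: matrix_matrix_mult_def vec_eq_iff sum.distrib sum_subtractf sum_negf sum_distrib_left algebra_simps)

lemma matrix_scaleR_right: "(A::real^'l^'m) ** (r *\<^sub>R B) = r *\<^sub>R (A ** B)"
  by (simp add: matrix_matrix_mult_def vec_eq_iff sum.distrib sum_subtractf sum_negf sum_distrib_left algebra_simps)

lemma matrix_zero_left [simp]: "(0::real^'l^'m) ** B = 0"
  by (simp add: matrix_matrix_mult_def vec_eq_iff sum.distrib sum_subtractf sum_negf sum_distrib_left algebra_simps)

lemma matrix_zero_right [simp]: "(A::real^'l^'m) ** 0 = 0"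
  by (simp add: matrix_matrix_mult_def vec_eq_iff sum.distrib sum_subtractf sum_negf sum_distrib_left algebra_simps)

lemma matrix_sum_left: "(\<Sum>i\<in>I. F i) ** (B::real^'l^'m) = (\<Sum>i\<in>I. F i ** B)"
  by (rule bounded_bilinear.sum_left[OF bounded_bilinear_matrix_mult])

lemma matrix_sum_right: "(B::real^'l^'m) ** (\<Sum>i\<in>I. F i) = (\<Sum>i\<in>I. B ** F i)"
  by (rule bounded_bilinear.sum_right[OF bounded_bilinear_matrix_mult])

lemma transpose_sum: "transpose (\<Sum>i\<in>I. F i :: real^'l^'m) = (\<Sum>i\<in>I. transpose (F i))"
  by (rule linear_sum[OF bounded_linear.linear[OF bounded_linear_transpose]])

lemmas matrix_sum_expand = matrix_sum_left matrix_sum_right matrix_scaleR_left matrix_scaleR_right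
  transpose_sum transpose_scalar

lemmas matrix_expand = matrix_add_ldistrib matrix_add_rdistrib matrix_diff_ldistrib
  matrix_diff_rdistrib matrix_minus_left matrix_minus_right matrix_mul_assoc

lemma transpose_add: "transpose ((A::real^'l^'m) + B) = transpose A + transpose B"
  and transpose_diff: "transpose ((A::real^'l^'m) - B) = transpose A - transpose B"
  by (auto simp: transpose_def vec_eq_iff)

lemma inner_matrix_transpose: "X \<bullet> ((A::real^'l^'m) *v Y) = (transpose A *v X) \<bullet> Y"
  by (simp only: dot_lmul_matrix[symmetric] transpose_matrix_vector)

lemma matrix_eq_inner:
  fixes A B :: "real^'l^'m"
  assumes "\<And>X Y. X \<bullet> (A *v Y) = X \<bullet> (B *v Y)"
  shows "A = B"
proof -
  have "A *v Y = B *v Y" for Y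
    by (rule vector_eq_rdot[THEN iffD1]) (use assms in \<open>simp add: inner_commute\<close>)
  then show ?thesis by (simp add: matrix_eq)
qed

lemma inner_axis_matrix: "axis i 1 \<bullet> ((A::real^'l^'m) *v axis j 1) = A $ i $ j"
  by (simp add: matrix_vector_mult_basis column_def inner_axis' )

lemma matrix_vector_minus: "(- (A::real^'l^'m)) *v X = - (A *v X)"
  "(A::real^'l^'m) *v (- X) = - (A *v X)"
  by (simp_all add: bounded_bilinear.minus_left[OF bounded_bilinear_matrix_vector_mult]
      bounded_bilinear.minus_right[OF bounded_bilinear_matrix_vector_mult])

lemma sum_rotate:
  "(\<Sum>a\<in>A. \<Sum>b\<in>B. \<Sum>c\<in>C. f a b c) = (\<Sum>b\<in>B. \<Sum>c\<in>C. \<Sum>a\<in>A. f a b c)"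
  by (subst sum.swap) (rule sum.cong[OF refl], rule sum.swap)

definition connection_matrix :: "(real^'k \<Rightarrow> real^'k^'k) \<Rightarrow> 'k \<Rightarrow> real^'k \<Rightarrow> real^'k^'k" where
  "connection_matrix g a y = (\<chi> l k. christoffel g l a k y)"

definition curvature_matrix :: "(real^'k \<Rightarrow> real^'k^'k) \<Rightarrow> 'k \<Rightarrow> 'k \<Rightarrow> real^'k \<Rightarrow> real^'k^'k" where
  "curvature_matrix g a b y = (\<chi> l k. riemann g l k a b y)"

locale local_metric =
  fixes U :: "(real^'k) set" and g :: "real^'k \<Rightarrow> real^'k^'k"
  assumes smooth: "smooth_on U g"
    and symmetric: "\<And>y. y \<in> U \<Longrightarrow> transpose (g y) = g y"
    and positive: "\<And>y X. y \<in> U \<Longrightarrow> X \<noteq> 0 \<Longrightarrow> X \<bullet> (g y *v X) > 0"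
begin

lemma open_U: "open U"
  using smooth by (rule smooth_on_open)

lemma invertible_g: "y \<in> U \<Longrightarrow> invertible (g y)"
  unfolding invertible_left_inverse matrix_left_invertible_ker
  using positive by (metis inner_zero_right less_irrefl)

lemma g_cancel_vector: "y \<in> U \<Longrightarrow> g y *v X = g y *v Y \<Longrightarrow> X = Y"
  using matrix_inv_inverse(2)[OF invertible_g, of y]
  by (metis matrix_vector_mul_assoc matrix_vector_mul_lid)

lemma g_cancel_matrix: "y \<in> U \<Longrightarrow> g y ** A = g y ** B \<Longrightarrow> A = B"
  using matrix_inv_inverse(2)[OF invertible_g, of y]
  by (metis matrix_mul_assoc matrix_mul_lid)

lemma g_sym: "y \<in> U \<Longrightarrow> g y $ i $ j = g y $ j $ i"
  using arg_cong[OF symmetric, of y "\<lambda>A. A $ j $ i"] by (simp add: transpose_def)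

lemma inner_g_commute: "y \<in> U \<Longrightarrow> X \<bullet> (g y *v Y) = Y \<bullet> (g y *v X)"
  using inner_matrix_transpose[of X "g y" Y] symmetric[of y] by (simp only: inner_commute)

lemma partial_deriv_g_sym:
  "y \<in> U \<Longrightarrow> partial_deriv a (\<lambda>z. g z $ i $ j) y = partial_deriv a (\<lambda>z. g z $ j $ i) y"
  by (rule partial_deriv_cong_open[OF open_U]) (auto simp: g_sym)

lemma smooth_christoffel: "smooth_on U (christoffel g k i j)"
  unfolding christoffel_def[abs_def]
  using smooth invertible_g open_U by (auto intro!: smooth_intros)

lemma smooth_connection: "smooth_on U (connection_matrix g a)"
  unfolding connection_matrix_def[abs_def] by (intro smooth_intros smooth_christoffel)

lemma christoffel_sym: "y \<in> U \<Longrightarrow> christoffel g k i j y = christoffel g k j i y"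
  unfolding christoffel_def
  by (intro arg_cong[of _ _ "(*) (1/2)"] sum.cong refl) (simp add: partial_deriv_g_sym[of y _ i j])

lemma lowered_connection:
  assumes "y \<in> U"
  shows "(g y ** connection_matrix g a y) $ l $ k = 1/2 *
    (partial_deriv a (\<lambda>z. g z $ k $ l) y + partial_deriv k (\<lambda>z. g z $ a $ l) y
        - partial_deriv l (\<lambda>z. g z $ a $ k) y)"
proof -
  define t :: "real^'k" where "t = (\<chi> l. 1/2 * (partial_deriv a (\<lambda>z. g z $ k $ l) y + partial_deriv k (\<lambda>z. g z $ a $ l) y
        - partial_deriv l (\<lambda>z. g z $ a $ k) y))"
  have "column k (connection_matrix g a y) = matrix_inv (g y) *v t"
    by (simp add: column_def connection_matrix_def christoffel_def t_def matrix_vector_mult_def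
        vec_eq_iff sum_distrib_left algebra_simps)
  then have "g y *v column k (connection_matrix g a y) = t"
    using matrix_inv_inverse[OF invertible_g[OF assms]] by (simp add: matrix_vector_mul_assoc)
  then have "(g y *v column k (connection_matrix g a y)) $ l = t $ l" by simp
  then show ?thesis
    by (simp add: t_def column_def matrix_vector_mult_def matrix_matrix_mult_def)
qed

lemma metric_compatible:
  assumes "y \<in> U"
  shows "partial_deriv a g y =
    transpose (connection_matrix g a y) ** g y + g y ** connection_matrix g a y"
proof -
  have "transpose (connection_matrix g a y) ** g y = transpose (g y ** connection_matrix g a y)"
    using symmetric[OF assms] by (simp add: matrix_transpose_mul)
  moreover have "partial_deriv a g y $ k $ l = partial_deriv a (\<lambda>z. g z $ k $ l) y" for k l
    using smooth assms smooth_on_differentiable[OF smooth assms]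
    by (simp add: partial_deriv_vec_nth differentiable_vec_nth)
  ultimately show ?thesis
    using assms by (simp add: vec_eq_iff transpose_def lowered_connection
        partial_deriv_g_sym[OF assms, of _ _ a] partial_deriv_g_sym[OF assms, of a] field_simps)
qed

lemma curvature_matrix_eq:
  assumes "y \<in> U"
  shows "curvature_matrix g a b y =
    partial_deriv a (connection_matrix g b) y - partial_deriv b (connection_matrix g a) y
    + connection_matrix g a y ** connection_matrix g b y
    - connection_matrix g b y ** connection_matrix g a y"
proof -
  have "partial_deriv a (connection_matrix g b) y $ l $ k = partial_deriv a (christoffel g l b k) y" for a b l k
    using smooth_on_differentiable[OF smooth_connection assms]
    by (simp add: differentiable_vec_nth flip: partial_deriv_vec_nth) (simp add: connection_matrix_def)
  then show ?thesis
    by (simp add: vec_eq_iff curvature_matrix_def riemann_def matrix_matrix_mult_def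
        connection_matrix_def sum_subtractf)
qed

text \<open>The second derivatives of the metric commute, while metric compatibility turns their
  difference into the symmetric part of the lowered curvature.\<close>

lemma curvature_matrix_skew:
  assumes y: "y \<in> U"
  shows "g y ** curvature_matrix g a b y + transpose (curvature_matrix g a b y) ** g y = 0"
proof -
  let ?C = "connection_matrix g"
  have gd: "g differentiable (at y)" and cd: "?C a differentiable (at y)" for a
    using smooth_on_differentiable[OF smooth y] smooth_on_differentiable[OF smooth_connection y] by auto
  have "partial_deriv a (partial_deriv b g) y =
      transpose (partial_deriv a (?C b) y) ** g y + transpose (?C b y) ** partial_deriv a g y
      + partial_deriv a g y ** ?C b y + g y ** partial_deriv a (?C b) y" for a b
  proof -
    have "partial_deriv a (partial_deriv b g) y =
        partial_deriv a (\<lambda>z. transpose (?C b z) ** g z + g z ** ?C b z) y"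
      by (rule partial_deriv_cong_open[OF open_U y]) (simp add: metric_compatible)
    also have "\<dots> = partial_deriv a (\<lambda>z. transpose (?C b z) ** g z) y + partial_deriv a (\<lambda>z. g z ** ?C b z) y"
      by (intro partial_deriv_add differentiable_bilinear[OF bounded_bilinear_matrix_mult]
          differentiable_bounded_linear[OF bounded_linear_transpose] gd cd)
    finally show ?thesis
      using gd cd by (simp add: partial_deriv_bilinear[OF bounded_bilinear_matrix_mult]
          partial_deriv_bounded_linear[OF bounded_linear_transpose]
          differentiable_bounded_linear[OF bounded_linear_transpose] add.assoc)
  qed
  note E = this[unfolded metric_compatible[OF y]]
  from partial_deriv_commute[OF smooth y, of a b, unfolded E] show ?thesis
    by (simp add: curvature_matrix_eq[OF y] transpose_add transpose_diff matrix_expand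
        matrix_transpose_mul algebra_simps)
qed

lemma riemann_bianchi:
  assumes y: "y \<in> U"
  shows "riemann g l k i j y + riemann g l i j k y + riemann g l j k i y = 0"
proof -
  have "partial_deriv a (christoffel g l b c) y = partial_deriv a (christoffel g l c b) y" for a b c l
    by (rule partial_deriv_cong_open[OF open_U y]) (rule christoffel_sym)
  note s = this[of _ _ k j] this[of _ _ k i] this[of _ _ i j]
  have "(\<Sum>m\<in>UNIV. christoffel g l a m y * christoffel g m b c y)
      = (\<Sum>m\<in>UNIV. christoffel g l a m y * christoffel g m c b y)" for a b c
    using christoffel_sym[OF y] by simp
  note t = this[of _ k j] this[of _ k i] this[of _ i j]
  show ?thesis
    unfolding riemann_def sum_subtractf s t by simp
qed

end

definition curvature_endo :: "(real^'k \<Rightarrow> real^'k^'k) \<Rightarrow> real^'k \<Rightarrow> real^'k \<Rightarrow> real^'k \<Rightarrow> real^'k^'k" where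
  "curvature_endo g y X Y = (\<Sum>i\<in>UNIV. \<Sum>j\<in>UNIV. (X $ i * Y $ j) *\<^sub>R curvature_matrix g i j y)"

lemma curvature_endo_component:
  "curvature_endo g y X Y $ l $ k = (\<Sum>i\<in>UNIV. \<Sum>j\<in>UNIV. X $ i * Y $ j * riemann g l k i j y)"
  by (simp add: curvature_endo_def curvature_matrix_def)

lemma curvature_operator_endo: "curvature_operator g y X Y Z = curvature_endo g y X Y *v Z"
proof -
  have "(\<Sum>i\<in>UNIV. \<Sum>j\<in>UNIV. \<Sum>k\<in>UNIV. riemann g l k i j y * X $ i * Y $ j * Z $ k) =
    (\<Sum>k\<in>UNIV. (\<Sum>i\<in>UNIV. \<Sum>j\<in>UNIV. X $ i * Y $ j * riemann g l k i j y) * Z $ k)" for l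
    unfolding sum_distrib_right
    by (subst (2) sum.swap, subst (3) sum.swap) (simp add: algebra_simps)
  then show ?thesis
    by (simp add: curvature_operator_def matrix_vector_mult_def curvature_endo_component vec_eq_iff)
qed

lemma curvature_endo_linear:
  "curvature_endo g y (X + X') Y = curvature_endo g y X Y + curvature_endo g y X' Y"
  "curvature_endo g y X (Y + Y') = curvature_endo g y X Y + curvature_endo g y X Y'"
  "curvature_endo g y (- X) Y = - curvature_endo g y X Y"
  "curvature_endo g y X (- Y) = - curvature_endo g y X Y"
  by (auto simp: curvature_endo_def algebra_simps sum.distrib sum_negf)

text \<open>Of the four cyclic identities for \<open>X, Y, Z, W\<close> and its rotations, two are added and two subtracted; the
  other terms cancel and twice the difference of both sides is left.\<close>

lemma curvature_symmetries_pair: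
  fixes F :: "'v \<Rightarrow> 'v \<Rightarrow> 'v \<Rightarrow> 'v \<Rightarrow> real"
  assumes 1: "\<And>X Y Z W. F X Y Z W = - F Y X Z W"
    and 2: "\<And>X Y Z W. F X Y Z W = - F X Y W Z"
    and 3: "\<And>X Y Z W. F X Y Z W + F Y Z X W + F Z X Y W = 0"
  shows "F X Y Z W = F Z W X Y"
  using 3[of X Y Z W] 3[of Y Z W X] 3[of Z W X Y] 3[of W X Y Z]
    2[of Y Z W X] 2[of Z W Y X] 1[of W Y Z X] 1[of W X Z Y] 2[of X W Z Y] 1[of X Z W Y] 2[of Z X W Y]
    1[of W X Y Z] 2[of X Y W Z] 2[of Y W X Z]
  by linarith

text \<open>Polarising twice makes such a tensor totally skew when its sectional curvatures vanish, and
  then the first Bianchi identity says that it is three times zero.\<close>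

lemma curvature_symmetries_zero:
  fixes F :: "'v::ab_group_add \<Rightarrow> 'v \<Rightarrow> 'v \<Rightarrow> 'v \<Rightarrow> real"
  assumes 1: "\<And>X Y Z W. F X Y Z W = - F Y X Z W"
    and 2: "\<And>X Y Z W. F X Y Z W = - F X Y W Z"
    and 3: "\<And>X Y Z W. F X Y Z W + F Y Z X W + F Z X Y W = 0"
    and add: "\<And>X X' Y Z W. F (X + X') Y Z W = F X Y Z W + F X' Y Z W"
    and zero: "\<And>X Y. F X Y Y X = 0"
  shows "F X Y Z W = 0"
proof -
  note pair = curvature_symmetries_pair[of F, OF 1 2 3]
  have add2: "F X (Y + Y') Z W = F X Y Z W + F X Y' Z W" for X Y Y' Z W
    using 1[of X "Y + Y'" Z W] 1[of X Y Z W] 1[of X Y' Z W] add[of Y Y' X Z W] by linarith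
  have add3: "F X Y (Z + Z') W = F X Y Z W + F X Y Z' W" for X Y Z Z' W
    using pair[of X Y "Z + Z'" W] pair[of X Y Z W] pair[of X Y Z' W] add[of Z Z' W X Y] by linarith
  have add4: "F X Y Z (W + W') = F X Y Z W + F X Y Z W'" for X Y Z W W'
    using 2[of X Y Z "W + W'"] 2[of X Y Z W] 2[of X Y Z W'] add3[of X Y W W' Z] by linarith
  have a: "F X Y Y W = 0" for X Y W
  proof -
    have "F X Y Y W + F W Y Y X = 0"
      using zero[of "X + W" Y] zero[of X Y] zero[of W Y] unfolding add add4 by simp
    moreover have "F W Y Y X = F X Y Y W"
      using pair[of W Y Y X] 1[of Y X W Y] 2[of X Y W Y] by simp
    ultimately show ?thesis by simp
  qed
  have b: "F X Y Z W = - F X Z Y W" for X Y Z W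
    using a[of X "Y + Z" W] a[of X Y W] a[of X Z W] unfolding add2 add3 by simp
  have "F Y Z X W = F X Y Z W" using b[of Y Z X W] 1[of Y X Z W] by simp
  moreover have "F Z X Y W = F X Y Z W" using b[of X Y Z W] 1[of Z X Y W] by simp
  ultimately show ?thesis using 3[of X Y Z W] by simp
qed

context local_metric
begin

lemma curvature_endo_skew: "curvature_endo g y X Y = - curvature_endo g y Y X"
proof -
  have "curvature_endo g y Y X = (\<Sum>i\<in>UNIV. \<Sum>j\<in>UNIV. (X $ i * Y $ j) *\<^sub>R curvature_matrix g j i y)"
    unfolding curvature_endo_def by (subst sum.swap) (simp add: mult.commute)
  also have "\<dots> = (\<Sum>i\<in>UNIV. \<Sum>j\<in>UNIV. (X $ i * Y $ j) *\<^sub>R (- curvature_matrix g i j y))"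
    by (intro sum.cong refl arg_cong[where f = "scaleR _"])
      (simp add: curvature_matrix_def vec_eq_iff riemann_def sum_subtractf)
  finally have "curvature_endo g y Y X = - curvature_endo g y X Y"
    by (simp add: curvature_endo_def sum_negf)
  then show ?thesis by simp
qed

lemma curvature_endo_bianchi:
  assumes y: "y \<in> U"
  shows "curvature_endo g y X Y *v Z + curvature_endo g y Y Z *v X + curvature_endo g y Z X *v Y = 0"
proof -
  have *: "curvature_operator g y X Y Z $ l = (\<Sum>i\<in>UNIV. \<Sum>j\<in>UNIV. \<Sum>k\<in>UNIV.
      riemann g l k i j y * (X $ i * Y $ j * Z $ k))" for X Y Z l
    by (simp add: curvature_operator_def algebra_simps)
  have "curvature_operator g y Y Z X $ l = (\<Sum>i\<in>UNIV. \<Sum>j\<in>UNIV. \<Sum>k\<in>UNIV.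
      riemann g l i j k y * (X $ i * Y $ j * Z $ k))" for l
    unfolding * by (rule trans[OF _ sum_rotate[symmetric]]) (simp add: algebra_simps)
  moreover have "curvature_operator g y Z X Y $ l = (\<Sum>i\<in>UNIV. \<Sum>j\<in>UNIV. \<Sum>k\<in>UNIV.
      riemann g l j k i y * (X $ i * Y $ j * Z $ k))" for l
    unfolding * by (rule trans[OF sum_rotate]) (simp add: algebra_simps)
  ultimately have "(curvature_operator g y X Y Z + curvature_operator g y Y Z X
      + curvature_operator g y Z X Y) $ l = (\<Sum>i\<in>UNIV. \<Sum>j\<in>UNIV. \<Sum>k\<in>UNIV.
      (riemann g l k i j y + riemann g l i j k y + riemann g l j k i y) * (X $ i * Y $ j * Z $ k))" for l
    by (simp add: * sum.distrib distrib_right)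
  then show ?thesis
    by (simp add: riemann_bianchi[OF y] vec_eq_iff curvature_operator_endo)
qed

lemma curvature_endo_metric_skew:
  assumes y: "y \<in> U"
  shows "W \<bullet> (g y *v (curvature_endo g y X Y *v Z)) = - (Z \<bullet> (g y *v (curvature_endo g y X Y *v W)))"
proof -
  let ?R = "curvature_endo g y X Y"
  have "g y ** ?R + transpose ?R ** g y = (\<Sum>i\<in>UNIV. \<Sum>j\<in>UNIV. (X $ i * Y $ j) *\<^sub>R
      (g y ** curvature_matrix g i j y + transpose (curvature_matrix g i j y) ** g y))"
    by (simp add: curvature_endo_def matrix_sum_expand scaleR_add_right sum.distrib)
  then have "g y ** ?R + transpose ?R ** g y = 0"
    by (simp add: curvature_matrix_skew[OF y])
  then have "W \<bullet> ((g y ** ?R + transpose ?R ** g y) *v Z) = 0"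
    by simp
  then have "W \<bullet> (g y *v (?R *v Z)) + W \<bullet> (transpose ?R *v (g y *v Z)) = 0"
    by (simp add: matrix_vector_mul_assoc matrix_vector_mult_add_rdistrib inner_add_right)
  moreover have "W \<bullet> (transpose ?R *v (g y *v Z)) = Z \<bullet> (g y *v (?R *v W))"
    using inner_g_commute[OF y, of "?R *v W" Z] by (subst inner_matrix_transpose) (simp add: inner_commute)
  ultimately show ?thesis by simp
qed

lemma curvature_endo_pair:
  assumes y: "y \<in> U"
  shows "W \<bullet> (g y *v (curvature_endo g y X Y *v Z)) = Y \<bullet> (g y *v (curvature_endo g y Z W *v X))"
proof -
  define F where "F X Y Z W = W \<bullet> (g y *v (curvature_endo g y X Y *v Z))" for X Y Z W
  have "F X Y Z W = F Z W X Y"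
  proof (rule curvature_symmetries_pair[of F])
    show "F X Y Z W = - F Y X Z W" for X Y Z W
      unfolding F_def by (subst curvature_endo_skew) (simp add: matrix_vector_minus)
    show "F X Y Z W = - F X Y W Z" for X Y Z W
      unfolding F_def using curvature_endo_metric_skew[OF y] .
    show "F X Y Z W + F Y Z X W + F Z X Y W = 0" for X Y Z W
      unfolding F_def
      by (simp add: curvature_endo_bianchi[OF y] flip: inner_add_right matrix_vector_right_distrib)
  qed
  then show ?thesis by (simp add: F_def)
qed

text \<open>The difference of both sides has the symmetries of a curvature tensor and vanishing sectional
  curvatures. Since \<open>c \<noteq> 0\<close>, the denominator of the sectional curvature of independent vectors
  cannot be zero: a quotient by zero would have the value zero.\<close>

lemma curvature_of_constant_sectional_curvature:
  assumes y: "y \<in> U" and c: "c \<noteq> 0"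
    and sec: "\<And>X Y. X \<noteq> Y \<Longrightarrow> independent {X, Y} \<Longrightarrow> sectional_curvature g y X Y = c"
  shows "curvature_endo g y X Y *v Z = c *\<^sub>R ((Y \<bullet> (g y *v Z)) *\<^sub>R X - (X \<bullet> (g y *v Z)) *\<^sub>R Y)"
proof -
  let ?b = "\<lambda>X Y. X \<bullet> (g y *v Y)"
  define F where "F X Y Z W = ?b W (curvature_endo g y X Y *v Z)
    - c * (?b Y Z * ?b X W - ?b X Z * ?b Y W)" for X Y Z W
  note b = inner_g_commute[OF y]
  have dep: "F X Y Y X = 0" if "Y = r *\<^sub>R X \<or> X = r *\<^sub>R Y" for X Y r
  proof -
    have sc: "curvature_endo g y (r *\<^sub>R Z) W = r *\<^sub>R curvature_endo g y Z W"
      "curvature_endo g y W (r *\<^sub>R Z) = r *\<^sub>R curvature_endo g y W Z" for Z W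
      by (auto simp: curvature_endo_def scaleR_sum_right algebra_simps)
    have "curvature_endo g y Z Z = 0" for Z
      using curvature_endo_skew[of y Z Z] by (simp add: eq_neg_iff_add_eq_0 flip: scaleR_2)
    then show ?thesis using that
      by (auto simp: F_def sc inner_scaleR_left matrix_vector_mult_scaleR)
  qed
  have zero: "F X Y Y X = 0" for X Y
  proof (cases "X \<noteq> Y \<and> independent {X, Y}")
    case True
    let ?d = "?b X X * ?b Y Y - (?b X Y)\<^sup>2"
    have s: "?b X (curvature_endo g y X Y *v Y) / ?d = c"
      using sec True by (simp add: sectional_curvature_def curvature_operator_endo)
    then have "?d \<noteq> 0" using c by auto
    then have "?b X (curvature_endo g y X Y *v Y) = c * ?d"
      using s by (simp add: field_simps)
    then show ?thesis by (simp add: F_def b[of Y X] power2_eq_square algebra_simps)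
  next
    case False
    then consider "X = Y" | "X \<noteq> Y" "dependent {X, Y}" by auto
    then show ?thesis
    proof cases
      case 1
      then show ?thesis using dep[of Y 1 X] by simp
    next
      case 2
      have "\<exists>r. Y = r *\<^sub>R X \<or> X = r *\<^sub>R Y"
      proof (cases "Y = 0")
        case True
        then show ?thesis by (intro exI[of _ 0]) auto
      next
        case False
        then have "X \<in> span {Y}"
          using 2 independent_insert[of X "{Y}"] by auto
        then show ?thesis by (auto simp: span_singleton)
      qed
      then show ?thesis using dep by blast
    qed
  qed
  have "F X Y Z W = 0" for W
  proof (rule curvature_symmetries_zero[of F, OF _ _ _ _ zero])
    show "F X Y Z W = - F Y X Z W" for X Y Z W
      unfolding F_def by (subst curvature_endo_skew) (simp add: matrix_vector_minus algebra_simps)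
    show "F X Y Z W = - F X Y W Z" for X Y Z W
      unfolding F_def by (subst curvature_endo_metric_skew[OF y]) (simp add: algebra_simps)
    show "F X Y Z W + F Y Z X W + F Z X Y W = 0" for X Y Z W
    proof -
      have "?b W (curvature_endo g y X Y *v Z + curvature_endo g y Y Z *v X + curvature_endo g y Z X *v Y) = 0"
        by (simp add: curvature_endo_bianchi[OF y])
      then show ?thesis
        unfolding F_def
        by (simp add: inner_add_right matrix_vector_right_distrib b[of Z X] b[of Z Y] b[of Y X] algebra_simps)
    qed
    show "F (X + X') Y Z W = F X Y Z W + F X' Y Z W" for X X' Y Z W
      by (simp add: F_def curvature_endo_linear algebra_simps inner_add_left inner_add_right)
  qed
  then have "W \<bullet> (g y *v (curvature_endo g y X Y *v Z)) =
      W \<bullet> (g y *v (c *\<^sub>R (?b Y Z *\<^sub>R X - ?b X Z *\<^sub>R Y)))" for W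
    by (simp add: F_def inner_diff_right matrix_vector_mult_scaleR matrix_vector_mult_diff_distrib
        b[of W X] b[of W Y] algebra_simps)
  then have "g y *v (curvature_endo g y X Y *v Z) = g y *v (c *\<^sub>R (?b Y Z *\<^sub>R X - ?b X Z *\<^sub>R Y))"
    using vector_eq_ldot by blast
  then show ?thesis by (rule g_cancel_vector[OF y])
qed

end

section \<open>Local Kaehler geometry\<close>

lemma trace_minus: "trace (- (A::real^'l^'l)) = - trace A"
  by (simp add: trace_def sum_negf)

lemma trace_transpose: "trace (transpose (A::real^'l^'l)) = trace A"
  by (simp add: trace_def transpose_def)

lemma nijenhuis_constant_fields:
  assumes "J differentiable (at y)"
  defines "D \<equiv> frechet_derivative J (at y)"
  shows "nijenhuis J (\<lambda>_. X) (\<lambda>_. Y) y =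
    D (J y *v X) *v Y - D (J y *v Y) *v X + J y *v (D Y *v X) - J y *v (D X *v Y)"
proof -
  have *: "frechet_derivative (\<lambda>z. J z *v Z) (at y) W = D W *v Z" for Z W
    using frechet_derivative_bilinear[OF bounded_bilinear_matrix_vector_mult assms(1), of "\<lambda>_. Z" W]
    by (simp add: D_def)
  show ?thesis
    by (simp add: nijenhuis_def lie_bracket_def * matrix_vector_minus)
qed

definition connection_endo :: "(real^'k \<Rightarrow> real^'k^'k) \<Rightarrow> real^'k \<Rightarrow> real^'k \<Rightarrow> real^'k^'k" where
  "connection_endo g y X = (\<Sum>a\<in>UNIV. X $ a *\<^sub>R connection_matrix g a y)"

lemma connection_endo_axis: "connection_endo g y (axis a 1) = connection_matrix g a y"
proof -
  have "connection_endo g y (axis a 1) = (\<Sum>b\<in>UNIV. if b = a then connection_matrix g b y else 0)"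
    unfolding connection_endo_def by (intro sum.cong) (auto simp: axis_def)
  then show ?thesis by simp
qed

lemma connection_endo_linear: "linear (connection_endo g y)"
  by (rule linearI) (simp_all add: connection_endo_def sum.distrib scaleR_left_distrib scaleR_sum_right)

text \<open>The endomorphism \<open>X \<mapsto> R(X, Y) Z\<close>, whose trace is the Ricci tensor.\<close>

definition ricci_endo :: "(real^'k \<Rightarrow> real^'k^'k) \<Rightarrow> real^'k \<Rightarrow> real^'k \<Rightarrow> real^'k \<Rightarrow> real^'k^'k" where
  "ricci_endo g y Y Z = (\<chi> l i. (curvature_endo g y (axis i 1) Y *v Z) $ l)"

lemma ricci_endo_mult: "ricci_endo g y Y Z *v X = curvature_endo g y X Y *v Z"
proof -
  have "curvature_endo g y X Y = (\<Sum>i\<in>UNIV. X $ i *\<^sub>R curvature_endo g y (axis i 1) Y)"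
  proof -
    have "curvature_endo g y (axis i 1) Y = (\<Sum>j\<in>UNIV. Y $ j *\<^sub>R curvature_matrix g i j y)" for i
    proof -
      have "curvature_endo g y (axis i 1) Y =
          (\<Sum>a\<in>UNIV. if a = i then (\<Sum>j\<in>UNIV. Y $ j *\<^sub>R curvature_matrix g a j y) else 0)"
        unfolding curvature_endo_def by (intro sum.cong) (auto simp: axis_def)
      then show ?thesis by simp
    qed
    then show ?thesis by (simp add: curvature_endo_def scaleR_sum_right)
  qed
  then show ?thesis
    by (simp add: ricci_endo_def matrix_vector_mult_def vec_eq_iff sum_component sum_distrib_right sum_distrib_left)
      (subst sum.swap, simp add: algebra_simps)
qed

lemma trace_ricci_endo: "trace (ricci_endo g y Y Z) = Y \<bullet> (ricci g y *v Z)"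
proof -
  have "trace (ricci_endo g y Y Z) = (\<Sum>i\<in>UNIV. \<Sum>k\<in>UNIV. \<Sum>j\<in>UNIV. Y $ j * riemann g i k i j y * Z $ k)"
  proof -
    have "curvature_endo g y (axis i 1) Y $ l $ k = (\<Sum>j\<in>UNIV. Y $ j * riemann g l k i j y)" for i l k
    proof -
      have "curvature_endo g y (axis i 1) Y $ l $ k =
          (\<Sum>a\<in>UNIV. if a = i then (\<Sum>j\<in>UNIV. Y $ j * riemann g l k a j y) else 0)"
        unfolding curvature_endo_component by (intro sum.cong) (auto simp: axis_def)
      then show ?thesis by simp
    qed
    then show ?thesis
      by (simp add: trace_def ricci_endo_def matrix_vector_mult_def sum_distrib_right)
  qed
  also have "\<dots> = (\<Sum>j\<in>UNIV. \<Sum>k\<in>UNIV. \<Sum>i\<in>UNIV. Y $ j * riemann g i k i j y * Z $ k)"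
    by (rule trans[OF sum_rotate sum.swap])
  also have "\<dots> = Y \<bullet> (ricci g y *v Z)"
    by (simp add: inner_vec_def matrix_vector_mult_def ricci_def sum_distrib_left sum_distrib_right algebra_simps)
  finally show ?thesis .
qed

context local_metric
begin

lemma connection_endo_commute:
  assumes "y \<in> U"
  shows "connection_endo g y X *v Y = connection_endo g y Y *v X"
proof -
  have *: "(connection_endo g y X *v Y) $ l = (\<Sum>a\<in>UNIV. \<Sum>b\<in>UNIV. christoffel g l a b y * X $ a * Y $ b)" for X Y l
    by (simp add: connection_endo_def connection_matrix_def matrix_vector_mult_def sum_distrib_right)
      (subst sum.swap, simp add: algebra_simps)
  show ?thesis
    unfolding vec_eq_iff * by (subst sum.swap) (simp add: christoffel_sym[OF assms] algebra_simps)
qed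

lemma metric_compatible_endo:
  assumes "y \<in> U"
  shows "frechet_derivative g (at y) X =
    transpose (connection_endo g y X) ** g y + g y ** connection_endo g y X"
  by (simp add: frechet_derivative_partials[OF smooth_on_differentiable[OF smooth assms]]
      metric_compatible[OF assms] connection_endo_def scaleR_add_right sum.distrib matrix_sum_expand)

lemma trace_curvature_endo:
  assumes y: "y \<in> U"
  shows "trace (curvature_endo g y X Y) = 0"
proof -
  let ?R = "curvature_endo g y X Y" and ?i = "matrix_inv (g y)"
  have "g y ** ?R = - (transpose ?R ** g y)"
  proof (rule matrix_eq_inner)
    fix W Z
    have "W \<bullet> ((transpose ?R ** g y) *v Z) = (?R *v W) \<bullet> (g y *v Z)"
      by (simp only: matrix_vector_mul_assoc[symmetric] inner_matrix_transpose[of W] transpose_transpose)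
    then show "W \<bullet> ((g y ** ?R) *v Z) = W \<bullet> (- (transpose ?R ** g y) *v Z)"
      using curvature_endo_metric_skew[OF y, of W X Y Z] inner_g_commute[OF y, of Z]
      by (simp add: matrix_vector_minus inner_minus_right flip: matrix_vector_mul_assoc)
  qed
  then have "?i ** (g y ** ?R) = - (?i ** (transpose ?R ** g y))"
    by (simp add: matrix_minus_right)
  then have "?R = - (?i ** (transpose ?R ** g y))"
    by (simp add: matrix_mul_assoc matrix_inv_inverse[OF invertible_g[OF y]])
  then have "trace ?R = - trace (?i ** (transpose ?R ** g y))"
    by (metis trace_minus)
  also have "trace (?i ** (transpose ?R ** g y)) = trace ((transpose ?R ** g y) ** ?i)"
    by (rule trace_mul_sym)
  also have "\<dots> = trace ?R"
    by (simp add: matrix_inv_inverse[OF invertible_g[OF y]] trace_transpose flip: matrix_mul_assoc)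
  finally show ?thesis by simp
qed

lemma ricci_symmetric:
  assumes y: "y \<in> U"
  shows "Y \<bullet> (ricci g y *v Z) = Z \<bullet> (ricci g y *v Y)"
proof -
  have "ricci_endo g y Y Z - ricci_endo g y Z Y + curvature_endo g y Y Z = 0"
    unfolding matrix_eq
  proof
    fix X
    show "(ricci_endo g y Y Z - ricci_endo g y Z Y + curvature_endo g y Y Z) *v X = 0 *v X"
      using curvature_endo_bianchi[OF y, of X Y Z] curvature_endo_skew[of y Z X]
      by (simp add: matrix_vector_mult_add_rdistrib matrix_vector_mult_diff_rdistrib ricci_endo_mult
          matrix_vector_minus algebra_simps)
  qed
  then have "trace (ricci_endo g y Y Z - ricci_endo g y Z Y + curvature_endo g y Y Z) = 0"
    by (simp add: trace_def)
  then show ?thesis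
    by (simp add: trace_add trace_sub trace_ricci_endo trace_curvature_endo[OF y])
qed

end

text \<open>The closedness of the fundamental form and the vanishing of the Nijenhuis tensor are stated
  for coordinate vectors, as in the definitions of the global notions.\<close>

locale local_kaehler = local_metric U g for U :: "(real^'k) set" and g +
  fixes J :: "real^'k \<Rightarrow> real^'k^'k"
  assumes smooth_J: "smooth_on U J"
    and J_square: "\<And>y. y \<in> U \<Longrightarrow> J y ** J y = - mat 1"
    and hermitian: "\<And>y X Y. y \<in> U \<Longrightarrow> (J y *v X) \<bullet> (g y *v (J y *v Y)) = X \<bullet> (g y *v Y)"
    and closed: "\<And>y a b d. y \<in> U \<Longrightarrow>
      partial_deriv a (\<lambda>z. fundamental_form g J z $ b $ d) y
      + partial_deriv b (\<lambda>z. fundamental_form g J z $ d $ a) y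
      + partial_deriv d (\<lambda>z. fundamental_form g J z $ a $ b) y = 0"
    and integrable: "\<And>y a b. y \<in> U \<Longrightarrow> nijenhuis J (\<lambda>_. axis a 1) (\<lambda>_. axis b 1) y = 0"
begin

lemma J_J: "y \<in> U \<Longrightarrow> J y *v (J y *v X) = - X"
  by (simp add: matrix_vector_mul_assoc J_square matrix_vector_minus)

lemma hermitian_skew:
  "y \<in> U \<Longrightarrow> Z \<bullet> (g y *v (J y *v W)) = - ((J y *v Z) \<bullet> (g y *v W))"
  using hermitian[of y "J y *v Z" W] by (simp add: J_J)

lemma J_differentiable: "y \<in> U \<Longrightarrow> J differentiable (at y)"
  by (rule smooth_on_differentiable[OF smooth_J])

lemma g_differentiable: "y \<in> U \<Longrightarrow> g differentiable (at y)"
  by (rule smooth_on_differentiable[OF smooth])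

lemma fundamental_form_skew:
  assumes "y \<in> U"
  shows "X \<bullet> (fundamental_form g J y *v Y) = - (Y \<bullet> (fundamental_form g J y *v X))"
  using hermitian_skew[OF assms, of X Y] inner_g_commute[OF assms, of "J y *v X"]
  by (simp add: fundamental_form_def flip: matrix_vector_mul_assoc)

lemma fundamental_form_transpose:
  assumes "y \<in> U"
  shows "transpose (fundamental_form g J y) = - fundamental_form g J y"
proof (rule matrix_eq_inner)
  fix X Y
  have "X \<bullet> (transpose (fundamental_form g J y) *v Y) = Y \<bullet> (fundamental_form g J y *v X)"
    by (simp only: inner_matrix_transpose[of X] transpose_transpose inner_commute)
  then show "X \<bullet> (transpose (fundamental_form g J y) *v Y) = X \<bullet> (- fundamental_form g J y *v Y)"
    using fundamental_form_skew[OF assms, of X Y] by (simp add: matrix_vector_minus)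
qed

lemma fundamental_form_differentiable: "y \<in> U \<Longrightarrow> fundamental_form g J differentiable (at y)"
  unfolding fundamental_form_def[abs_def]
  by (intro differentiable_bilinear[OF bounded_bilinear_matrix_mult] g_differentiable J_differentiable)

definition nabla_J :: "real^'k \<Rightarrow> real^'k \<Rightarrow> real^'k^'k" where
  "nabla_J y X = frechet_derivative J (at y) X + connection_endo g y X ** J y - J y ** connection_endo g y X"

lemma nabla_J_anticommute:
  assumes y: "y \<in> U"
  shows "nabla_J y X ** J y = - (J y ** nabla_J y X)"
proof -
  let ?D = "frechet_derivative J (at y) X" and ?C = "connection_endo g y X"
  have "frechet_derivative (\<lambda>z. J z ** J z) (at y) X = 0"
    using frechet_derivative_cong_open[OF open_U y, of "\<lambda>z. J z ** J z" "\<lambda>_. - mat 1"]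
    by (simp add: J_square)
  then have D: "?D ** J y + J y ** ?D = 0"
    by (simp add: frechet_derivative_bilinear[OF bounded_bilinear_matrix_mult] J_differentiable y)
  have "?C ** J y ** J y = - ?C" "J y ** J y ** ?C = - ?C"
    using J_square[OF y] by (simp_all add: matrix_minus_left matrix_minus_right flip: matrix_mul_assoc)
  then show ?thesis
    using D by (simp add: nabla_J_def matrix_expand algebra_simps add_eq_0_iff)
qed

lemma fundamental_form_derivative:
  assumes y: "y \<in> U"
  shows "frechet_derivative (fundamental_form g J) (at y) X =
    transpose (connection_endo g y X) ** fundamental_form g J y
    + fundamental_form g J y ** connection_endo g y X + g y ** nabla_J y X"
  unfolding fundamental_form_def[abs_def] nabla_J_def
  by (simp add: frechet_derivative_bilinear[OF bounded_bilinear_matrix_mult] J_differentiable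
      g_differentiable y metric_compatible_endo matrix_expand algebra_simps)

text \<open>Differentiating the fundamental form \<open>\<Omega> = g J\<close> produces \<open>g (\<nabla> J)\<close> and two terms with the
  connection, whose sum is skew because \<open>\<Omega>\<close> is.\<close>

lemma nabla_J_skew:
  assumes y: "y \<in> U"
  shows "Z \<bullet> (g y *v (nabla_J y X *v Y)) = - (Y \<bullet> (g y *v (nabla_J y X *v Z)))"
proof -
  let ?w = "fundamental_form g J" and ?C = "connection_endo g y X"
  let ?D = "frechet_derivative ?w (at y) X"
  have "transpose ?D = frechet_derivative (\<lambda>z. transpose (?w z)) (at y) X"
    by (rule frechet_derivative_bounded_linear[OF bounded_linear_transpose
          fundamental_form_differentiable[OF y], symmetric])
  also have "\<dots> = frechet_derivative (\<lambda>z. - ?w z) (at y) X"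
    using frechet_derivative_cong_open[OF open_U y, of "\<lambda>z. transpose (?w z)" "\<lambda>z. - ?w z"]
    by (simp add: fundamental_form_transpose)
  also have "\<dots> = - ?D"
    by (rule frechet_derivative_bounded_linear[OF bounded_linear_minus[OF bounded_linear_ident]
          fundamental_form_differentiable[OF y]])
  finally have "transpose (g y ** nabla_J y X) = - (g y ** nabla_J y X)"
    unfolding fundamental_form_derivative[OF y]
    by (simp add: transpose_add matrix_transpose_mul[of _ ?C] matrix_transpose_mul[of _ "?w y"]
       matrix_transpose_mul[of "?w y"] fundamental_form_transpose[OF y] matrix_expand)
  then have "Z \<bullet> ((g y ** nabla_J y X) *v Y) = - (Y \<bullet> ((g y ** nabla_J y X) *v Z))"
    using inner_matrix_transpose[of Z "g y ** nabla_J y X" Y]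
    by (simp add: matrix_vector_minus inner_commute del: transpose_matrix_vector)
  then show ?thesis by (simp flip: matrix_vector_mul_assoc)
qed

lemma closed_vectors:
  assumes y: "y \<in> U"
  defines "D \<equiv> frechet_derivative (fundamental_form g J) (at y)"
  shows "Y \<bullet> (D X *v Z) + Z \<bullet> (D Y *v X) + X \<bullet> (D Z *v Y) = 0"
proof -
  let ?p = "\<lambda>a b d. partial_deriv a (\<lambda>z. fundamental_form g J z $ b $ d) y"
  have e: "Y \<bullet> (D X *v Z) = (\<Sum>a\<in>UNIV. \<Sum>b\<in>UNIV. \<Sum>d\<in>UNIV. ?p a b d * (X $ a * Y $ b * Z $ d))" for X Y Z
  proof -
    have "D X $ b $ d = (\<Sum>a\<in>UNIV. X $ a * ?p a b d)" for b d
      using fundamental_form_differentiable[OF y]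
      by (simp add: D_def frechet_derivative_partials partial_deriv_vec_nth differentiable_vec_nth)
    then have "Y \<bullet> (D X *v Z) = (\<Sum>b\<in>UNIV. \<Sum>d\<in>UNIV. \<Sum>a\<in>UNIV. ?p a b d * (X $ a * Y $ b * Z $ d))"
      by (simp add: inner_vec_def matrix_vector_mult_def sum_distrib_left sum_distrib_right algebra_simps)
    also have "\<dots> = (\<Sum>a\<in>UNIV. \<Sum>b\<in>UNIV. \<Sum>d\<in>UNIV. ?p a b d * (X $ a * Y $ b * Z $ d))"
      by (rule sum_rotate[symmetric])
    finally show ?thesis .
  qed
  have "Z \<bullet> (D Y *v X) = (\<Sum>a\<in>UNIV. \<Sum>b\<in>UNIV. \<Sum>d\<in>UNIV. ?p b d a * (X $ a * Y $ b * Z $ d))"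
    unfolding e by (rule trans[OF _ sum_rotate[symmetric]]) (simp add: algebra_simps)
  moreover have "X \<bullet> (D Z *v Y) = (\<Sum>a\<in>UNIV. \<Sum>b\<in>UNIV. \<Sum>d\<in>UNIV. ?p d a b * (X $ a * Y $ b * Z $ d))"
    unfolding e by (rule trans[OF sum_rotate]) (simp add: algebra_simps)
  ultimately have "Y \<bullet> (D X *v Z) + Z \<bullet> (D Y *v X) + X \<bullet> (D Z *v Y) =
      (\<Sum>a\<in>UNIV. \<Sum>b\<in>UNIV. \<Sum>d\<in>UNIV. (?p a b d + ?p b d a + ?p d a b) * (X $ a * Y $ b * Z $ d))"
    by (simp add: e sum.distrib distrib_right)
  then show ?thesis by (simp add: closed[OF y])
qed

text \<open>In the cyclic sum of the derivatives of the fundamental form the connection terms cancel, as the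
  connection is torsion-free.\<close>

lemma nabla_J_cyclic:
  assumes y: "y \<in> U"
  shows "Y \<bullet> (g y *v (nabla_J y X *v Z)) + Z \<bullet> (g y *v (nabla_J y Y *v X))
    + X \<bullet> (g y *v (nabla_J y Z *v Y)) = 0"
proof -
  let ?w = "fundamental_form g J y" and ?C = "connection_endo g y"
  have e: "Y \<bullet> (frechet_derivative (fundamental_form g J) (at y) X *v Z) =
      (?C X *v Y) \<bullet> (?w *v Z) - (?C X *v Z) \<bullet> (?w *v Y) + Y \<bullet> (g y *v (nabla_J y X *v Z))" for X Y Z
  proof -
    have "Y \<bullet> (transpose (?C X) *v (?w *v Z)) = (?C X *v Y) \<bullet> (?w *v Z)"
      by (subst inner_matrix_transpose) simp
    then show ?thesis
      using fundamental_form_skew[OF y, of Y "?C X *v Z"]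
      by (simp add: fundamental_form_derivative[OF y] matrix_vector_mult_add_rdistrib inner_add_right
          del: transpose_matrix_vector flip: matrix_vector_mul_assoc)
  qed
  show ?thesis
    using closed_vectors[OF y, of Y X Z] connection_endo_commute[OF y, of X Y]
      connection_endo_commute[OF y, of Y Z] connection_endo_commute[OF y, of Z X]
    unfolding e by simp
qed

lemma nijenhuis_zero:
  assumes y: "y \<in> U"
  shows "nijenhuis J (\<lambda>_. X) (\<lambda>_. Y) y = 0"
proof -
  let ?N = "\<lambda>X Y. nijenhuis J (\<lambda>_. X) (\<lambda>_. Y) y"
  note N = nijenhuis_constant_fields[OF J_differentiable[OF y]]
  interpret D: linear "frechet_derivative J (at y)"
    using J_differentiable[OF y] by (rule linear_frechet_derivative)
  note lin = N D.add D.scaleR matrix_vector_right_distrib matrix_vector_mult_add_rdistrib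
      matrix_vector_mult_scaleR scaleR_matrix_vector_assoc[symmetric]
  have 1: "linear (\<lambda>X. ?N X Y)" for Y
    by (rule linearI) (simp_all add: lin algebra_simps)
  have 2: "linear (\<lambda>Y. ?N X Y)" for X
    by (rule linearI) (simp_all add: lin algebra_simps)
  have a: "(\<lambda>Y. ?N (axis a 1) Y) = (\<lambda>Y. 0)" for a
    by (rule linear_eq_stdbasis[OF 2]) (auto simp: Basis_vec_def integrable[OF y] intro!: linearI)
  have "(\<lambda>X. ?N X Y) = (\<lambda>X. 0)"
    by (rule linear_eq_stdbasis[OF 1]) (use a in \<open>auto simp: Basis_vec_def fun_eq_iff intro!: linearI\<close>)
  then show ?thesis by (simp add: fun_eq_iff)
qed

text \<open>The Levi-Civita connection being torsion-free, the Nijenhuis tensor may be computed with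
  covariant derivatives.\<close>

lemma nabla_J_nijenhuis:
  assumes y: "y \<in> U"
  shows "nabla_J y (J y *v X) *v Y - nabla_J y (J y *v Y) *v X
    + J y *v (nabla_J y Y *v X) - J y *v (nabla_J y X *v Y) = 0"
proof -
  let ?D = "frechet_derivative J (at y)"
  have "J y *v (?D X *v Y) = ?D (J y *v X) *v Y - ?D (J y *v Y) *v X + J y *v (?D Y *v X)"
    using nijenhuis_zero[OF y, of X Y]
    by (simp add: nijenhuis_constant_fields[OF J_differentiable[OF y]])
  then show ?thesis
    using connection_endo_commute[OF y, of "J y *v X" Y]
      connection_endo_commute[OF y, of "J y *v Y" X] connection_endo_commute[OF y, of X Y]
      connection_endo_commute[OF y, of "J y *v X" "J y *v Y"]
    by (simp add: nabla_J_def matrix_vector_mult_add_rdistrib matrix_vector_mult_diff_rdistrib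
        matrix_vector_right_distrib matrix_vector_mult_diff_distrib J_J[OF y] flip: matrix_vector_mul_assoc)
qed

text \<open>Vanishing of the Nijenhuis tensor makes \<open>S(JX, Y, Z) + S(X, Y, JZ)\<close> symmetric in \<open>X, Y\<close>, where
  \<open>S(X, Y, Z) = g((\<nabla>\<^sub>X J) Y, Z)\<close>; as it is also skew in \<open>Y, Z\<close>, it is zero. With this relation the
  cyclic identity for \<open>(JX, Y, Z)\<close> and its rotations becomes a regular linear system for the three
  rotations of \<open>S(X, Y, JZ)\<close>.\<close>

lemma nabla_J_eq_0:
  assumes y: "y \<in> U"
  shows "nabla_J y X = 0"
proof -
  let ?J = "\<lambda>X. J y *v X"
  define S where "S X Y Z = Z \<bullet> (g y *v (nabla_J y X *v Y))" for X Y Z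
  have skew: "S X Y Z = - S X Z Y" for X Y Z
    unfolding S_def using nabla_J_skew[OF y] .
  have anti: "nabla_J y X *v ?J Y = - ?J (nabla_J y X *v Y)" for X Y
    by (simp add: matrix_vector_mul_assoc nabla_J_anticommute[OF y] matrix_vector_minus)
  have JZ: "Z \<bullet> (g y *v ?J (nabla_J y X *v Y)) = - S X Y (?J Z)" for X Y Z
    by (simp add: S_def hermitian_skew[OF y])
  have J: "S X (?J Y) Z = S X Y (?J Z)" for X Y Z
    using JZ by (simp add: S_def anti matrix_vector_minus)
  have cyc: "S X Y Z + S Y Z X + S Z X Y = 0" for X Y Z
    using nabla_J_cyclic[OF y, of Z X Y] by (simp add: S_def)
  define T where "T X Y Z = S (?J X) Y Z + S X Y (?J Z)" for X Y Z
  have Tsym: "T X Y Z = T Y X Z" for X Y Z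
  proof -
    have "Z \<bullet> (g y *v (nabla_J y (?J X) *v Y - nabla_J y (?J Y) *v X
        + ?J (nabla_J y Y *v X) - ?J (nabla_J y X *v Y))) = 0"
      by (simp add: nabla_J_nijenhuis[OF y])
    then show ?thesis
      by (simp add: T_def matrix_vector_right_distrib matrix_vector_mult_diff_distrib inner_add_right
          inner_diff_right JZ) (simp add: S_def)
  qed
  have Tskew: "T X Y Z = - T X Z Y" for X Y Z
    unfolding T_def using skew[of "?J X" Y Z] skew[of X Y "?J Z"] J[of X Z Y] by simp
  have "T X Y Z = 0" for X Y Z
    using Tsym[of X Y Z] Tskew[of Y X Z] Tsym[of Y Z X] Tskew[of Z Y X] Tsym[of Z X Y] Tskew[of X Z Y]
    by linarith
  then have T0: "S (?J X) Y Z = - S X Y (?J Z)" for X Y Z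
    by (simp add: T_def add_eq_0_iff)
  have "S X Y (?J Z) = 0" for X Y Z
    using cyc[of "?J X" Y Z] cyc[of X "?J Y" Z] cyc[of X Y "?J Z"]
      T0[of X Y Z] T0[of Y Z X] T0[of Z X Y] J[of Z X Y] J[of X Y Z] J[of Y Z X] by linarith
  from this[of X _ "?J _"] have "S X Y Z = 0" for Y Z
    by (simp add: J_J[OF y]) (simp add: S_def)
  then have "Z \<bullet> ((g y ** nabla_J y X) *v Y) = Z \<bullet> (0 *v Y)" for Y Z
    by (simp add: S_def flip: matrix_vector_mul_assoc)
  then have "g y ** nabla_J y X = 0" by (rule matrix_eq_inner)
  then show ?thesis using g_cancel_matrix[OF y, of "nabla_J y X" 0] by simp
qed

lemma partial_deriv_J:
  assumes "y \<in> U"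
  shows "partial_deriv a J y = J y ** connection_matrix g a y - connection_matrix g a y ** J y"
  using nabla_J_eq_0[OF assms, of "axis a 1"]
  by (simp add: nabla_J_def partial_deriv_def connection_endo_axis algebra_simps)

lemma connection_differentiable: "y \<in> U \<Longrightarrow> connection_matrix g a differentiable (at y)"
  by (rule smooth_on_differentiable[OF smooth_connection])

text \<open>The curvature is the commutator of covariant derivatives, and \<open>J\<close> is parallel; in coordinates this is
  the symmetry of the second derivatives of \<open>J\<close>.\<close>

lemma curvature_matrix_J_commute:
  assumes y: "y \<in> U"
  shows "J y ** curvature_matrix g a b y = curvature_matrix g a b y ** J y"
proof -
  let ?C = "connection_matrix g"
  have E: "partial_deriv a (partial_deriv b J) y =
      (J y ** ?C a y - ?C a y ** J y) ** ?C b y + J y ** partial_deriv a (?C b) y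
      - (partial_deriv a (?C b) y ** J y + ?C b y ** (J y ** ?C a y - ?C a y ** J y))" for a b
  proof -
    have "partial_deriv a (partial_deriv b J) y = partial_deriv a (\<lambda>z. J z ** ?C b z - ?C b z ** J z) y"
      by (rule partial_deriv_cong_open[OF open_U y]) (simp add: partial_deriv_J)
    then show ?thesis
      using J_differentiable[OF y] connection_differentiable[OF y]
      by (simp add: partial_deriv_diff partial_deriv_bilinear[OF bounded_bilinear_matrix_mult]
          differentiable_bilinear[OF bounded_bilinear_matrix_mult] partial_deriv_J[OF y])
  qed
  from partial_deriv_commute[OF smooth_J y, of a b, unfolded E] show ?thesis
    by (simp add: curvature_matrix_eq[OF y] matrix_expand algebra_simps)
qed

lemma curvature_endo_J_commute:
  assumes y: "y \<in> U"
  shows "J y ** curvature_endo g y X Y = curvature_endo g y X Y ** J y"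
  by (simp add: curvature_endo_def matrix_sum_expand curvature_matrix_J_commute[OF y])

lemma curvature_endo_J_invariant:
  assumes y: "y \<in> U"
  shows "curvature_endo g y (J y *v X) (J y *v Y) = curvature_endo g y X Y"
proof -
  have "W \<bullet> ((g y ** curvature_endo g y (J y *v X) (J y *v Y)) *v Z) =
      W \<bullet> ((g y ** curvature_endo g y X Y) *v Z)" for W Z
  proof -
    have "W \<bullet> (g y *v (curvature_endo g y (J y *v X) (J y *v Y) *v Z)) =
        (J y *v Y) \<bullet> (g y *v ((curvature_endo g y Z W ** J y) *v X))"
      by (subst curvature_endo_pair[OF y]) (simp flip: matrix_vector_mul_assoc)
    also have "\<dots> = Y \<bullet> (g y *v (curvature_endo g y Z W *v X))"
      by (simp add: hermitian[OF y] flip: curvature_endo_J_commute[OF y] matrix_vector_mul_assoc)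
    also have "\<dots> = W \<bullet> (g y *v (curvature_endo g y X Y *v Z))"
      by (rule curvature_endo_pair[OF y, symmetric])
    finally show ?thesis by (simp flip: matrix_vector_mul_assoc)
  qed
  then show ?thesis by (rule g_cancel_matrix[OF y matrix_eq_inner])
qed

text \<open>On a Kaehler manifold the Ricci tensor is the trace of the curvature over the complex structure:
  the Bianchi identity splits \<open>Ric(Y, Z)\<close> into this trace and \<open>- Ric(JZ, JY)\<close>, and the Ricci tensor is
  symmetric and invariant under \<open>J\<close>.\<close>

lemma ricci_trace:
  assumes y: "y \<in> U"
  shows "2 * (Y \<bullet> (ricci g y *v Z)) = trace (J y ** curvature_endo g y Y (J y *v Z))"
proof -
  let ?J = "\<lambda>X. J y *v X" and ?R = "curvature_endo g y" and ?Q = "ricci_endo g y"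
  have JR: "J y *v (?R X Y *v Z) = ?R X Y *v ?J Z" for X Y Z
    by (simp add: matrix_vector_mul_assoc curvature_endo_J_commute[OF y])
  have "?Q Y Z = J y ** ?R Y (?J Z) - ?Q (?J Z) (?J Y)"
    unfolding matrix_eq
  proof
    fix X
    have "?R X Y *v Z = - ?J (?R X Y *v ?J Z)"
      by (simp add: JR J_J[OF y] matrix_vector_minus)
    also have "?R X Y *v ?J Z = - (?R Y (?J Z) *v X + ?R (?J Z) X *v Y)"
      using curvature_endo_bianchi[OF y, of X Y "?J Z"] by (simp only: eq_neg_iff_add_eq_0 add.assoc)
    finally have "?R X Y *v Z = ?J (?R Y (?J Z) *v X) + ?R (?J Z) X *v ?J Y"
      by (simp add: matrix_vector_right_distrib matrix_vector_mult_diff_distrib matrix_vector_minus JR)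
    then show "?Q Y Z *v X = (J y ** ?R Y (?J Z) - ?Q (?J Z) (?J Y)) *v X"
      using curvature_endo_skew[of y "?J Z" X]
      by (simp add: ricci_endo_mult matrix_vector_mult_diff_rdistrib matrix_vector_minus
          flip: matrix_vector_mul_assoc)
  qed
  then have "trace (?Q Y Z) = trace (J y ** ?R Y (?J Z)) - trace (?Q (?J Z) (?J Y))"
    by (metis trace_sub)
  moreover have "trace (?Q (?J Z) (?J Y)) = trace (?Q Z Y)"
  proof -
    have "?Q (?J Z) (?J Y) = J y ** ?Q (?J Z) Y"
      unfolding matrix_eq by (simp add: ricci_endo_mult JR flip: matrix_vector_mul_assoc)
    moreover have "?Q (?J Z) Y ** J y = ?Q Z Y"
      unfolding matrix_eq
      by (simp add: ricci_endo_mult curvature_endo_J_invariant[OF y] flip: matrix_vector_mul_assoc)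
    ultimately show ?thesis by (simp add: trace_mul_sym)
  qed
  ultimately show ?thesis
    using ricci_symmetric[OF y, of Y Z] by (simp add: trace_ricci_endo)
qed

text \<open>Let \<open>V\<close> be a field of projections onto a fixed subspace that \<open>J\<close> maps onto the kernel. A frame of
  this subspace is a complex frame of the tangent bundle, and \<open>trace (V J \<Gamma>\<^sub>a)\<close> is, up to
  sign, the imaginary part of the trace of its connection form, of which the Ricci form is the exterior
  derivative. The quadratic terms of the curvature disappear from the trace because the connection is
  complex linear.\<close>

lemma trace_J_curvature:
  assumes y: "y \<in> U" and V: "smooth_on U V"
    and V_proj: "\<And>z. z \<in> U \<Longrightarrow> V z ** V z = V z"
    and V_range: "\<And>z a. z \<in> U \<Longrightarrow> V z ** partial_deriv a V z = partial_deriv a V z"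
    and V_J: "\<And>z. z \<in> U \<Longrightarrow> J z ** V z + V z ** J z = J z"
  defines "\<beta> \<equiv> \<lambda>a z. trace (V z ** J z ** connection_matrix g a z)"
  shows "trace (J y ** curvature_matrix g a b y) = 2 * (partial_deriv a (\<beta> b) y - partial_deriv b (\<beta> a) y)"
proof -
  let ?C = "\<lambda>a. connection_matrix g a y" and ?V = "V y" and ?J = "J y" and ?R = "curvature_matrix g a b y"
  have Vd: "V differentiable (at y)" using smooth_on_differentiable[OF V y] .
  note Jd = J_differentiable[OF y] and Cd = connection_differentiable[OF y]
  note rules = partial_deriv_bilinear[OF bounded_bilinear_matrix_mult]
    differentiable_bilinear[OF bounded_bilinear_matrix_mult] Vd Jd Cd
  have JV: "?J ** ?V = ?J - ?V ** ?J" using V_J[OF y] by (simp add: eq_diff_eq)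
  have VaJ: "partial_deriv a V y ** ?J = ?V ** ?C a ** ?J - ?V ** ?C a ** ?V ** ?J - ?V ** ?J ** ?C a ** ?V" for a
  proof -
    let ?D = "partial_deriv a V y" and ?E = "partial_deriv a J y"
    have "?D ** ?V + ?V ** ?D = ?D"
      using partial_deriv_cong_open[OF open_U y, of "\<lambda>z. V z ** V z" V a] V_proj by (simp add: rules)
    then have DV: "?D ** ?V = 0" using V_range[OF y] by simp
    have "?E ** ?V + ?J ** ?D + (?D ** ?J + ?V ** ?E) = ?E"
      using partial_deriv_cong_open[OF open_U y, of "\<lambda>z. J z ** V z + V z ** J z" J a] V_J
      by (simp add: rules partial_deriv_add)
    then have "?V ** (?E ** ?V + ?J ** ?D + (?D ** ?J + ?V ** ?E)) ** ?V = ?V ** ?E ** ?V" by simp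
    then have "?V ** ?E ** ?V ** ?V + ?V ** ?J ** (?D ** ?V) + (?V ** ?D ** (?J ** ?V) + ?V ** ?V ** ?E ** ?V)
        = ?V ** ?E ** ?V" by (simp add: matrix_expand)
    moreover have "?V ** ?E ** ?V ** ?V = ?V ** ?E ** ?V"
      using V_proj[OF y] by (simp flip: matrix_mul_assoc)
    moreover have "?D ** ?V ** ?J = 0" by (simp add: DV)
    ultimately have "?D ** ?J = - (?V ** ?E ** ?V)"
      using V_proj[OF y] V_range[OF y] by (simp add: DV JV matrix_expand eq_neg_iff_add_eq_0 add.commute)
    also have "\<dots> = ?V ** ?C a ** (?J ** ?V) - ?V ** ?J ** ?C a ** ?V"
      by (simp add: partial_deriv_J[OF y] matrix_expand)
    finally show ?thesis by (simp add: JV matrix_expand)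
  qed
  have d: "partial_deriv a (\<beta> b) y = trace (?V ** ?J ** ?C a ** ?C b) + trace (?V ** ?J ** partial_deriv a (connection_matrix g b) y)
      - trace (?V ** ?C a ** ?V ** ?J ** ?C b) - trace (?V ** ?J ** ?C a ** ?V ** ?C b)" for a b
  proof -
    have "partial_deriv a (\<beta> b) y = trace (partial_deriv a (\<lambda>z. V z ** J z ** connection_matrix g b z) y)"
      unfolding \<beta>_def by (intro partial_deriv_bounded_linear[OF bounded_linear_trace] rules)
    also have "partial_deriv a (\<lambda>z. V z ** J z ** connection_matrix g b z) y =
      (partial_deriv a V y ** ?J) ** ?C b + ?V ** partial_deriv a J y ** ?C b
      + ?V ** ?J ** partial_deriv a (connection_matrix g b) y"
      by (simp add: rules matrix_expand)
    finally show ?thesis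
      unfolding VaJ by (simp add: partial_deriv_J[OF y] matrix_expand trace_add trace_sub)
  qed
  have "trace (?V ** ?C a ** ?V ** ?J ** ?C b) = trace (?V ** ?J ** ?C b ** ?V ** ?C a)" for a b
    using trace_mul_sym[of "?V ** ?C a" "?V ** ?J ** ?C b"] by (simp add: matrix_mul_assoc)
  then have "partial_deriv a (\<beta> b) y - partial_deriv b (\<beta> a) y = trace (?V ** ?J ** ?R)"
    by (simp add: d curvature_matrix_eq[OF y] matrix_expand trace_add trace_sub)
  moreover have "trace (?J ** ?R) = 2 * trace (?V ** ?J ** ?R)"
  proof -
    have "trace (?J ** ?R) = trace ((?J ** ?V + ?V ** ?J) ** ?R)" by (simp add: V_J[OF y])
    also have "\<dots> = trace (?J ** (?V ** ?R)) + trace (?V ** ?J ** ?R)"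
      by (simp add: matrix_expand trace_add)
    also have "trace (?J ** (?V ** ?R)) = trace (?V ** (?R ** ?J))"
      by (subst trace_mul_sym) (simp add: matrix_mul_assoc)
    also have "?V ** (?R ** ?J) = ?V ** ?J ** ?R"
      by (simp add: matrix_mul_assoc flip: curvature_matrix_J_commute[OF y])
    finally show ?thesis by simp
  qed
  ultimately show ?thesis by simp
qed

end

section \<open>Coordinates of the cotangent bundle\<close>

lemma bounded_bilinear_vector_matrix_mult:
  "bounded_bilinear ((v*) :: real^'m \<Rightarrow> real^'l^'m \<Rightarrow> real^'l)"
  unfolding bilinear_conv_bounded_bilinear[symmetric] bilinear_def linear_iff
  by (auto simp: vector_matrix_mult_def vec_eq_iff sum.distrib sum_distrib_left algebra_simps)

lemmas smooth_on_vector_matrix_mult [smooth_intros] =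
  smooth_on_bilinear[OF bounded_bilinear_vector_matrix_mult]

lemma vector_matrix_linear:
  "x v* ((A::real^'l^'m) + B) = x v* A + x v* B" "x v* (A - B) = x v* A - x v* B"
  "(x + y) v* A = x v* A + y v* A" "(x - y) v* A = x v* A - y v* A" "(r *\<^sub>R x) v* A = r *\<^sub>R (x v* A)"
  "(- x) v* A = - (x v* A)"
  by (simp_all add: bounded_bilinear.add_right[OF bounded_bilinear_vector_matrix_mult]
      bounded_bilinear.diff_right[OF bounded_bilinear_vector_matrix_mult]
      bounded_bilinear.add_left[OF bounded_bilinear_vector_matrix_mult]
      bounded_bilinear.diff_left[OF bounded_bilinear_vector_matrix_mult]
      bounded_bilinear.scaleR_left[OF bounded_bilinear_vector_matrix_mult]
      bounded_bilinear.minus_left[OF bounded_bilinear_vector_matrix_mult])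

lemma frechet_derivative_matrix_inv:
  fixes A :: "real^'k \<Rightarrow> real^'l^'l"
  assumes A: "smooth_on S A" and inv: "\<And>x. x \<in> S \<Longrightarrow> invertible (A x)" and z: "z \<in> S"
  shows "frechet_derivative (\<lambda>x. matrix_inv (A x)) (at z) Z =
    - (matrix_inv (A z) ** frechet_derivative A (at z) Z ** matrix_inv (A z))"
proof -
  let ?P = "\<lambda>x. matrix_inv (A x)"
  let ?D = "frechet_derivative ?P (at z) Z" and ?E = "frechet_derivative A (at z) Z"
  have d: "A differentiable (at z)" "?P differentiable (at z)"
    using smooth_on_differentiable z A smooth_on_matrix_inv[OF A inv] by blast+
  have "frechet_derivative (\<lambda>x. ?P x ** A x) (at z) Z = 0"
    using frechet_derivative_cong_open[OF smooth_on_open[OF A] z, of "\<lambda>x. ?P x ** A x" "\<lambda>_. mat 1"]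
    by (simp add: matrix_inv_inverse inv)
  then have "(?D ** A z + ?P z ** ?E) ** ?P z = 0"
    by (simp add: frechet_derivative_bilinear[OF bounded_bilinear_matrix_mult] d)
  then have "?D ** (A z ** ?P z) + ?P z ** ?E ** ?P z = 0"
    by (simp add: matrix_expand)
  then show ?thesis
    by (simp add: matrix_inv_inverse inv z eq_neg_iff_add_eq_0)
qed

definition bundle_vec :: "real^'n \<Rightarrow> real^'n \<Rightarrow> real^('n + 'n)" where
  "bundle_vec a b = (\<chi> i. case i of Inl h \<Rightarrow> a $ h | Inr h \<Rightarrow> b $ h)"

lemma q_part_bundle_vec [simp]: "q_part (bundle_vec a b) = a"
  and p_part_bundle_vec [simp]: "p_part (bundle_vec a b) = b"
  by (simp_all add: q_part_def p_part_def bundle_vec_def)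

lemma bundle_vec_parts: "bundle_vec (q_part X) (p_part X) = X"
  by (simp add: q_part_def p_part_def bundle_vec_def vec_eq_iff split: sum.split)

lemma bundle_vec_eqI: "q_part X = q_part Y \<Longrightarrow> p_part X = p_part Y \<Longrightarrow> X = Y"
  by (metis bundle_vec_parts)

lemma q_part_linear: "linear q_part" and p_part_linear: "linear p_part"
  by (auto simp: linear_iff q_part_def p_part_def vec_eq_iff)

lemma q_part_bounded_linear: "bounded_linear q_part" and p_part_bounded_linear: "bounded_linear p_part"
  using q_part_linear p_part_linear by (simp_all add: linear_conv_bounded_linear)

lemmas part_simps [simp] = linear_add[OF q_part_linear] linear_add[OF p_part_linear]
  linear_diff[OF q_part_linear] linear_diff[OF p_part_linear]
  linear_neg[OF q_part_linear] linear_neg[OF p_part_linear]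
  linear_cmul[OF q_part_linear] linear_cmul[OF p_part_linear]
  linear_0[OF q_part_linear] linear_0[OF p_part_linear]

lemma q_part_axis [simp]: "q_part (axis (Inl i) 1) = axis i 1" "q_part (axis (Inr i) 1) = 0"
  and p_part_axis [simp]: "p_part (axis (Inl i) 1) = 0" "p_part (axis (Inr i) 1) = axis i 1"
  by (auto simp: q_part_def p_part_def axis_def vec_eq_iff)

lemma open_bundle_set:
  fixes S :: "(real^'n) set"
  assumes "open S"
  shows "open {z. q_part z \<in> S \<and> p_part z \<noteq> 0}"
proof -
  have "continuous_on UNIV (q_part :: real^('n + 'n) \<Rightarrow> _)" "continuous_on UNIV (p_part :: real^('n + 'n) \<Rightarrow> _)"
    by (simp_all add: linear_continuous_on q_part_bounded_linear p_part_bounded_linear)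
  then have "open (q_part -` S :: (real^('n + 'n)) set)" "open (p_part -` (- {0}) :: (real^('n + 'n)) set)"
    using assms by (auto simp: continuous_on_open_vimage)
  moreover have "{z. q_part z \<in> S \<and> p_part z \<noteq> 0} = q_part -` S \<inter> p_part -` (- {0})" by auto
  ultimately show ?thesis by (simp only: open_Int)
qed

lemma sum_UNIV_sum:
  "(\<Sum>a\<in>(UNIV :: ('n::finite + 'n) set). f a) = (\<Sum>i\<in>UNIV. f (Inl i)) + (\<Sum>i\<in>UNIV. f (Inr i))"
  unfolding UNIV_Plus_UNIV[symmetric] by (subst sum.Plus) (simp_all add: o_def)

lemma matrix_of_bilinear:
  fixes B :: "real^'k \<Rightarrow> real^'k \<Rightarrow> real"
  assumes "bilinear B"
  shows "X \<bullet> ((\<chi> a b. B (axis a 1) (axis b 1)) *v Y) = B X Y"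
proof -
  have "B X Y = B (\<Sum>a\<in>UNIV. X $ a *\<^sub>R axis a 1) (\<Sum>b\<in>UNIV. Y $ b *\<^sub>R axis b 1)"
    by (simp add: basis_expansion flip: scalar_mult_eq_scaleR)
  also have "\<dots> = (\<Sum>a\<in>UNIV. \<Sum>b\<in>UNIV. X $ a * (Y $ b * B (axis a 1) (axis b 1)))"
    using assms by (simp add: bilinear_sum[OF assms] bilinear_lmul[OF assms] bilinear_rmul[OF assms]
        sum.cartesian_product mult.left_commute)
  finally show ?thesis
    by (simp add: inner_vec_def matrix_vector_mult_def sum_distrib_left algebra_simps)
qed

section \<open>The metric and the complex structure in the adapted frame\<close>

lemma curvature_endo_connection:
  fixes g :: "real^'k \<Rightarrow> real^'k^'k"
  assumes "local_metric U g" and y: "y \<in> U"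
  defines "D \<equiv> \<lambda>X Y. frechet_derivative (\<lambda>y. connection_endo g y Y) (at y) X"
  shows "curvature_endo g y X Y = D X Y - D Y X
    + connection_endo g y X ** connection_endo g y Y - connection_endo g y Y ** connection_endo g y X"
proof -
  interpret local_metric U g by fact
  let ?C = "connection_matrix g"
  have diff: "(\<lambda>y. Y $ b *\<^sub>R ?C b y) differentiable (at y)" for b Y
    by (intro smooth_on_differentiable[OF _ y] smooth_intros smooth_connection open_U)
  have "D X Y = (\<Sum>b\<in>UNIV. frechet_derivative (\<lambda>y. Y $ b *\<^sub>R ?C b y) (at y) X)" for X Y
    unfolding D_def connection_endo_def by (rule frechet_derivative_sum) (rule diff)
  also have "\<dots> X Y = (\<Sum>a\<in>UNIV. \<Sum>b\<in>UNIV. (X $ a * Y $ b) *\<^sub>R partial_deriv a (?C b) y)" for X Y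
    using smooth_on_differentiable[OF smooth_connection y]
    by (simp add: frechet_derivative_bounded_linear[OF bounded_linear_scaleR_right]
        frechet_derivative_partials scaleR_sum_right) (subst sum.swap, simp add: mult.commute)
  finally have D: "D X Y = (\<Sum>a\<in>UNIV. \<Sum>b\<in>UNIV. (X $ a * Y $ b) *\<^sub>R partial_deriv a (?C b) y)" for X Y .
  have D': "D Y X = (\<Sum>a\<in>UNIV. \<Sum>b\<in>UNIV. (X $ a * Y $ b) *\<^sub>R partial_deriv b (?C a) y)"
    unfolding D by (rule trans[OF sum.swap]) (simp add: mult.commute)
  have C: "connection_endo g y X ** connection_endo g y Y =
      (\<Sum>a\<in>UNIV. \<Sum>b\<in>UNIV. (X $ a * Y $ b) *\<^sub>R (?C a y ** ?C b y))" for X Y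
    by (simp add: connection_endo_def matrix_sum_expand)
      (simp add: scaleR_sum_right, subst sum.swap, simp add: mult.commute)
  have C': "connection_endo g y Y ** connection_endo g y X =
      (\<Sum>a\<in>UNIV. \<Sum>b\<in>UNIV. (X $ a * Y $ b) *\<^sub>R (?C b y ** ?C a y))"
    unfolding C by (rule trans[OF sum.swap]) (simp add: mult.commute)
  show ?thesis
    unfolding D[of X Y] D' C[of X Y] C'
    by (simp add: curvature_endo_def curvature_matrix_eq[OF y] scaleR_add_right scaleR_diff_right
        sum.distrib sum_subtractf)
qed

lemma (in local_metric) koszul:
  assumes y: "y \<in> U"
  defines "D \<equiv> frechet_derivative g (at y)"
  shows "2 * (W \<bullet> (g y *v (connection_endo g y X *v Y))) =
    W \<bullet> (D X *v Y) + W \<bullet> (D Y *v X) - X \<bullet> (D W *v Y)"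
proof -
  let ?C = "connection_endo g y"
  have D: "Z \<bullet> (D X *v Y) = (?C X *v Z) \<bullet> (g y *v Y) + Z \<bullet> (g y *v (?C X *v Y))" for X Y Z
    by (simp add: D_def metric_compatible_endo[OF y] matrix_vector_mult_add_rdistrib inner_add_right
        flip: matrix_vector_mul_assoc) (metis dot_lmul_matrix inner_commute)
  show ?thesis
    using connection_endo_commute[OF y, of X W] connection_endo_commute[OF y, of Y W]
      connection_endo_commute[OF y, of X Y] inner_g_commute[OF y, of "?C W *v Y" X]
    unfolding D by simp
qed

text \<open>The smoothness of \<open>v\<close> is expressed through compositions, since \<^const>\<open>smooth_on\<close> is about functions
  on \<open>real^'k\<close>. The condition on \<open>v\<close> is \<open>v(t) > - sqrt (c / (2 t))\<close>, multiplied out.\<close>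

locale cotangent_metric = local_metric U g for U :: "(real^'n) set" and g +
  fixes c :: real and v v' :: "real \<Rightarrow> real"
  assumes c_pos: "c > 0"
    and v_smooth: "\<And>(S :: (real^('n + 'n)) set) f. smooth_on S f \<Longrightarrow> (\<And>z. z \<in> S \<Longrightarrow> f z > 0) \<Longrightarrow>
      smooth_on S (\<lambda>z. v (f z))"
    and v_deriv: "\<And>t. t > 0 \<Longrightarrow> (v has_real_derivative v' t) (at t)"
    and v_bound: "\<And>t. t > 0 \<Longrightarrow> c + sqrt (2 * c * t) * v t > 0"
begin

definition W :: "(real^('n + 'n)) set" where
  "W = {z. q_part z \<in> U \<and> p_part z \<noteq> 0}"

abbreviation gq :: "real^('n + 'n) \<Rightarrow> real^'n^'n" where "gq z \<equiv> g (q_part z)"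
abbreviation P :: "real^('n + 'n) \<Rightarrow> real^'n^'n" where "P z \<equiv> matrix_inv (g (q_part z))"
abbreviation u :: "real^('n + 'n) \<Rightarrow> real^'n" where "u z \<equiv> P z *v p_part z"
abbreviation t :: "real^('n + 'n) \<Rightarrow> real" where "t z \<equiv> energy g z"
abbreviation s :: "real^('n + 'n) \<Rightarrow> real" where "s z \<equiv> sqrt (2 * c * t z)"
abbreviation vt :: "real^('n + 'n) \<Rightarrow> real" where "vt z \<equiv> v (t z)"
abbreviation \<Gamma> :: "real^('n + 'n) \<Rightarrow> real^'n \<Rightarrow> real^'n^'n" where "\<Gamma> z \<equiv> connection_endo g (q_part z)"

definition Gl :: "real^('n + 'n) \<Rightarrow> real^'n^'n" where "Gl z = (\<chi> i j. G_low c v g z i j)"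
definition Hu :: "real^('n + 'n) \<Rightarrow> real^'n^'n" where "Hu z = (\<chi> i j. H_up c v g z i j)"

text \<open>The value of \<open>\<Gamma>\<^sup>0\<^sub>i\<^sub>h a\<^sup>h\<close>, and the vertical part \<open>Dp\<close> of a tangent vector.\<close>

definition K :: "real^('n + 'n) \<Rightarrow> real^'n \<Rightarrow> real^'n" where "K z a = p_part z v* \<Gamma> z a"
definition Dpv :: "real^('n + 'n) \<Rightarrow> real^('n + 'n) \<Rightarrow> real^'n" where
  "Dpv z X = p_part X - K z (q_part X)"

abbreviation G :: "real^('n + 'n) \<Rightarrow> real^('n + 'n)^('n + 'n)" where
  "G \<equiv> metric_G c v (\<lambda>_::unit. g) ()"
abbreviation J :: "real^('n + 'n) \<Rightarrow> real^('n + 'n)^('n + 'n)" where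
  "J \<equiv> structure_J c v (\<lambda>_::unit. g) ()"

lemma W_q: "z \<in> W \<Longrightarrow> q_part z \<in> U" and W_p: "z \<in> W \<Longrightarrow> p_part z \<noteq> 0"
  by (auto simp: W_def)

lemma open_W: "open W"
  unfolding W_def by (rule open_bundle_set[OF open_U])

lemma P_inverse:
  assumes "z \<in> W"
  shows "gq z *v (P z *v a) = a" "P z *v (gq z *v a) = a"
  using matrix_inv_inverse[OF invertible_g[OF W_q[OF assms]]] by (simp_all add: matrix_vector_mul_assoc)

lemma P_inner_commute: "z \<in> W \<Longrightarrow> a \<bullet> (P z *v b) = b \<bullet> (P z *v a)"
  using inner_g_commute[OF W_q, of z "P z *v a" "P z *v b"] by (simp add: P_inverse inner_commute)

lemma energy_inner: "t z = 1/2 * (p_part z \<bullet> u z)"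
  by (simp add: energy_def inner_vec_def matrix_vector_mult_def sum_distrib_left algebra_simps)

lemma energy_pos:
  assumes "z \<in> W"
  shows "t z > 0"
proof -
  have "u z \<noteq> 0" using W_p[OF assms] P_inverse(1)[OF assms, of "p_part z"] by auto
  then show ?thesis
    using positive[OF W_q[OF assms], of "u z"]
    by (simp add: energy_inner P_inverse[OF assms] inner_commute)
qed

lemma p_u: "p_part z \<bullet> u z = 2 * t z"
  by (simp add: energy_inner)

lemma s_pos: "z \<in> W \<Longrightarrow> s z > 0" and s_square: "z \<in> W \<Longrightarrow> s z * s z = 2 * c * t z"
  using energy_pos[of z] c_pos by simp_all

lemma denominator_pos: "z \<in> W \<Longrightarrow> c + s z * vt z > 0"
  using v_bound energy_pos by blast

lemma Gl_mult: "Gl z *v a = s z *\<^sub>R (gq z *v a) + (vt z * (p_part z \<bullet> a)) *\<^sub>R p_part z"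
  by (simp add: Gl_def G_low_def matrix_vector_mult_def vec_eq_iff inner_vec_def sum_distrib_left
      sum.distrib algebra_simps)

lemma g0_u: "z \<in> W \<Longrightarrow> g0 g z i = u z $ i"
proof -
  assume z: "z \<in> W"
  have "P z $ h $ i = P z $ i $ h" for h
    using P_inner_commute[OF z, of "axis h 1" "axis i 1"] by (simp add: inner_axis_matrix)
  then show ?thesis by (simp add: g0_def matrix_vector_mult_def mult.commute)
qed

lemma Hu_mult:
  assumes "z \<in> W"
  shows "Hu z *v a = (1 / s z) *\<^sub>R (P z *v a)
    - (vt z / (2 * t z * (c + s z * vt z)) * (u z \<bullet> a)) *\<^sub>R u z"
proof -
  have "Hu z = (1 / s z) *\<^sub>R P z - (vt z / (2 * t z * (c + s z * vt z))) *\<^sub>R (\<chi> i j. u z $ i * u z $ j)"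
    by (simp add: Hu_def H_up_def Let_def vec_eq_iff g0_u[OF assms])
  moreover have "(\<chi> i j. u z $ i * u z $ j) *v a = (u z \<bullet> a) *\<^sub>R u z"
    by (simp add: matrix_vector_mult_def[of "\<chi> i j. u z $ i * u z $ j"] vec_eq_iff inner_vec_def sum_distrib_left algebra_simps)
  ultimately show ?thesis
    by (simp add: matrix_vector_mult_diff_rdistrib flip: scaleR_matrix_vector_assoc)
qed

lemma Gl_u:
  assumes "z \<in> W"
  shows "Gl z *v u z = (s z + 2 * t z * vt z) *\<^sub>R p_part z"
  by (simp add: Gl_mult P_inverse[OF assms] p_u algebra_simps)

lemma factor_eq: "z \<in> W \<Longrightarrow> c * (s z + 2 * t z * vt z) = s z * (c + s z * vt z)"
  using s_square[of z] by (simp add: algebra_simps)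

text \<open>The two rank one terms cancel because \<open>s\<^sup>2 = 2 c t\<close> gives
  \<open>(s + 2 t v) / (2 t (c + s v)) = 1 / s\<close>.\<close>

lemma Gl_Hu:
  assumes z: "z \<in> W"
  shows "Gl z *v (Hu z *v a) = a"
proof -
  let ?d = "2 * t z * (c + s z * vt z)"
  have nz: "s z \<noteq> 0" "?d \<noteq> 0" "t z \<noteq> 0" "c + s z * vt z \<noteq> 0" "c \<noteq> 0"
    using s_pos[OF z] denominator_pos[OF z] energy_pos[OF z] c_pos by simp_all
  have pu: "p_part z \<bullet> (P z *v a) = u z \<bullet> a" using P_inner_commute[OF z, of a] by (simp add: inner_commute)
  have E: "(s z + 2 * t z * vt z) / ?d = 1 / s z"
  proof -
    have "(s z + 2 * t z * vt z) * s z = ?d"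
    proof -
      have "c * ((s z + 2 * t z * vt z) * s z) = (s z * s z) * (c + s z * vt z)"
        unfolding mult.assoc[symmetric] factor_eq[OF z] by (simp only: mult_ac)
      also have "\<dots> = c * ?d" unfolding s_square[OF z] by simp
      finally show ?thesis using nz(5) mult_left_cancel by blast
    qed
    then show ?thesis unfolding frac_eq_eq[OF nz(2) nz(1)] mult_1 .
  qed
  have k: "vt z / s z = vt z / ?d * (s z + 2 * t z * vt z)"
  proof -
    have "vt z / s z = vt z * (1 / s z)" by simp
    also have "\<dots> = vt z / ?d * (s z + 2 * t z * vt z)" unfolding E[symmetric] by simp
    finally show ?thesis .
  qed
  have "Gl z *v (Hu z *v a) = (1 / s z) *\<^sub>R (Gl z *v (P z *v a)) - (vt z / ?d * (u z \<bullet> a)) *\<^sub>R (Gl z *v u z)"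
    by (simp add: Hu_mult[OF z] matrix_vector_mult_diff_distrib matrix_vector_mult_scaleR)
  also have "\<dots> = a + (vt z / s z * (u z \<bullet> a)) *\<^sub>R p_part z
      - (vt z / ?d * (u z \<bullet> a) * (s z + 2 * t z * vt z)) *\<^sub>R p_part z"
    using nz unfolding Gl_u[OF z] by (simp add: Gl_mult P_inverse[OF z] pu scaleR_add_right)
  also have "\<dots> = a" unfolding k by (simp add: algebra_simps)
  finally show ?thesis .
qed

lemma Gl_Hu_matrix: "z \<in> W \<Longrightarrow> Gl z ** Hu z = mat 1"
  by (simp add: matrix_eq Gl_Hu flip: matrix_vector_mul_assoc)

lemma Hu_Gl: "z \<in> W \<Longrightarrow> Hu z *v (Gl z *v a) = a"
  using Gl_Hu_matrix[of z] matrix_left_right_inverse[of "Gl z" "Hu z"] by (simp add: matrix_vector_mul_assoc)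

lemma Gl_invertible: "z \<in> W \<Longrightarrow> invertible (Gl z)" and Hu_inv: "z \<in> W \<Longrightarrow> Hu z = matrix_inv (Gl z)"
proof -
  assume z: "z \<in> W"
  show i: "invertible (Gl z)"
    using Gl_Hu_matrix[OF z] matrix_left_right_inverse[of "Gl z" "Hu z"] by (auto simp: invertible_def)
  have "Hu z = matrix_inv (Gl z) ** (Gl z ** Hu z)"
    using matrix_inv_inverse(2)[OF i] by (simp add: matrix_mul_assoc)
  then show "Hu z = matrix_inv (Gl z)" by (simp add: Gl_Hu_matrix[OF z])
qed

lemma Gl_inner_commute: "z \<in> W \<Longrightarrow> a \<bullet> (Gl z *v b) = b \<bullet> (Gl z *v a)"
  using inner_g_commute[OF W_q, of z a b] by (simp add: Gl_mult inner_add_right inner_commute)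

lemma Hu_inner_commute: "z \<in> W \<Longrightarrow> a \<bullet> (Hu z *v b) = b \<bullet> (Hu z *v a)"
  using Gl_inner_commute[of z "Hu z *v a" "Hu z *v b"] by (simp add: Gl_Hu inner_commute)

text \<open>Positivity of \<open>G\<^sub>i\<^sub>j\<close>: on the orthogonal complement of \<open>u\<close> it is \<open>s g\<close>, and on \<open>u\<close> it is \<open>g\<close>
  times the positive factor \<open>s (c + s v) / c\<close>. The vector \<open>a\<close> is split orthogonally along \<open>u\<close>.\<close>

lemma Gl_positive:
  assumes z: "z \<in> W" and a: "a \<noteq> 0"
  shows "a \<bullet> (Gl z *v a) > 0"
proof -
  define r where "r = (p_part z \<bullet> a) / (2 * t z)"
  define b where "b = a - r *\<^sub>R u z"
  have t: "t z > 0" by (rule energy_pos[OF z])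
  have pb: "p_part z \<bullet> b = 0" using t by (simp add: b_def r_def inner_diff_right p_u)
  have ab: "a = b + r *\<^sub>R u z" by (simp add: b_def)
  have "u z \<bullet> (Gl z *v b) = 0"
    unfolding Gl_inner_commute[OF z, of "u z"] Gl_u[OF z] using pb by (simp add: inner_commute)
  then have "a \<bullet> (Gl z *v a) = b \<bullet> (Gl z *v b) + r * (r * (u z \<bullet> (Gl z *v u z)))"
    using Gl_inner_commute[OF z, of "u z" b]
    by (simp add: ab inner_add_left inner_add_right matrix_vector_right_distrib matrix_vector_mult_scaleR)
  also have "b \<bullet> (Gl z *v b) = s z * (b \<bullet> (gq z *v b))"
    using pb by (simp add: Gl_mult inner_add_right)
  also have "u z \<bullet> (Gl z *v u z) = (s z + 2 * t z * vt z) * (2 * t z)"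
    by (simp add: Gl_u[OF z] p_u inner_commute)
  finally have e: "a \<bullet> (Gl z *v a) = s z * (b \<bullet> (gq z *v b)) + (s z + 2 * t z * vt z) * (2 * t z) * r\<^sup>2"
    by (simp add: power2_eq_square algebra_simps)
  have f: "s z + 2 * t z * vt z > 0"
  proof -
    have "c * (s z + 2 * t z * vt z) > 0"
      unfolding factor_eq[OF z] using s_pos[OF z] denominator_pos[OF z] by simp
    then show ?thesis using c_pos by (simp add: zero_less_mult_iff)
  qed
  show ?thesis
  proof (cases "b = 0")
    case True
    then have "r \<noteq> 0" using a ab by auto
    then show ?thesis unfolding e using f t True by simp
  next
    case False
    then show ?thesis
      unfolding e using positive[OF W_q[OF z] False] s_pos[OF z] f t
      by (intro add_pos_nonneg) auto
  qed
qed

lemma Hu_positive: "z \<in> W \<Longrightarrow> a \<noteq> 0 \<Longrightarrow> a \<bullet> (Hu z *v a) > 0"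
  using Gl_positive[of z "Hu z *v a"] Gl_Hu[of z a] by (metis inner_commute matrix_vector_mult_0_right)

lemma K_inner: "K z a \<bullet> b = p_part z \<bullet> (\<Gamma> z a *v b)"
  by (simp add: K_def dot_lmul_matrix)

lemma K_sym: "z \<in> W \<Longrightarrow> K z a \<bullet> b = K z b \<bullet> a"
  by (simp add: K_inner connection_endo_commute[OF W_q])

lemma K_linear: "linear (K z)"
proof (rule linearI)
  show "K z (a + b) = K z a + K z b" for a b
    by (simp add: K_def linear_add[OF connection_endo_linear] vector_matrix_linear)
  show "K z (r *\<^sub>R a) = r *\<^sub>R K z a" for a r
    by (simp add: K_def linear_cmul[OF connection_endo_linear]
        bounded_bilinear.scaleR_right[OF bounded_bilinear_vector_matrix_mult])
qed

lemma Dpv_linear: "linear (Dpv z)"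
  by (rule linearI) (simp_all add: Dpv_def linear_add[OF K_linear] linear_cmul[OF K_linear] algebra_simps)

lemma Gamma0_K: "Gamma0 g z i h = K z (axis i 1) $ h"
  by (simp add: Gamma0_def K_def vector_matrix_mult_def connection_matrix_def connection_endo_axis mult.commute)

lemma Gamma0_sym: "z \<in> W \<Longrightarrow> Gamma0 g z i h = Gamma0 g z h i"
  using K_sym[of z "axis i 1" "axis h 1"] by (simp add: Gamma0_K inner_axis)

lemma Dp_Dpv: "z \<in> W \<Longrightarrow> Dp g z i X = Dpv z X $ i"
proof -
  assume z: "z \<in> W"
  have "(\<Sum>j\<in>UNIV. Gamma0 g z i j * X $ Inl j) = K z (axis i 1) \<bullet> q_part X"
    by (simp add: Gamma0_K inner_vec_def q_part_def)
  also have "\<dots> = K z (q_part X) $ i" by (subst K_sym[OF z]) (simp add: inner_axis)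
  finally show ?thesis by (simp add: Dp_def Dpv_def p_part_def)
qed

lemma G_inner:
  assumes z: "z \<in> W"
  shows "X \<bullet> (G z *v Y) = q_part X \<bullet> (Gl z *v q_part Y) + Dpv z X \<bullet> (Hu z *v Dpv z Y)"
proof -
  let ?B = "\<lambda>X Y. q_part X \<bullet> (Gl z *v q_part Y) + Dpv z X \<bullet> (Hu z *v Dpv z Y)"
  have "bilinear ?B"
    unfolding bilinear_def
    by (auto intro!: linearI simp: linear_add[OF Dpv_linear] linear_cmul[OF Dpv_linear] inner_add_left
        inner_add_right matrix_vector_right_distrib matrix_vector_mult_scaleR algebra_simps)
  moreover have "G z = (\<chi> a b. ?B (axis a 1) (axis b 1))"
    by (simp add: metric_G_def Let_def vec_eq_iff Dp_Dpv[OF z] dq_def Gl_def[of z] Hu_def[of z] inner_vec_def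
        matrix_vector_mult_def q_part_def sum_distrib_left algebra_simps)
  ultimately show ?thesis using matrix_of_bilinear[of ?B X Y] by simp
qed

lemma parts_eqI: "q_part X = q_part Y \<Longrightarrow> Dpv z X = Dpv z Y \<Longrightarrow> X = Y"
  by (rule bundle_vec_eqI) (auto simp: Dpv_def)

lemma q_J:
  assumes z: "z \<in> W"
  shows "q_part (J z *v X) = - (Hu z *v Dpv z X)"
proof -
  have "q_part (J z *v X) $ i = - (\<Sum>h\<in>UNIV. Hu z $ h $ i * Dpv z X $ h)" for i
    by (simp add: structure_J_mult q_part_def partial_p_def delta_q_def axis_def Dp_Dpv[OF z] sum_negf Hu_def
        if_distrib[of "\<lambda>x. _ * x"] sum.delta cong: if_cong) (simp add: algebra_simps)
  moreover have "Hu z $ h $ i = Hu z $ i $ h" for h i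
    using Hu_inner_commute[OF z, of "axis h 1" "axis i 1"] by (simp add: inner_axis_matrix)
  ultimately show ?thesis by (simp add: vec_eq_iff matrix_vector_mult_def)
qed

lemma p_J:
  assumes z: "z \<in> W"
  shows "p_part (J z *v X) = Gl z *v q_part X + K z (q_part (J z *v X))"
proof -
  have K: "K z a $ i = (\<Sum>k\<in>UNIV. a $ k * Gamma0 g z k i)" for a i
  proof -
    have "K z a $ i = K z (axis i 1) \<bullet> a" using K_sym[OF z, of a "axis i 1"] by (simp add: inner_axis)
    also have "\<dots> = (\<Sum>k\<in>UNIV. a $ k * Gamma0 g z i k)" by (simp add: inner_vec_def Gamma0_K mult.commute)
    finally show ?thesis by (simp add: Gamma0_sym[OF z, of i])
  qed
  have Gs: "Gl z $ h $ i = Gl z $ i $ h" for h i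
    using Gl_inner_commute[OF z, of "axis h 1" "axis i 1"] by (simp add: inner_axis_matrix)
  have Hs: "Hu z $ h $ i = Hu z $ i $ h" for h i
    using Hu_inner_commute[OF z, of "axis h 1" "axis i 1"] by (simp add: inner_axis_matrix)
  have "p_part (J z *v X) $ i = (\<Sum>h\<in>UNIV. Gl z $ h $ i * q_part X $ h)
      - (\<Sum>h\<in>UNIV. Dpv z X $ h * (\<Sum>k\<in>UNIV. Hu z $ h $ k * Gamma0 g z k i))" for i
    by (simp add: structure_J_mult q_part_def p_part_def partial_p_def delta_q_def axis_def Dp_Dpv[OF z] sum_negf
        Hu_def Gl_def dq_def if_distrib[of "\<lambda>x. _ * x"] sum.delta cong: if_cong) (simp add: algebra_simps)
  also have "\<dots> i = (Gl z *v q_part X) $ i + K z (q_part (J z *v X)) $ i" for i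
    unfolding q_J[OF z] K
    by (simp add: matrix_vector_mult_def Gs[of _ i] sum_negf sum_distrib_right sum_distrib_left)
      (subst sum.swap, simp add: Hs mult_ac)
  finally show ?thesis by (simp add: vec_eq_iff)
qed

lemma Dpv_J: "z \<in> W \<Longrightarrow> Dpv z (J z *v X) = Gl z *v q_part X"
  by (simp add: Dpv_def p_J)

end

lemmas has_derivative_parts = bounded_linear.has_derivative[OF q_part_bounded_linear]
  bounded_linear.has_derivative[OF p_part_bounded_linear]

lemma has_derivative_base:
  assumes "f differentiable (at (q_part z))"
  shows "((\<lambda>z. f (q_part z)) has_derivative (\<lambda>Z. frechet_derivative f (at (q_part z)) (q_part Z))) (at z)"
  using diff_chain_at[OF bounded_linear_imp_has_derivative[OF q_part_bounded_linear]
      differentiable_has_derivative[OF assms]] by (simp add: o_def)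

lemmas has_derivative_mult_vec = bounded_bilinear.FDERIV[OF bounded_bilinear_matrix_vector_mult]
lemmas has_derivative_vec_mult = bounded_bilinear.FDERIV[OF bounded_bilinear_vector_matrix_mult]

lemma frechet_derivative_mult_vec:
  "A differentiable (at z) \<Longrightarrow> ((\<lambda>z. A z *v a) has_derivative (\<lambda>Z. frechet_derivative A (at z) Z *v a)) (at z)"
  for A :: "real^'k \<Rightarrow> real^'l^'m"
  using has_derivative_mult_vec[OF differentiable_has_derivative has_derivative_const[of a]] by simp

context cotangent_metric
begin

lemma smooth_on_part: "smooth_on W q_part" "smooth_on W p_part"
  using smooth_on_linear[OF q_part_bounded_linear open_W] smooth_on_linear[OF p_part_bounded_linear open_W]
  by simp_all

lemma smooth_on_base: "smooth_on U f \<Longrightarrow> smooth_on W (\<lambda>z. f (q_part z))"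
  by (rule smooth_on_compose[OF _ smooth_on_part(1)]) (auto simp: W_def)

lemma smooth_on_gq: "smooth_on W (\<lambda>z. gq z)"
  by (rule smooth_on_base[OF smooth])

lemma smooth_on_P: "smooth_on W (\<lambda>z. P z)"
  by (rule smooth_on_matrix_inv[OF smooth_on_gq]) (simp add: invertible_g W_q)

lemma smooth_on_energy: "smooth_on W (\<lambda>z. t z)"
  unfolding energy_inner by (intro smooth_intros smooth_on_P smooth_on_part open_W)

lemma smooth_on_s: "smooth_on W (\<lambda>z. s z)"
  using energy_pos c_pos by (intro smooth_intros smooth_on_energy open_W) simp

lemma smooth_on_vt: "smooth_on W (\<lambda>z. vt z)"
  using energy_pos by (intro v_smooth smooth_on_energy)

lemma smooth_on_Gl: "smooth_on W Gl"
  unfolding Gl_def[abs_def] G_low_def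
  by (intro smooth_intros smooth_on_s smooth_on_vt smooth_on_gq smooth_on_part open_W)

lemma smooth_on_Hu: "smooth_on W Hu"
  by (rule smooth_on_cong[OF smooth_on_matrix_inv[OF smooth_on_Gl]]) (simp_all add: Gl_invertible Hu_inv)

lemma smooth_on_Gamma0: "smooth_on W (\<lambda>z. Gamma0 g z i h)"
  unfolding Gamma0_def
  by (intro smooth_intros smooth_on_base[OF smooth_christoffel] smooth_on_part open_W)

lemma smooth_on_Dp: "smooth_on W (\<lambda>z. Dp g z i X)"
  unfolding Dp_def by (intro smooth_intros smooth_on_Gamma0 open_W)

lemma smooth_on_entries:
  "smooth_on W (\<lambda>z. G_low c v g z h k)" "smooth_on W (\<lambda>z. H_up c v g z h k)"
  using smooth_on_vec_nth[OF smooth_on_vec_nth[OF smooth_on_Gl]]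
    smooth_on_vec_nth[OF smooth_on_vec_nth[OF smooth_on_Hu]] by (simp_all add: Gl_def Hu_def)

lemma smooth_on_G: "smooth_on W G"
  unfolding metric_G_def[abs_def] Let_def
  by (intro smooth_intros smooth_on_Dp smooth_on_entries open_W)

lemma smooth_on_J: "smooth_on W J"
proof -
  have "smooth_on W (\<lambda>z. delta_q g z k)" for k
    unfolding delta_q_def by (intro smooth_intros smooth_on_Gamma0 open_W)
  then show ?thesis
    unfolding structure_J_def[abs_def] matrix_def
    by (intro smooth_intros smooth_on_Dp smooth_on_entries open_W)
qed

lemma G_symmetric: "z \<in> W \<Longrightarrow> transpose (G z) = G z"
proof (rule matrix_eq_inner)
  fix X Y
  assume z: "z \<in> W"
  have "X \<bullet> (transpose (G z) *v Y) = Y \<bullet> (G z *v X)"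
    by (simp only: inner_matrix_transpose[of X] transpose_transpose inner_commute)
  then show "X \<bullet> (transpose (G z) *v Y) = X \<bullet> (G z *v Y)"
    unfolding G_inner[OF z] Gl_inner_commute[OF z, of "q_part Y"] Hu_inner_commute[OF z, of "Dpv z Y"] .
qed

lemma G_positive:
  assumes z: "z \<in> W" and X: "X \<noteq> 0"
  shows "X \<bullet> (G z *v X) > 0"
proof -
  have "q_part X \<noteq> 0 \<or> Dpv z X \<noteq> 0"
    using X parts_eqI[of X 0 z] linear_0[OF Dpv_linear] by auto
  then show ?thesis
    unfolding G_inner[OF z]
    using Gl_positive[OF z, of "q_part X"] Hu_positive[OF z, of "Dpv z X"]
    by (cases "q_part X = 0"; cases "Dpv z X = 0") (auto intro: add_pos_pos)
qed

lemma J_J: "z \<in> W \<Longrightarrow> J z *v (J z *v X) = - X"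
  by (rule parts_eqI[of _ _ z])
    (simp_all add: q_J Dpv_J linear_neg[OF Dpv_linear] Hu_Gl Gl_Hu matrix_vector_minus)

lemma J_square: "z \<in> W \<Longrightarrow> J z ** J z = - mat 1"
  by (simp add: matrix_eq J_J matrix_vector_minus flip: matrix_vector_mul_assoc)

lemma G_hermitian: "z \<in> W \<Longrightarrow> (J z *v X) \<bullet> (G z *v (J z *v Y)) = X \<bullet> (G z *v Y)"
  using Hu_inner_commute[of z "Dpv z X" "Dpv z Y"] Gl_inner_commute[of z "q_part X" "q_part Y"]
  by (simp add: G_inner q_J Dpv_J matrix_vector_minus Gl_Hu Hu_Gl inner_commute)

text \<open>The matrices \<open>(G\<^sub>i\<^sub>j)\<close> and \<open>(H\<^sup>k\<^sup>l)\<close> cancel in the product of the metric with \<open>J\<close>, and the symmetry of the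
  Christoffel symbols allows to replace \<open>Dp\<close> by \<open>p\<close>. Hence the components are constant.\<close>

lemma fundamental_form_canonical:
  assumes z: "z \<in> W"
  shows "X \<bullet> (fundamental_form G J z *v Y) = p_part X \<bullet> q_part Y - q_part X \<bullet> p_part Y"
proof -
  have "X \<bullet> (fundamental_form G J z *v Y) = Dpv z X \<bullet> q_part Y - q_part X \<bullet> Dpv z Y"
    by (simp add: fundamental_form_def G_inner[OF z] q_J[OF z] Dpv_J[OF z] Gl_Hu[OF z] Hu_Gl[OF z]
        matrix_vector_minus flip: matrix_vector_mul_assoc)
  then show ?thesis
    using K_sym[OF z, of "q_part X" "q_part Y"]
    by (simp add: Dpv_def inner_diff_left inner_diff_right inner_commute)
qed

lemma fundamental_form_closed:
  assumes z: "z \<in> W"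
  shows "partial_deriv a (\<lambda>z. fundamental_form G J z $ b $ d) z = 0"
proof -
  have "partial_deriv a (\<lambda>z. fundamental_form G J z $ b $ d) z =
      partial_deriv a (\<lambda>z. p_part (axis b 1) \<bullet> q_part (axis d 1) - q_part (axis b 1) \<bullet> p_part (axis d 1)) z"
  proof (rule partial_deriv_cong_open[OF open_W z])
    fix y assume "y \<in> W"
    from fundamental_form_canonical[OF this, of "axis b 1" "axis d 1"]
    show "fundamental_form G J y $ b $ d
        = p_part (axis b 1) \<bullet> q_part (axis d 1) - q_part (axis b 1) \<bullet> p_part (axis d 1)"
      by (simp only: inner_axis_matrix)
  qed
  then show ?thesis by (simp only: partial_deriv_const)
qed

section \<open>Derivatives along the cotangent bundle\<close>

lemma has_derivative_gq:
  assumes z: "z \<in> W"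
  shows "((\<lambda>z. gq z) has_derivative (\<lambda>Z. transpose (\<Gamma> z (q_part Z)) ** gq z + gq z ** \<Gamma> z (q_part Z))) (at z)"
  using has_derivative_base[OF smooth_on_differentiable[OF smooth W_q[OF z]]]
  by (simp add: metric_compatible_endo[OF W_q[OF z]])

lemma has_derivative_u:
  assumes z: "z \<in> W"
  shows "((\<lambda>z. u z) has_derivative (\<lambda>Z. P z *v Dpv z Z - \<Gamma> z (q_part Z) *v u z)) (at z)"
proof -
  have "P differentiable (at z)" by (rule smooth_on_differentiable[OF smooth_on_P z])
  from has_derivative_mult_vec[OF differentiable_has_derivative[OF this]
      bounded_linear_imp_has_derivative[OF p_part_bounded_linear]]
  have "((\<lambda>z. u z) has_derivative (\<lambda>Z. P z *v p_part Z + frechet_derivative P (at z) Z *v p_part z)) (at z)" .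
  moreover have "P z *v p_part Z + frechet_derivative P (at z) Z *v p_part z =
      P z *v Dpv z Z - \<Gamma> z (q_part Z) *v u z" for Z
  proof -
    have "frechet_derivative P (at z) Z *v p_part z =
        - (P z *v ((transpose (\<Gamma> z (q_part Z)) ** gq z + gq z ** \<Gamma> z (q_part Z)) *v u z))"
      using frechet_derivative_matrix_inv[OF smooth_on_gq _ z, of Z] invertible_g[OF W_q]
      by (simp add: frechet_derivative_eq[OF has_derivative_gq[OF z]] matrix_vector_minus
          flip: matrix_vector_mul_assoc)
    also have "\<dots> = - (P z *v K z (q_part Z)) - \<Gamma> z (q_part Z) *v u z"
      by (simp add: matrix_vector_mult_add_rdistrib matrix_vector_right_distrib P_inverse[OF z] K_def
          flip: matrix_vector_mul_assoc)
    finally show ?thesis by (simp add: Dpv_def matrix_vector_mult_diff_distrib)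
  qed
  ultimately show ?thesis by simp
qed

text \<open>The energy is constant along horizontal curves.\<close>

lemma has_derivative_energy:
  assumes z: "z \<in> W"
  shows "((\<lambda>z. t z) has_derivative (\<lambda>Z. u z \<bullet> Dpv z Z)) (at z)"
proof -
  have "((\<lambda>z. 1/2 * (p_part z \<bullet> u z)) has_derivative
      (\<lambda>Z. 1/2 * (p_part z \<bullet> (P z *v Dpv z Z - \<Gamma> z (q_part Z) *v u z) + p_part Z \<bullet> u z))) (at z)"
    by (intro has_derivative_mult_right has_derivative_inner has_derivative_u[OF z]
        bounded_linear_imp_has_derivative[OF p_part_bounded_linear])
  moreover have "1/2 * (p_part z \<bullet> (P z *v Dpv z Z - \<Gamma> z (q_part Z) *v u z) + p_part Z \<bullet> u z)
      = u z \<bullet> Dpv z Z" for Z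
    using P_inner_commute[OF z, of "p_part z" "Dpv z Z"]
    by (simp add: inner_diff_right Dpv_def inner_diff_left K_inner inner_commute[of "u z"]
        flip: K_inner)
  ultimately show ?thesis by (simp add: energy_inner)
qed

lemma has_derivative_s:
  assumes z: "z \<in> W"
  shows "((\<lambda>z. s z) has_derivative (\<lambda>Z. c / s z * (u z \<bullet> Dpv z Z))) (at z)"
proof -
  have "((\<lambda>z. 2 * c * t z) has_derivative (\<lambda>Z. 2 * c * (u z \<bullet> Dpv z Z))) (at z)"
    by (intro has_derivative_mult_right has_derivative_energy z)
  moreover have "(sqrt has_derivative (*) (inverse (sqrt (2 * c * t z)) / 2)) (at (2 * c * t z))"
    using DERIV_real_sqrt[of "2 * c * t z"] energy_pos[OF z] c_pos by (simp add: has_field_derivative_def)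
  ultimately show ?thesis
    using diff_chain_at[of "\<lambda>z. 2 * c * t z" _ z sqrt] by (fastforce simp: o_def field_simps)
qed

lemma has_derivative_vt:
  assumes z: "z \<in> W"
  shows "((\<lambda>z. vt z) has_derivative (\<lambda>Z. v' (t z) * (u z \<bullet> Dpv z Z))) (at z)"
  using diff_chain_at[OF has_derivative_energy[OF z], of v "(*) (v' (t z))"] v_deriv[OF energy_pos[OF z]]
  by (simp add: has_field_derivative_def o_def)

text \<open>Along a horizontal direction only the first two terms are left: \<open>G\<^sub>i\<^sub>j\<close> is parallel with respect to
  the Levi-Civita connection of the base.\<close>

definition Gl_deriv :: "real^('n + 'n) \<Rightarrow> real^('n + 'n) \<Rightarrow> real^'n \<Rightarrow> real^'n" where
  "Gl_deriv z Z a = (Gl z *v a) v* \<Gamma> z (q_part Z) + Gl z *v (\<Gamma> z (q_part Z) *v a)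
    + (c / s z * (u z \<bullet> Dpv z Z)) *\<^sub>R (gq z *v a)
    + (v' (t z) * (u z \<bullet> Dpv z Z) * (p_part z \<bullet> a)) *\<^sub>R p_part z
    + (vt z * (Dpv z Z \<bullet> a)) *\<^sub>R p_part z + (vt z * (p_part z \<bullet> a)) *\<^sub>R Dpv z Z"

lemma has_derivative_Gl:
  assumes z: "z \<in> W"
  shows "((\<lambda>z. Gl z *v a) has_derivative (\<lambda>Z. Gl_deriv z Z a)) (at z)"
proof -
  have 1: "((\<lambda>z. gq z *v a) has_derivative (\<lambda>Z. (gq z *v a) v* \<Gamma> z (q_part Z) + gq z *v (\<Gamma> z (q_part Z) *v a))) (at z)"
    using has_derivative_mult_vec[OF has_derivative_gq[OF z] has_derivative_const[of a]]
    by (simp add: matrix_vector_mult_add_rdistrib flip: matrix_vector_mul_assoc)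
  have 2: "((\<lambda>z. p_part z \<bullet> a) has_derivative (\<lambda>Z. p_part Z \<bullet> a)) (at z)"
    by (intro has_derivative_inner_left bounded_linear_imp_has_derivative[OF p_part_bounded_linear])
  have 3: "((\<lambda>z. vt z * (p_part z \<bullet> a)) has_derivative
      (\<lambda>Z. vt z * (p_part Z \<bullet> a) + v' (t z) * (u z \<bullet> Dpv z Z) * (p_part z \<bullet> a))) (at z)"
    by (intro has_derivative_mult has_derivative_vt[OF z] 2)
  have "((\<lambda>z. s z *\<^sub>R (gq z *v a) + (vt z * (p_part z \<bullet> a)) *\<^sub>R p_part z) has_derivative
      (\<lambda>Z. (s z *\<^sub>R ((gq z *v a) v* \<Gamma> z (q_part Z) + gq z *v (\<Gamma> z (q_part Z) *v a))
          + (c / s z * (u z \<bullet> Dpv z Z)) *\<^sub>R (gq z *v a))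
        + ((vt z * (p_part z \<bullet> a)) *\<^sub>R p_part Z
          + (vt z * (p_part Z \<bullet> a) + v' (t z) * (u z \<bullet> Dpv z Z) * (p_part z \<bullet> a)) *\<^sub>R p_part z))) (at z)"
    by (intro has_derivative_add has_derivative_scaleR has_derivative_s[OF z] 1 3
        bounded_linear_imp_has_derivative[OF p_part_bounded_linear])
  moreover have "(\<lambda>z. s z *\<^sub>R (gq z *v a) + (vt z * (p_part z \<bullet> a)) *\<^sub>R p_part z) = (\<lambda>z. Gl z *v a)"
    by (simp add: Gl_mult)
  moreover have "(s z *\<^sub>R ((gq z *v a) v* \<Gamma> z (q_part Z) + gq z *v (\<Gamma> z (q_part Z) *v a))
          + (c / s z * (u z \<bullet> Dpv z Z)) *\<^sub>R (gq z *v a))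
        + ((vt z * (p_part z \<bullet> a)) *\<^sub>R p_part Z
          + (vt z * (p_part Z \<bullet> a) + v' (t z) * (u z \<bullet> Dpv z Z) * (p_part z \<bullet> a)) *\<^sub>R p_part z)
        = Gl_deriv z Z a" for Z
  proof -
    have pZ: "p_part Z = Dpv z Z + p_part z v* \<Gamma> z (q_part Z)" by (simp add: Dpv_def K_def)
    have pZa: "p_part Z \<bullet> a = Dpv z Z \<bullet> a + p_part z \<bullet> (\<Gamma> z (q_part Z) *v a)"
      unfolding pZ by (simp add: inner_add_left dot_lmul_matrix)
    show ?thesis
      unfolding Gl_deriv_def pZa unfolding pZ Gl_mult
      by (simp add: vector_matrix_linear scaleR_add_right scaleR_add_left distrib_left)
  qed
  ultimately show ?thesis by simp
qed

lemma has_derivative_Hu_horizontal: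
  assumes z: "z \<in> W" and Z: "Dpv z Z = 0"
  shows "frechet_derivative Hu (at z) Z *v a = - (\<Gamma> z (q_part Z) *v (Hu z *v a)) - Hu z *v (a v* \<Gamma> z (q_part Z))"
proof -
  have d: "Gl differentiable (at z)" "Hu differentiable (at z)"
    using smooth_on_differentiable z smooth_on_Gl smooth_on_Hu by blast+
  have D: "frechet_derivative Gl (at z) Z *v b = Gl_deriv z Z b" for b
    using frechet_derivative_eq[OF has_derivative_mult_vec[OF differentiable_has_derivative[OF d(1)] has_derivative_const[of b]]]
      frechet_derivative_eq[OF has_derivative_Gl[OF z, of b]] by (simp add: fun_eq_iff)
  have "frechet_derivative Hu (at z) Z = frechet_derivative (\<lambda>z. matrix_inv (Gl z)) (at z) Z"
    using frechet_derivative_cong_open[OF open_W z, of Hu "\<lambda>z. matrix_inv (Gl z)"] by (simp add: Hu_inv)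
  also have "\<dots> = - (Hu z ** frechet_derivative Gl (at z) Z ** Hu z)"
    using frechet_derivative_matrix_inv[OF smooth_on_Gl _ z] by (simp add: Gl_invertible Hu_inv z)
  finally have "frechet_derivative Hu (at z) Z *v a = - (Hu z *v Gl_deriv z Z (Hu z *v a))"
    by (simp add: matrix_vector_minus D flip: matrix_vector_mul_assoc)
  then show ?thesis
    by (simp add: Gl_deriv_def Z Gl_Hu[OF z] Hu_Gl[OF z] matrix_vector_right_distrib)
qed

definition K_deriv :: "real^('n + 'n) \<Rightarrow> real^('n + 'n) \<Rightarrow> real^'n \<Rightarrow> real^'n" where
  "K_deriv z Z a = p_part z v* frechet_derivative (\<lambda>y. connection_endo g y a) (at (q_part z)) (q_part Z)
    + p_part Z v* \<Gamma> z a"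

lemma smooth_connection_endo: "smooth_on U (\<lambda>y. connection_endo g y a)"
  unfolding connection_endo_def by (intro smooth_intros smooth_connection open_U)

lemma has_derivative_K:
  assumes z: "z \<in> W"
  shows "((\<lambda>z. K z a) has_derivative (\<lambda>Z. K_deriv z Z a)) (at z)"
  unfolding K_def K_deriv_def
  by (intro has_derivative_vec_mult bounded_linear_imp_has_derivative[OF p_part_bounded_linear]
      has_derivative_base smooth_on_differentiable[OF smooth_connection_endo W_q[OF z]])

lemma K_deriv_vertical:
  "q_part Z = 0 \<Longrightarrow> z \<in> W \<Longrightarrow> K_deriv z Z a = p_part Z v* \<Gamma> z a"
  using linear_0[OF linear_frechet_derivative[OF smooth_on_differentiable[OF smooth_connection_endo W_q]]]
  by (simp add: K_deriv_def bounded_bilinear.zero_right[OF bounded_bilinear_vector_matrix_mult])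

lemma K_deriv_linear:
  assumes z: "z \<in> W"
  shows "linear (\<lambda>Z. K_deriv z Z a)" "linear (K_deriv z Z)"
proof -
  show "linear (\<lambda>Z. K_deriv z Z a)"
    using has_derivative_linear[OF has_derivative_K[OF z]] .
  have d: "(\<lambda>z. K z a) differentiable (at z)" for a
    using has_derivative_K[OF z] by (rule differentiableI)
  have e: "K_deriv z Z a = frechet_derivative (\<lambda>z. K z a) (at z) Z" for a
    by (simp add: frechet_derivative_eq[OF has_derivative_K[OF z]])
  show "linear (K_deriv z Z)"
    by (rule linearI) (simp_all add: e linear_add[OF K_linear] linear_cmul[OF K_linear]
        frechet_derivative_add d frechet_derivative_bounded_linear[OF bounded_linear_scaleR_right])
qed

text \<open>The curvature of the base is the obstruction to the integrability of the horizontal distribution.\<close>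

lemma K_deriv_curvature:
  assumes z: "z \<in> W" and X: "Dpv z X = 0" and Y: "Dpv z Y = 0"
  shows "K_deriv z X (q_part Y) - K_deriv z Y (q_part X)
    = p_part z v* curvature_endo g (q_part z) (q_part X) (q_part Y)"
proof -
  have "p_part X = p_part z v* \<Gamma> z (q_part X)" "p_part Y = p_part z v* \<Gamma> z (q_part Y)"
    using X Y by (simp_all add: Dpv_def K_def)
  then show ?thesis
    by (simp add: K_deriv_def vector_matrix_linear vector_matrix_mul_assoc algebra_simps
        curvature_endo_connection[OF local_metric_axioms W_q[OF z]])
qed

lemma has_derivative_Dpv:
  assumes z: "z \<in> W"
  shows "((\<lambda>z. Dpv z X) has_derivative (\<lambda>Z. - K_deriv z Z (q_part X))) (at z)"
  unfolding Dpv_def using has_derivative_diff[OF has_derivative_const has_derivative_K[OF z]] by simp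

lemma has_derivative_J_parts:
  assumes z: "z \<in> W"
  defines "D \<equiv> frechet_derivative J (at z)"
  shows "q_part (D Z *v X) = - (frechet_derivative Hu (at z) Z *v Dpv z X) + Hu z *v K_deriv z Z (q_part X)"
    and "Dpv z (D Z *v X) = Gl_deriv z Z (q_part X) + K_deriv z Z (q_part (J z *v X))"
proof -
  have dJ: "((\<lambda>z. J z *v X) has_derivative (\<lambda>Z. D Z *v X)) (at z)"
    unfolding D_def by (rule frechet_derivative_mult_vec[OF smooth_on_differentiable[OF smooth_on_J z]])
  have q: "((\<lambda>z. q_part (J z *v X)) has_derivative (\<lambda>Z. q_part (D Z *v X))) (at z)"
    by (rule has_derivative_parts(1)[OF dJ])
  have "((\<lambda>z. - (Hu z *v Dpv z X)) has_derivative
      (\<lambda>Z. - (Hu z *v (- K_deriv z Z (q_part X)) + frechet_derivative Hu (at z) Z *v Dpv z X))) (at z)"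
    by (intro has_derivative_minus has_derivative_mult_vec has_derivative_Dpv z
        differentiable_has_derivative smooth_on_differentiable[OF smooth_on_Hu z])
  from has_derivative_transform_within_open[OF this open_W z, of "\<lambda>z. q_part (J z *v X)"]
  have "((\<lambda>z. q_part (J z *v X)) has_derivative
      (\<lambda>Z. - (Hu z *v (- K_deriv z Z (q_part X)) + frechet_derivative Hu (at z) Z *v Dpv z X))) (at z)"
    by (simp add: q_J)
  from has_derivative_unique[OF q this]
  show "q_part (D Z *v X) = - (frechet_derivative Hu (at z) Z *v Dpv z X) + Hu z *v K_deriv z Z (q_part X)"
    by (simp add: fun_eq_iff matrix_vector_minus)
  have "((\<lambda>z. p_part (J z *v X)) has_derivative (\<lambda>Z. p_part (D Z *v X))) (at z)"
    by (rule has_derivative_parts(2)[OF dJ])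
  moreover have "((\<lambda>z. p_part (J z *v X)) has_derivative (\<lambda>Z. Gl_deriv z Z (q_part X)
      + (p_part z v* (\<Gamma> z (q_part (D Z *v X))) + K_deriv z Z (q_part (J z *v X))))) (at z)"
  proof -
    have "((\<lambda>y. K y (q_part (J y *v X))) has_derivative
        (\<lambda>Z. p_part z v* (\<Gamma> z (q_part (D Z *v X))) + K_deriv z Z (q_part (J z *v X)))) (at z)"
    proof -
      define b where "b a = (axis a 1 :: real^'n)" for a
      have e: "K y x = (\<Sum>a\<in>UNIV. x $ a *\<^sub>R K y (b a))" for y x
      proof -
        have "K y x = K y (\<Sum>a\<in>UNIV. x $ a *\<^sub>R b a)"
          by (simp add: b_def basis_expansion flip: scalar_mult_eq_scaleR)
        then show ?thesis by (simp add: linear_sum[OF K_linear] linear_cmul[OF K_linear])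
      qed
      have e': "K_deriv z Z x = (\<Sum>a\<in>UNIV. x $ a *\<^sub>R K_deriv z Z (b a))" for Z x
      proof -
        have "K_deriv z Z x = K_deriv z Z (\<Sum>a\<in>UNIV. x $ a *\<^sub>R b a)"
          by (simp add: b_def basis_expansion flip: scalar_mult_eq_scaleR)
        then show ?thesis by (simp add: linear_sum[OF K_deriv_linear(2)[OF z]] linear_cmul[OF K_deriv_linear(2)[OF z]])
      qed
      have "((\<lambda>y. \<Sum>a\<in>UNIV. q_part (J y *v X) $ a *\<^sub>R K y (b a)) has_derivative
          (\<lambda>Z. \<Sum>a\<in>UNIV. q_part (J z *v X) $ a *\<^sub>R K_deriv z Z (b a) + q_part (D Z *v X) $ a *\<^sub>R K z (b a))) (at z)"
        by (intro has_derivative_sum has_derivative_scaleR has_derivative_K z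
            bounded_linear.has_derivative[OF bounded_linear_vec_nth q])
      then show ?thesis
        unfolding e[symmetric] sum.distrib e'[symmetric] by (simp add: K_def add.commute)
    qed
    from has_derivative_add[OF has_derivative_Gl[OF z] this]
    show ?thesis
      by (rule has_derivative_transform_within_open[OF _ open_W z]) (simp add: p_J)
  qed
  ultimately have "p_part (D Z *v X) = Gl_deriv z Z (q_part X)
      + (p_part z v* (\<Gamma> z (q_part (D Z *v X))) + K_deriv z Z (q_part (J z *v X)))"
    using has_derivative_unique by (metis (no_types, lifting))
  then show "Dpv z (D Z *v X) = Gl_deriv z Z (q_part X) + K_deriv z Z (q_part (J z *v X))"
    by (simp add: Dpv_def K_def)
qed

lemma frechet_derivative_G:
  assumes z: "z \<in> W"
  shows "X \<bullet> (frechet_derivative G (at z) Z *v Y) =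
    q_part X \<bullet> Gl_deriv z Z (q_part Y) + Dpv z X \<bullet> (frechet_derivative Hu (at z) Z *v Dpv z Y)
    - K_deriv z Z (q_part X) \<bullet> (Hu z *v Dpv z Y) - Dpv z X \<bullet> (Hu z *v K_deriv z Z (q_part Y))"
proof -
  have "((\<lambda>z. X \<bullet> (G z *v Y)) has_derivative (\<lambda>Z. X \<bullet> (frechet_derivative G (at z) Z *v Y))) (at z)"
    by (intro has_derivative_inner_right frechet_derivative_mult_vec smooth_on_differentiable[OF smooth_on_G z])
  moreover have "((\<lambda>z. X \<bullet> (G z *v Y)) has_derivative (\<lambda>Z. q_part X \<bullet> Gl_deriv z Z (q_part Y)
      + (Dpv z X \<bullet> (Hu z *v (- K_deriv z Z (q_part Y)) + frechet_derivative Hu (at z) Z *v Dpv z Y)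
        + (- K_deriv z Z (q_part X)) \<bullet> (Hu z *v Dpv z Y)))) (at z)"
  proof -
    have "((\<lambda>z. q_part X \<bullet> (Gl z *v q_part Y) + Dpv z X \<bullet> (Hu z *v Dpv z Y)) has_derivative
      (\<lambda>Z. q_part X \<bullet> Gl_deriv z Z (q_part Y)
      + (Dpv z X \<bullet> (Hu z *v (- K_deriv z Z (q_part Y)) + frechet_derivative Hu (at z) Z *v Dpv z Y)
        + (- K_deriv z Z (q_part X)) \<bullet> (Hu z *v Dpv z Y)))) (at z)"
      by (intro has_derivative_add has_derivative_inner has_derivative_inner_right has_derivative_mult_vec
          has_derivative_Gl has_derivative_Dpv z
          differentiable_has_derivative smooth_on_differentiable[OF smooth_on_Hu z])
    then show ?thesis
      by (rule has_derivative_transform_within_open[OF _ open_W z]) (simp add: G_inner)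
  qed
  ultimately have "X \<bullet> (frechet_derivative G (at z) Z *v Y) = q_part X \<bullet> Gl_deriv z Z (q_part Y)
      + (Dpv z X \<bullet> (Hu z *v (- K_deriv z Z (q_part Y)) + frechet_derivative Hu (at z) Z *v Dpv z Y)
        + (- K_deriv z Z (q_part X)) \<bullet> (Hu z *v Dpv z Y))"
    using has_derivative_unique by (metis (no_types, lifting))
  then show ?thesis
    by (simp add: matrix_vector_minus inner_add_right inner_diff_right)
qed

end

section \<open>Integrability\<close>

locale constant_curvature_cotangent = cotangent_metric U g c v v'
  for U :: "(real^'n) set" and g c v v' +
  assumes constant_curvature: "\<And>y X Y Z. y \<in> U \<Longrightarrow>
    curvature_endo g y X Y *v Z = c *\<^sub>R ((Y \<bullet> (g y *v Z)) *\<^sub>R X - (X \<bullet> (g y *v Z)) *\<^sub>R Y)"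
begin

lemma momentum_curvature:
  assumes z: "z \<in> W"
  shows "p_part z v* curvature_endo g (q_part z) a b =
    c *\<^sub>R ((p_part z \<bullet> a) *\<^sub>R (gq z *v b) - (p_part z \<bullet> b) *\<^sub>R (gq z *v a))"
proof (rule vector_eq_rdot[THEN iffD1], rule allI)
  fix e
  show "(p_part z v* curvature_endo g (q_part z) a b) \<bullet> e =
      c *\<^sub>R ((p_part z \<bullet> a) *\<^sub>R (gq z *v b) - (p_part z \<bullet> b) *\<^sub>R (gq z *v a)) \<bullet> e"
  proof -
    have "(gq z *v x) \<bullet> e = x \<bullet> (gq z *v e)" for x
      using inner_g_commute[OF W_q[OF z], of e x] by (simp add: inner_commute)
    then show ?thesis
      by (simp add: dot_lmul_matrix constant_curvature[OF W_q[OF z]] inner_diff_right inner_diff_left algebra_simps)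
  qed
qed

lemma J_differentiable: "z \<in> W \<Longrightarrow> J differentiable (at z)"
  by (rule smooth_on_differentiable[OF smooth_on_J])

lemma Gamma_zero [simp]: "\<Gamma> z 0 = 0"
  using linear_0[OF connection_endo_linear] .

lemma vector_matrix_zero [simp]: "x v* (0::real^'l^'m) = 0"
  by (rule bounded_bilinear.zero_right[OF bounded_bilinear_vector_matrix_mult])

lemma Gl_deriv_vertical:
  "q_part Z = 0 \<Longrightarrow> Gl_deriv z Z a = (c / s z * (u z \<bullet> Dpv z Z)) *\<^sub>R (gq z *v a)
    + (v' (t z) * (u z \<bullet> Dpv z Z) * (p_part z \<bullet> a)) *\<^sub>R p_part z
    + (vt z * (Dpv z Z \<bullet> a)) *\<^sub>R p_part z + (vt z * (p_part z \<bullet> a)) *\<^sub>R Dpv z Z"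
  by (simp add: Gl_deriv_def)

lemma Gl_deriv_horizontal:
  "Dpv z Z = 0 \<Longrightarrow> Gl_deriv z Z a = (Gl z *v a) v* \<Gamma> z (q_part Z) + Gl z *v (\<Gamma> z (q_part Z) *v a)"
  by (simp add: Gl_deriv_def)

text \<open>On two horizontal vectors the horizontal part of the Nijenhuis tensor vanishes because \<open>G\<^sub>i\<^sub>j\<close> is
  parallel. In the vertical part the vertical derivatives of \<open>G\<^sub>i\<^sub>j\<close>, which contribute
  \<open>(c / s) (s + 2 t v) - v s = c\<close>, compensate the curvature of the base; this is where
  \<open>s\<^sup>2 = 2 c t\<close> and the constancy of the curvature enter.\<close>

lemma nijenhuis_horizontal:
  assumes z: "z \<in> W" and X: "Dpv z X = 0" and Y: "Dpv z Y = 0"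
  shows "nijenhuis J (\<lambda>_. X) (\<lambda>_. Y) z = 0"
proof -
  let ?D = "frechet_derivative J (at z)" and ?a = "q_part X" and ?b = "q_part Y" and ?p = "p_part z"
  have qJ: "q_part (J z *v X) = 0" "q_part (J z *v Y) = 0" by (simp_all add: q_J[OF z] X Y)
  have DJ: "Dpv z (J z *v X) = Gl z *v ?a" "Dpv z (J z *v Y) = Gl z *v ?b" by (simp_all add: Dpv_J[OF z])
  have pJ: "p_part (J z *v X) = Gl z *v ?a" "p_part (J z *v Y) = Gl z *v ?b"
    using DJ by (simp_all add: Dpv_def qJ linear_0[OF K_linear])
  have K0: "K_deriv z Z 0 = 0" for Z by (rule linear_0[OF K_deriv_linear(2)[OF z]])
  note parts = has_derivative_J_parts[OF z]
  let ?N = "?D (J z *v X) *v Y - ?D (J z *v Y) *v X + J z *v (?D Y *v X) - J z *v (?D X *v Y)"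
  have "q_part ?N = 0"
    using connection_endo_commute[OF W_q[OF z], of ?a ?b]
    by (simp add: parts X Y qJ q_J[OF z] K0 K_deriv_vertical[OF qJ(1) z] K_deriv_vertical[OF qJ(2) z] pJ
        Gl_deriv_horizontal matrix_vector_right_distrib Hu_Gl[OF z])
  moreover have "Dpv z ?N = 0"
  proof -
    have "Dpv z ?N = Gl_deriv z (J z *v X) ?b - Gl_deriv z (J z *v Y) ?a + (K_deriv z Y ?a - K_deriv z X ?b)"
      by (simp add: linear_diff[OF Dpv_linear] linear_add[OF Dpv_linear] Dpv_J[OF z] parts X Y qJ K0 Gl_Hu[OF z])
    also have "K_deriv z Y ?a - K_deriv z X ?b = - (?p v* curvature_endo g (q_part z) ?a ?b)"
      using K_deriv_curvature[OF z X Y] by (simp add: algebra_simps)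
    also have "\<dots> = - (c *\<^sub>R ((?p \<bullet> ?a) *\<^sub>R (gq z *v ?b) - (?p \<bullet> ?b) *\<^sub>R (gq z *v ?a)))"
      by (simp add: momentum_curvature[OF z])
    also have "Gl_deriv z (J z *v X) ?b - Gl_deriv z (J z *v Y) ?a =
        c *\<^sub>R ((?p \<bullet> ?a) *\<^sub>R (gq z *v ?b) - (?p \<bullet> ?b) *\<^sub>R (gq z *v ?a))"
    proof -
      have u: "u z \<bullet> (Gl z *v e) = (s z + 2 * t z * vt z) * (?p \<bullet> e)" for e
        by (subst Gl_inner_commute[OF z]) (simp add: Gl_u[OF z] inner_commute)
      have ab: "(Gl z *v ?a) \<bullet> ?b = (Gl z *v ?b) \<bullet> ?a"
        using Gl_inner_commute[OF z, of ?a ?b] by (simp add: inner_commute)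
      have k: "c / s z * (s z + 2 * t z * vt z) = c + vt z * s z"
      proof -
        have "c / s z * (s z + 2 * t z * vt z) = s z * (c + s z * vt z) / s z"
          by (simp only: times_divide_eq_left factor_eq[OF z])
        also have "\<dots> = c + s z * vt z"
          by (rule nonzero_mult_div_cancel_left[OF less_imp_neq[OF s_pos[OF z], THEN not_sym]])
        finally show ?thesis by (simp only: mult.commute)
      qed
      let ?k = "c / s z * (s z + 2 * t z * vt z)"
      have "Gl_deriv z (J z *v X) ?b - Gl_deriv z (J z *v Y) ?a =
          (?k * (?p \<bullet> ?a)) *\<^sub>R (gq z *v ?b) - (?k * (?p \<bullet> ?b)) *\<^sub>R (gq z *v ?a)
          + (vt z * (?p \<bullet> ?b)) *\<^sub>R (Gl z *v ?a) - (vt z * (?p \<bullet> ?a)) *\<^sub>R (Gl z *v ?b)"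
        unfolding Gl_deriv_vertical[OF qJ(1)] Gl_deriv_vertical[OF qJ(2)] DJ u ab
        by (simp only: mult_ac) (simp add: algebra_simps)
      then show ?thesis
        unfolding k Gl_mult by (simp only: scaleR_add_right scaleR_scaleR) (simp add: algebra_simps)
    qed
    finally show ?thesis by simp
  qed
  ultimately have "?N = 0"
    by (intro parts_eqI[of _ 0 z]) (simp_all add: linear_0[OF Dpv_linear])
  then show ?thesis by (simp add: nijenhuis_constant_fields[OF J_differentiable[OF z]])
qed

text \<open>Since \<open>N(JX, Y) = - J N(X, Y)\<close> and \<open>J\<close> maps the horizontal onto the vertical space, horizontal
  vectors suffice.\<close>

lemma nijenhuis_zero:
  assumes z: "z \<in> W"
  shows "nijenhuis J (\<lambda>_. X) (\<lambda>_. Y) z = 0"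
proof -
  let ?N = "\<lambda>X Y. nijenhuis J (\<lambda>_. X) (\<lambda>_. Y) z"
  define D where "D = frechet_derivative J (at z)"
  note N = nijenhuis_constant_fields[OF J_differentiable[OF z], folded D_def]
  interpret D: linear D
    unfolding D_def using J_differentiable[OF z] by (rule linear_frechet_derivative)
  have anti: "D Z *v (J z *v X) = - (J z *v (D Z *v X))" for Z X
  proof -
    have "frechet_derivative (\<lambda>z. J z ** J z) (at z) Z = 0"
      using frechet_derivative_cong_open[OF open_W z, of "\<lambda>z. J z ** J z" "\<lambda>_. - mat 1"]
      by (simp add: J_square)
    then have "(D Z ** J z + J z ** D Z) *v X = 0"
      by (simp add: frechet_derivative_bilinear[OF bounded_bilinear_matrix_mult] J_differentiable z D_def)
    then show ?thesis
      by (simp add: matrix_vector_mult_add_rdistrib eq_neg_iff_add_eq_0 flip: matrix_vector_mul_assoc)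
  qed
  have skew: "?N X Y = - ?N Y X" for X Y by (simp add: N algebra_simps)
  have add: "?N (X + X') Y = ?N X Y + ?N X' Y" for X X' Y
    by (simp add: N D.add matrix_vector_right_distrib matrix_vector_mult_add_rdistrib algebra_simps)
  have left: "?N (J z *v X) Y = - (J z *v ?N X Y)" for X Y
    by (simp add: N anti J_J[OF z] D.neg matrix_vector_minus matrix_vector_right_distrib
        matrix_vector_mult_diff_distrib)
  define hor where "hor X = bundle_vec (q_part X) (K z (q_part X))" for X
  define ver where "ver X = bundle_vec (Hu z *v Dpv z X) (K z (Hu z *v Dpv z X))" for X
  have h: "Dpv z (hor X) = 0" "Dpv z (ver X) = 0" for X by (simp_all add: Dpv_def hor_def ver_def)
  have dec: "X = hor X + J z *v ver X" for X
    by (rule parts_eqI[of _ _ z], simp_all add: linear_add[OF Dpv_linear] h q_J[OF z] Dpv_J[OF z])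
      (simp_all add: hor_def ver_def Gl_Hu[OF z])
  have 1: "?N X Y = 0" if "Dpv z Y = 0" for X Y
    by (subst dec[of X]) (simp add: add left nijenhuis_horizontal[OF z _ that] h)
  have "?N Y X = 0"
    by (subst dec[of Y]) (simp add: add left skew[of "hor Y"] skew[of "ver Y"] 1 h)
  then show ?thesis using skew[of X Y] by simp
qed

lemma local_kaehler: "local_kaehler W G J"
proof
  show "smooth_on W G" "smooth_on W J" by (rule smooth_on_G, rule smooth_on_J)
qed (simp_all add: G_symmetric G_positive J_square G_hermitian fundamental_form_closed nijenhuis_zero)

section \<open>The Ricci tensor\<close>

text \<open>The projection onto the vertical space along the horizontal one.\<close>

definition V :: "real^('n + 'n) \<Rightarrow> real^('n + 'n)^('n + 'n)" where
  "V z = (\<chi> a b. case a of Inl _ \<Rightarrow> 0 | Inr i \<Rightarrow> Dpv z (axis b 1) $ i)"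

lemma V_mult: "V z *v X = bundle_vec 0 (Dpv z X)"
proof -
  have "Dpv z X = Dpv z (\<Sum>b\<in>UNIV. X $ b *\<^sub>R axis b 1)"
    by (simp add: basis_expansion flip: scalar_mult_eq_scaleR)
  then have "Dpv z X = (\<Sum>b\<in>UNIV. X $ b *\<^sub>R Dpv z (axis b 1))"
    by (simp add: linear_sum[OF Dpv_linear] linear_cmul[OF Dpv_linear])
  then show ?thesis
    by (auto simp: V_def bundle_vec_def matrix_vector_mult_def vec_eq_iff mult.commute split: sum.split)
qed

lemma Dpv_vertical: "q_part X = 0 \<Longrightarrow> Dpv z X = p_part X"
  by (simp add: Dpv_def linear_0[OF K_linear])

lemma V_vertical: "q_part X = 0 \<Longrightarrow> V z *v X = X"
  by (rule bundle_vec_eqI) (simp_all add: V_mult Dpv_vertical)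

lemma smooth_on_V: "smooth_on W V"
proof -
  have "smooth_on W (\<lambda>z. Dpv z X)" for X
    unfolding Dpv_def K_def
    by (intro smooth_intros smooth_on_part smooth_on_base[OF smooth_connection_endo] open_W)
  then have "smooth_on W (\<lambda>z. case a of Inl _ \<Rightarrow> 0 | Inr i \<Rightarrow> Dpv z (axis b 1) $ i)" for a :: "'n + 'n" and b
    by (cases a) (auto intro!: smooth_intros open_W)
  then show ?thesis
    unfolding V_def[abs_def] by (intro smooth_intros)
qed

lemma V_properties:
  assumes z: "z \<in> W"
  shows "V z ** V z = V z" "V z ** partial_deriv a V z = partial_deriv a V z" "J z ** V z + V z ** J z = J z"
proof -
  show "V z ** V z = V z"
    by (simp add: matrix_eq V_mult Dpv_vertical flip: matrix_vector_mul_assoc)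
  have "q_part (partial_deriv a V z *v X) = 0" for X
  proof -
    have d: "V differentiable (at z)" by (rule smooth_on_differentiable[OF smooth_on_V z])
    have "((\<lambda>z. q_part (V z *v X)) has_derivative (\<lambda>Z. q_part (frechet_derivative V (at z) Z *v X))) (at z)"
      by (rule has_derivative_parts(1)[OF frechet_derivative_mult_vec[OF d]])
    moreover have "((\<lambda>z. q_part (V z *v X)) has_derivative (\<lambda>Z. 0)) (at z)" by (simp add: V_mult)
    ultimately have "(\<lambda>Z. q_part (frechet_derivative V (at z) Z *v X)) = (\<lambda>Z. 0)"
      by (rule has_derivative_unique)
    then show ?thesis by (simp add: partial_deriv_def fun_eq_iff)
  qed
  then show "V z ** partial_deriv a V z = partial_deriv a V z"
    by (simp add: matrix_eq V_vertical flip: matrix_vector_mul_assoc)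
  show "J z ** V z + V z ** J z = J z"
    unfolding matrix_eq
  proof
    fix X
    show "(J z ** V z + V z ** J z) *v X = J z *v X"
      by (rule parts_eqI[of _ _ z])
        (simp_all add: matrix_vector_mult_add_rdistrib V_mult q_J[OF z] Dpv_J[OF z] linear_add[OF Dpv_linear]
          Dpv_vertical flip: matrix_vector_mul_assoc)
  qed
qed

lemma trace_V_J:
  assumes z: "z \<in> W"
  shows "trace (V z ** J z ** M) = (\<Sum>k\<in>UNIV. axis k 1 \<bullet> (Gl z *v q_part (M *v axis (Inr k) 1)))"
proof -
  have "(V z ** J z ** M) $ a $ a = (V z *v (J z *v (M *v axis a 1))) $ a" for a
    using inner_axis_matrix[of a "V z ** J z ** M" a]
    by (simp add: inner_axis' flip: matrix_vector_mul_assoc)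
  then show ?thesis
    by (simp add: trace_def sum_UNIV_sum V_mult bundle_vec_def inner_axis' Dpv_J[OF z])
qed

lemma sum_axis_inner: "(\<Sum>k\<in>UNIV. (x \<bullet> axis k 1) * (axis k 1 \<bullet> y)) = x \<bullet> (y :: real^'l)"
  by (simp add: inner_axis inner_axis') (simp add: inner_vec_def)

lemma Hu_p:
  assumes z: "z \<in> W"
  shows "(s z + 2 * t z * vt z) *\<^sub>R (Hu z *v p_part z) = u z"
  using Hu_Gl[OF z, of "u z"] unfolding Gl_u[OF z] by (simp add: matrix_vector_mult_scaleR)

text \<open>For constant curvature the contraction only involves \<open>H p = u / (s + 2 t v)\<close> and the trace of
  \<open>g H\<close>. The dependence on \<open>v\<close> cancels, since \<open>1 / (s + 2 t v) + v / (c + s v) = 1 / s\<close>.\<close>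

lemma curvature_contraction:
  assumes z: "z \<in> W"
  shows "(\<Sum>k\<in>UNIV. (p_part z v* curvature_endo g (q_part z) (axis k 1) a) \<bullet> (Hu z *v axis k 1))
    = c * (1 - real CARD('n)) / s z * (p_part z \<bullet> a)"
proof -
  let ?p = "p_part z" and ?e = "\<lambda>k. axis k (1::real)" and ?x = "s z + 2 * t z * vt z" and ?y = "c + s z * vt z"
  have pos: "s z > 0" "?y > 0" "t z > 0"
    using s_pos[OF z] denominator_pos[OF z] energy_pos[OF z] by simp_all
  have x: "?x > 0"
    using factor_eq[OF z] pos c_pos by (metis mult_pos_pos zero_less_mult_pos)
  have ex: "(?p v* curvature_endo g (q_part z) (?e k) a) \<bullet> (Hu z *v ?e k) =
      c * ((?p \<bullet> ?e k) * (?e k \<bullet> (Hu z *v (gq z *v a)))) - c * (?p \<bullet> a) * ((gq z *v ?e k) \<bullet> (Hu z *v ?e k))" for k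
    using Hu_inner_commute[OF z, of "gq z *v a" "?e k"]
    by (simp add: momentum_curvature[OF z] inner_diff_left algebra_simps)
  have 1: "?p \<bullet> (Hu z *v (gq z *v a)) = (?p \<bullet> a) / ?x"
  proof -
    have "?x * (?p \<bullet> (Hu z *v (gq z *v a))) = (gq z *v a) \<bullet> (?x *\<^sub>R (Hu z *v ?p))"
      using Hu_inner_commute[OF z, of ?p "gq z *v a"] by simp
    also have "\<dots> = ?p \<bullet> a"
      unfolding Hu_p[OF z] using inner_g_commute[OF W_q[OF z], of "u z" a] P_inverse(1)[OF z, of ?p]
      by (simp add: inner_commute)
    finally show ?thesis using x by (simp add: eq_divide_eq mult.commute)
  qed
  have 2: "(\<Sum>k\<in>UNIV. (gq z *v ?e k) \<bullet> (Hu z *v ?e k)) = real CARD('n) / s z - vt z / ?y"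
  proof -
    let ?d = "2 * t z * ?y"
    have e: "(gq z *v ?e k) \<bullet> (Hu z *v ?e k) = 1 / s z - vt z / ?d * ((u z \<bullet> ?e k) * (?e k \<bullet> ?p))" for k
    proof -
      have a: "(gq z *v ?e k) \<bullet> (P z *v ?e k) = 1"
        using P_inner_commute[OF z, of "gq z *v ?e k" "?e k"] by (simp add: P_inverse[OF z] inner_axis_axis)
      have b: "(gq z *v ?e k) \<bullet> u z = ?e k \<bullet> ?p"
        using P_inner_commute[OF z, of "gq z *v ?e k" ?p] by (simp add: P_inverse[OF z] inner_commute)
      show ?thesis unfolding Hu_mult[OF z] by (simp add: inner_diff_right a b)
    qed
    have "(\<Sum>k\<in>UNIV. (gq z *v ?e k) \<bullet> (Hu z *v ?e k)) = real CARD('n) * (1 / s z) - vt z / ?d * (u z \<bullet> ?p)"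
      by (simp only: e sum_subtractf sum_distrib_left[symmetric] sum_axis_inner sum_constant)
    also have "u z \<bullet> ?p = 2 * t z" using p_u[of z] by (simp add: inner_commute)
    finally show ?thesis using pos(3) by simp
  qed
  have "(\<Sum>k\<in>UNIV. (?p v* curvature_endo g (q_part z) (?e k) a) \<bullet> (Hu z *v ?e k)) =
      c * (?p \<bullet> (Hu z *v (gq z *v a))) - c * (?p \<bullet> a) * (\<Sum>k\<in>UNIV. (gq z *v ?e k) \<bullet> (Hu z *v ?e k))"
    unfolding ex sum_subtractf sum_distrib_left[symmetric] sum_axis_inner ..
  also have "\<dots> = c * (?p \<bullet> a) * (1 / ?x + vt z / ?y - real CARD('n) / s z)"
    unfolding 1 2 by (simp add: algebra_simps)
  also have "1 / ?x + vt z / ?y = 1 / s z"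
  proof -
    have "1 / ?x = c / (s z * ?y)"
      unfolding factor_eq[OF z, symmetric] using x c_pos by simp
    moreover have "vt z / ?y = s z * vt z / (s z * ?y)"
      by (rule mult_divide_mult_cancel_left[symmetric, OF less_imp_neq[OF pos(1), THEN not_sym]])
    ultimately have "1 / ?x + vt z / ?y = ?y / (s z * ?y)" by (simp only: add_divide_distrib)
    then show ?thesis using pos(2) by simp
  qed
  also have "c * (?p \<bullet> a) * (1 / s z - real CARD('n) / s z) = c * (1 - real CARD('n)) / s z * (?p \<bullet> a)"
    by (simp add: diff_divide_distrib algebra_simps)
  finally show ?thesis .
qed

lemma vertical_divergence:
  assumes z: "z \<in> W"
  shows "(\<Sum>k\<in>UNIV. axis k 1 \<bullet> Gl_deriv z (axis (Inr k) 1) a)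
    = (c / s z + 2 * t z * v' (t z) + (real CARD('n) + 1) * vt z) * (p_part z \<bullet> a)"
proof -
  let ?p = "p_part z" and ?e = "\<lambda>k. axis k (1::real)"
  have e: "?e k \<bullet> Gl_deriv z (axis (Inr k) 1) a = c / s z * ((u z \<bullet> ?e k) * (?e k \<bullet> (gq z *v a)))
      + v' (t z) * (?p \<bullet> a) * ((u z \<bullet> ?e k) * (?e k \<bullet> ?p))
      + vt z * ((a \<bullet> ?e k) * (?e k \<bullet> ?p)) + vt z * (?p \<bullet> a)" for k
    by (simp add: Gl_deriv_vertical Dpv_vertical inner_add_right inner_axis_axis inner_commute[of a] algebra_simps)
  have "(\<Sum>k\<in>UNIV. ?e k \<bullet> Gl_deriv z (axis (Inr k) 1) a) = c / s z * (u z \<bullet> (gq z *v a))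
      + v' (t z) * (?p \<bullet> a) * (u z \<bullet> ?p) + vt z * (a \<bullet> ?p) + vt z * (real CARD('n) * (?p \<bullet> a))"
    by (simp only: e sum.distrib sum_distrib_left[symmetric] sum_axis_inner sum_constant)
  moreover have "u z \<bullet> (gq z *v a) = ?p \<bullet> a"
    using inner_g_commute[OF W_q[OF z], of "u z" a] P_inverse(1)[OF z, of ?p] by (simp add: inner_commute)
  moreover have "u z \<bullet> ?p = 2 * t z" using p_u[of z] by (simp add: inner_commute)
  ultimately show ?thesis by (simp add: inner_commute[of a] algebra_simps)
qed

text \<open>The Koszul formula expresses the trace in first derivatives of the metric. Since \<open>H\<close> is parallel along
  horizontal directions, its derivatives cancel against the vertical derivatives of \<open>\<Gamma>\<^sup>0\<close>. What remains
  are the curvature of the base and the vertical divergence of \<open>G\<^sub>i\<^sub>j\<close>, both multiples of \<open>p\<^sub>i\<close>.\<close>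

lemma ricci_potential:
  assumes z: "z \<in> W"
  shows "2 * trace (V z ** J z ** connection_endo G z X) =
    (c * (2 - real CARD('n)) / s z + 2 * t z * v' (t z) + (real CARD('n) + 1) * vt z) * (p_part z \<bullet> q_part X)"
proof -
  interpret K: local_kaehler W G J by (rule local_kaehler)
  let ?C = "connection_endo G z" and ?a = "q_part X" and ?w = "Dpv z X" and ?e = "\<lambda>k. axis k (1::real)"
  let ?R = "\<lambda>k. p_part z v* curvature_endo g (q_part z) (?e k) ?a"
  define h where "h a = bundle_vec a (K z a)" for a
  have h: "q_part (h a) = a" "Dpv z (h a) = 0" for a by (simp_all add: h_def Dpv_def)
  have K0: "K_deriv z Z 0 = 0" for Z by (rule linear_0[OF K_deriv_linear(2)[OF z]])
  have Gl0: "Gl_deriv z Z 0 = 0" for Z by (simp add: Gl_deriv_def)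
  have X: "X = h ?a + bundle_vec 0 ?w"
    by (rule parts_eqI[of _ _ z]) (simp_all add: h linear_add[OF Dpv_linear] Dpv_vertical)
  have summand: "2 * (?e k \<bullet> (Gl z *v q_part (?C X *v axis (Inr k) 1))) =
      ?R k \<bullet> (Hu z *v ?e k) + ?e k \<bullet> Gl_deriv z (axis (Inr k) 1) ?a" for k
  proof -
    let ?Y = "axis (Inr k) 1 :: real^('n + 'n)" and ?H = "h (?e k)"
    let ?D = "frechet_derivative G (at z)"
    have Y: "q_part ?Y = 0" "Dpv z ?Y = ?e k" "p_part ?Y = ?e k" by (simp_all add: Dpv_vertical)
    have "2 * (?e k \<bullet> (Gl z *v q_part (?C X *v ?Y))) = 2 * (?H \<bullet> (G z *v (?C X *v ?Y)))"
      by (simp add: G_inner[OF z] h)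
    also have "\<dots> = ?H \<bullet> (?D X *v ?Y) + ?H \<bullet> (?D ?Y *v X) - X \<bullet> (?D ?H *v ?Y)"
      by (rule K.koszul[OF z])
    also have "?H \<bullet> (?D X *v ?Y) = - (K_deriv z X (?e k) \<bullet> (Hu z *v ?e k))"
      unfolding frechet_derivative_G[OF z] by (simp add: h Y Gl0 del: q_part_axis)
    also have "K_deriv z X (?e k) = K_deriv z (h ?a) (?e k) + ?w v* \<Gamma> z (?e k)"
      by (subst X) (simp add: linear_add[OF K_deriv_linear(1)[OF z]] K_deriv_vertical[OF _ z])
    also have "?H \<bullet> (?D ?Y *v X) = ?e k \<bullet> Gl_deriv z ?Y ?a - (?e k v* \<Gamma> z (?e k)) \<bullet> (Hu z *v ?w)"
      unfolding frechet_derivative_G[OF z] by (simp add: h Y K_deriv_vertical[OF Y(1) z] del: q_part_axis p_part_axis)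
    also have "X \<bullet> (?D ?H *v ?Y) = ?w \<bullet> (- (\<Gamma> z (?e k) *v (Hu z *v ?e k)) - Hu z *v (?e k v* \<Gamma> z (?e k)))
        - K_deriv z ?H ?a \<bullet> (Hu z *v ?e k)"
      unfolding frechet_derivative_G[OF z]
      by (simp add: Y K0 Gl0 has_derivative_Hu_horizontal[OF z h(2)] h(1) del: q_part_axis)
    finally have "2 * (?e k \<bullet> (Gl z *v q_part (?C X *v ?Y))) =
        (K_deriv z ?H ?a - K_deriv z (h ?a) (?e k)) \<bullet> (Hu z *v ?e k) + ?e k \<bullet> Gl_deriv z ?Y ?a"
      using Hu_inner_commute[OF z, of ?w "?e k v* \<Gamma> z (?e k)"]
      by (simp add: inner_add_left inner_diff_left inner_diff_right dot_lmul_matrix)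
    also have "K_deriv z ?H ?a - K_deriv z (h ?a) (?e k) = ?R k"
      using K_deriv_curvature[OF z h(2)[of "?e k"] h(2)[of ?a]] by (simp only: h(1))
    finally show ?thesis .
  qed
  have "2 * trace (V z ** J z ** ?C X) = (\<Sum>k\<in>UNIV. 2 * (?e k \<bullet> (Gl z *v q_part (?C X *v axis (Inr k) 1))))"
    by (simp add: trace_V_J[OF z] sum_distrib_left)
  also have "\<dots> = c * (1 - real CARD('n)) / s z * (p_part z \<bullet> ?a)
      + (c / s z + 2 * t z * v' (t z) + (real CARD('n) + 1) * vt z) * (p_part z \<bullet> ?a)"
    unfolding summand sum.distrib curvature_contraction[OF z] vertical_divergence[OF z] ..
  also have "\<dots> = (c * (1 - real CARD('n)) / s z + c / s z + 2 * t z * v' (t z) + (real CARD('n) + 1) * vt z) * (p_part z \<bullet> ?a)"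
    by (simp only: distrib_right add.assoc)
  also have "c * (1 - real CARD('n)) / s z + c / s z = c * (2 - real CARD('n)) / s z"
    by (simp only: add_divide_distrib[symmetric]) (simp add: algebra_simps)
  finally show ?thesis .
qed

text \<open>If the coefficient in the potential is a constant \<open>2 \<kappa>\<close>, the Ricci form is \<open>\<kappa>\<close> times the exterior
  derivative of the canonical form \<open>p\<^sub>i dq\<^sup>i\<close>, that is, a multiple of the fundamental form.\<close>

lemma ricci_eq_metric:
  assumes z: "z \<in> W"
    and ode: "\<And>t. t > 0 \<Longrightarrow>
      c * (2 - real CARD('n)) / sqrt (2 * c * t) + 2 * t * v' t + (real CARD('n) + 1) * v t = 2 * \<kappa>"
  shows "ricci G z = (- \<kappa>) *\<^sub>R G z"
proof -
  interpret K: local_kaehler W G J by (rule local_kaehler)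
  let ?l = "\<lambda>a z. \<kappa> * (p_part z \<bullet> q_part (axis a 1))"
  let ?b = "\<lambda>a z. trace (V z ** J z ** connection_matrix G a z)"
  have b: "?b a y = ?l a y" if y: "y \<in> W" for a y
  proof -
    show ?thesis
      using ricci_potential[OF y, of "axis a 1"] unfolding ode[OF energy_pos[OF y]] connection_endo_axis by simp
  qed
  have db: "partial_deriv a (?b b) z = \<kappa> * (p_part (axis a 1) \<bullet> q_part (axis b 1))" for a b
  proof -
    have "partial_deriv a (?b b) z = partial_deriv a (?l b) z"
      by (rule partial_deriv_cong_open[OF open_W z]) (rule b)
    also have "\<dots> = \<kappa> * (p_part (axis a 1) \<bullet> q_part (axis b 1))"
      by (rule partial_deriv_eq)
        (intro has_derivative_mult_right has_derivative_inner_left bounded_linear_imp_has_derivative[OF p_part_bounded_linear])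
    finally show ?thesis .
  qed
  have trace: "trace (J z ** curvature_endo G z X Y) = 2 * \<kappa> * (p_part X \<bullet> q_part Y - p_part Y \<bullet> q_part X)" for X Y
  proof -
    let ?B = "\<lambda>X Y. 2 * \<kappa> * (p_part X \<bullet> q_part Y - p_part Y \<bullet> q_part X)"
    have "trace (J z ** curvature_endo G z X Y) =
        (\<Sum>a\<in>UNIV. \<Sum>b\<in>UNIV. X $ a * Y $ b * trace (J z ** curvature_matrix G a b z))"
      by (simp add: curvature_endo_def matrix_sum_expand linear_sum[OF bounded_linear.linear[OF bounded_linear_trace]]
          linear_cmul[OF bounded_linear.linear[OF bounded_linear_trace]])
    also have "\<dots> = (\<Sum>a\<in>UNIV. \<Sum>b\<in>UNIV. X $ a * Y $ b * ?B (axis a 1) (axis b 1))"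
    proof -
      have "trace (J z ** curvature_matrix G a b z) = ?B (axis a 1) (axis b 1)" for a b
        using K.trace_J_curvature[OF z smooth_on_V V_properties, of a b] unfolding db by (simp add: algebra_simps)
      then show ?thesis by simp
    qed
    also have "\<dots> = X \<bullet> ((\<chi> a b. ?B (axis a 1) (axis b 1)) *v Y)"
      by (simp add: inner_vec_def matrix_vector_mult_def sum_distrib_left algebra_simps)
    also have "\<dots> = ?B X Y"
      by (rule matrix_of_bilinear)
        (auto simp: bilinear_def inner_add_left inner_add_right algebra_simps intro!: linearI)
    finally show ?thesis .
  qed
  show ?thesis
  proof (rule matrix_eq_inner)
    fix X Y
    have "2 * (X \<bullet> (ricci G z *v Y)) = 2 * \<kappa> * (X \<bullet> (fundamental_form G J z *v (J z *v Y)))"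
      unfolding K.ricci_trace[OF z] trace fundamental_form_canonical[OF z] by (simp add: inner_commute)
    also have "X \<bullet> (fundamental_form G J z *v (J z *v Y)) = - (X \<bullet> (G z *v Y))"
      by (simp add: fundamental_form_def J_J[OF z] matrix_vector_minus flip: matrix_vector_mul_assoc)
    finally show "X \<bullet> (ricci G z *v Y) = X \<bullet> ((- \<kappa>) *\<^sub>R G z *v Y)"
      by (simp add: matrix_vector_minus flip: scaleR_matrix_vector_assoc)
  qed
qed

end

section \<open>Change of charts\<close>

text \<open>The situation of two charts of the base: \<open>D\<close> is the image of their overlap in the first chart and
  \<open>T\<close> the transition map, under which the components \<open>g\<close> and \<open>g'\<close> of the metric correspond.\<close>

locale isometric_change = L1: local_metric U g + L2: local_metric U' g'
  for U U' :: "(real^'n) set" and g g' :: "real^'n \<Rightarrow> real^'n^'n" +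
  fixes D :: "(real^'n) set" and T :: "real^'n \<Rightarrow> real^'n"
  assumes T_smooth: "smooth_on D T"
    and D_subset: "D \<subseteq> U"
    and T_image: "T ` D \<subseteq> U'"
    and T_invertible: "\<And>y. y \<in> D \<Longrightarrow> invertible (matrix (frechet_derivative T (at y)))"
    and T_isometric: "\<And>y. y \<in> D \<Longrightarrow> g y = transpose (matrix (frechet_derivative T (at y))) ** g' (T y)
      ** matrix (frechet_derivative T (at y))"
begin

definition A :: "real^'n \<Rightarrow> real^'n^'n" where "A y = matrix (frechet_derivative T (at y))"

lemma open_D: "open D" using T_smooth by (rule smooth_on_open)

lemma T_differentiable: "y \<in> D \<Longrightarrow> T differentiable (at y)"
  by (rule smooth_on_differentiable[OF T_smooth])

lemma A_mult: "y \<in> D \<Longrightarrow> A y *v X = frechet_derivative T (at y) X"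
  unfolding A_def by (rule fun_cong[OF matrix_vector_mul(2)[OF linear_frechet_derivative[OF T_differentiable]]])

lemma A_column: "A y = (\<chi> a b. partial_deriv b T y $ a)"
  by (simp add: A_def matrix_def partial_deriv_def)

lemma smooth_on_A: "smooth_on D A"
  unfolding A_column[abs_def] by (intro smooth_intros T_smooth)

lemma A_differentiable: "y \<in> D \<Longrightarrow> A differentiable (at y)"
  by (rule smooth_on_differentiable[OF smooth_on_A])

lemma A_cancel: "y \<in> D \<Longrightarrow> x v* A y = x' v* A y \<Longrightarrow> x = x'"
  using matrix_inv_inverse(1)[OF T_invertible, folded A_def, of y]
  by (metis vector_matrix_mul_assoc vector_matrix_mul_rid)

lemma A_surj: "y \<in> D \<Longrightarrow> \<exists>x. A y *v x = w"
  using matrix_inv_inverse(1)[OF T_invertible, folded A_def, of y]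
  by (metis matrix_vector_mul_assoc matrix_vector_mul_lid)

lemma metric_A: "y \<in> D \<Longrightarrow> X \<bullet> (g y *v Y) = (A y *v X) \<bullet> (g' (T y) *v (A y *v Y))"
  using T_isometric[folded A_def, of y]
  by (simp add: inner_matrix_transpose[of X "transpose (A y)"] del: transpose_matrix_vector
      flip: matrix_vector_mul_assoc)

lemma A_derivative_sym:
  assumes y: "y \<in> D"
  shows "frechet_derivative A (at y) X *v Y = frechet_derivative A (at y) Y *v X"
proof -
  have d: "partial_deriv a A y $ l $ b = partial_deriv a (partial_deriv b T) y $ l" for a b l
  proof -
    have "partial_deriv a A y $ l $ b = partial_deriv a (\<lambda>y. A y $ l $ b) y"
      using A_differentiable[OF y] by (simp add: partial_deriv_vec_nth differentiable_vec_nth)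
    also have "\<dots> = partial_deriv a (partial_deriv b T) y $ l"
      unfolding A_column using smooth_on_differentiable[OF smooth_on_partial_deriv[OF T_smooth] y]
      by (simp add: partial_deriv_vec_nth)
    finally show ?thesis .
  qed
  have e: "(frechet_derivative A (at y) X *v Y) $ l =
      (\<Sum>a\<in>UNIV. \<Sum>b\<in>UNIV. X $ a * Y $ b * partial_deriv a (partial_deriv b T) y $ l)" for X Y l
    by (simp add: frechet_derivative_partials[OF A_differentiable[OF y]] matrix_vector_mult_def d
        sum_distrib_left sum_distrib_right) (subst sum.swap, simp add: mult_ac)
  show ?thesis
    unfolding vec_eq_iff e
    by (rule allI, rule trans[OF sum.swap], intro sum.cong refl,
        subst partial_deriv_commute[OF T_smooth y], simp only: mult_ac)
qed

lemma has_derivative_compose_T: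
  fixes f :: "real^'n \<Rightarrow> 'b::real_normed_vector"
  assumes y: "y \<in> D" and f: "f differentiable (at (T y))"
  shows "((\<lambda>y. f (T y)) has_derivative (\<lambda>X. frechet_derivative f (at (T y)) (A y *v X))) (at y)"
  using diff_chain_at[OF differentiable_has_derivative[OF T_differentiable[OF y]]
      differentiable_has_derivative[OF f]] by (simp add: o_def A_mult[OF y])

text \<open>Differentiating the isometry relation brings in the second derivatives of \<open>T\<close>. As they are symmetric,
  all but the inhomogeneous term of the transformation law cancel in the Koszul formula.\<close>

lemma connection_change:
  assumes y: "y \<in> D"
  shows "A y *v (connection_endo g y X *v Y) =
    connection_endo g' (T y) (A y *v X) *v (A y *v Y) + frechet_derivative A (at y) X *v Y"
proof -
  let ?A = "A y" and ?DA = "frechet_derivative A (at y)" and ?g = "g' (T y)"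
  let ?E = "frechet_derivative g (at y)" and ?E' = "frechet_derivative g' (at (T y))"
  have yU: "y \<in> U" and TU: "T y \<in> U'" using y D_subset T_image by auto
  have dg: "X \<bullet> (?E Z *v Y) = (?A *v X) \<bullet> (?E' (?A *v Z) *v (?A *v Y))
      + (?DA Z *v X) \<bullet> (?g *v (?A *v Y)) + (?DA Z *v Y) \<bullet> (?g *v (?A *v X))" for X Y Z
  proof -
    have dA: "((\<lambda>y. A y *v X) has_derivative (\<lambda>Z. ?DA Z *v X)) (at y)" for X
      using bounded_bilinear.FDERIV[OF bounded_bilinear_matrix_vector_mult
          differentiable_has_derivative[OF A_differentiable[OF y]] has_derivative_const[of X]] by simp
    have "((\<lambda>y. (A y *v X) \<bullet> (g' (T y) *v (A y *v Y))) has_derivative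
        (\<lambda>Z. (?A *v X) \<bullet> (?g *v (?DA Z *v Y) + ?E' (?A *v Z) *v (?A *v Y)) + (?DA Z *v X) \<bullet> (?g *v (?A *v Y)))) (at y)"
      by (intro has_derivative_inner dA bounded_bilinear.FDERIV[OF bounded_bilinear_matrix_vector_mult]
          has_derivative_compose_T y smooth_on_differentiable[OF L2.smooth TU])
    then have "((\<lambda>y. X \<bullet> (g y *v Y)) has_derivative
        (\<lambda>Z. (?A *v X) \<bullet> (?g *v (?DA Z *v Y) + ?E' (?A *v Z) *v (?A *v Y)) + (?DA Z *v X) \<bullet> (?g *v (?A *v Y)))) (at y)"
      by (rule has_derivative_transform_within_open[OF _ open_D y]) (rule metric_A[symmetric])
    moreover have "((\<lambda>y. X \<bullet> (g y *v Y)) has_derivative (\<lambda>Z. X \<bullet> (?E Z *v Y))) (at y)"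
      using bounded_bilinear.FDERIV[OF bounded_bilinear_matrix_vector_mult
          differentiable_has_derivative[OF smooth_on_differentiable[OF L1.smooth yU]] has_derivative_const[of Y]]
      by (intro has_derivative_inner_right) simp
    ultimately have "X \<bullet> (?E Z *v Y) = (?A *v X) \<bullet> (?g *v (?DA Z *v Y) + ?E' (?A *v Z) *v (?A *v Y))
        + (?DA Z *v X) \<bullet> (?g *v (?A *v Y))"
      using has_derivative_unique by (metis (no_types, lifting))
    then show ?thesis
      using L2.inner_g_commute[OF TU, of "?A *v X" "?DA Z *v Y"] by (simp add: inner_add_right)
  qed
  have "g' (T y) *v (A y *v (connection_endo g y X *v Y)) =
    g' (T y) *v (connection_endo g' (T y) (A y *v X) *v (A y *v Y) + ?DA X *v Y)"
  proof (rule vector_eq_ldot[THEN iffD1], rule allI)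
    fix w
    obtain W where w: "w = ?A *v W" using A_surj[OF y] by metis
    have "2 * (w \<bullet> (?g *v (?A *v (connection_endo g y X *v Y)))) = 2 * (W \<bullet> (g y *v (connection_endo g y X *v Y)))"
      unfolding w metric_A[OF y] ..
    also have "\<dots> = W \<bullet> (?E X *v Y) + W \<bullet> (?E Y *v X) - X \<bullet> (?E W *v Y)"
      by (rule L1.koszul[OF yU])
    also have "\<dots> = (w \<bullet> (?E' (?A *v X) *v (?A *v Y)) + w \<bullet> (?E' (?A *v Y) *v (?A *v X))
        - (?A *v X) \<bullet> (?E' w *v (?A *v Y))) + 2 * ((?DA X *v Y) \<bullet> (?g *v w))"
      unfolding dg w A_derivative_sym[OF y, of Y X] A_derivative_sym[OF y, of W X] A_derivative_sym[OF y, of W Y]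
      by simp
    also have "\<dots> = 2 * (w \<bullet> (?g *v (connection_endo g' (T y) (?A *v X) *v (?A *v Y)))) + 2 * (w \<bullet> (?g *v (?DA X *v Y)))"
      using L2.inner_g_commute[OF TU, of w "?DA X *v Y"]
      unfolding L2.koszul[OF TU, symmetric] by simp
    finally show "w \<bullet> (g' (T y) *v (A y *v (connection_endo g y X *v Y))) =
        w \<bullet> (g' (T y) *v (connection_endo g' (T y) (A y *v X) *v (A y *v Y) + ?DA X *v Y))"
      by (simp add: matrix_vector_right_distrib inner_add_right)
  qed
  then show ?thesis by (rule L2.g_cancel_vector[OF TU])
qed

end

text \<open>The induced change of bundle coordinates, characterised by \<open>p\<^sub>h = p'\<^sub>k \<partial>x'\<^sup>k / \<partial>x\<^sup>h\<close>.\<close>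

locale cotangent_change = isometric_change U U' g g' D T +
  C1: cotangent_metric U g c v v' + C2: cotangent_metric U' g' c v v'
  for U U' :: "(real^'n) set" and g g' D T c v v' +
  fixes L :: "real^('n + 'n) \<Rightarrow> real^('n + 'n)"
  assumes L_smooth: "smooth_on {z. q_part z \<in> D \<and> p_part z \<noteq> 0} L"
    and L_q: "\<And>z. q_part z \<in> D \<Longrightarrow> p_part z \<noteq> 0 \<Longrightarrow> q_part (L z) = T (q_part z)"
    and L_p: "\<And>z. q_part z \<in> D \<Longrightarrow> p_part z \<noteq> 0 \<Longrightarrow> p_part (L z) v* A (q_part z) = p_part z"
begin

context
  fixes z :: "real^('n + 'n)"
  assumes qz: "q_part z \<in> D" and pz: "p_part z \<noteq> 0"
begin

abbreviation (input) Az where "Az \<equiv> A (q_part z)"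
abbreviation (input) DL where "DL \<equiv> frechet_derivative L (at z)"

lemma zW: "z \<in> C1.W" and LW: "L z \<in> C2.W"
proof -
  show "z \<in> C1.W" using qz pz D_subset by (auto simp: C1.W_def)
  have "p_part (L z) \<noteq> 0"
    using L_p[OF qz pz] pz by (metis bounded_bilinear.zero_left[OF bounded_bilinear_vector_matrix_mult])
  then show "L z \<in> C2.W" using L_q[OF qz pz] qz T_image by (auto simp: C2.W_def)
qed

lemma momentum_A: "p_part z \<bullet> a = p_part (L z) \<bullet> (Az *v a)"
  using L_p[OF qz pz] by (metis dot_lmul_matrix)

lemma u_A: "C2.u (L z) = Az *v C1.u z"
proof -
  have "g' (T (q_part z)) *v (Az *v C1.u z) = p_part (L z)"
  proof (rule A_cancel[OF qz])
    have "((g' (T (q_part z)) *v (Az *v C1.u z)) v* Az) \<bullet> a = p_part z \<bullet> a" for a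
      using metric_A[OF qz, of a "C1.u z"] C1.P_inverse(1)[OF zW, of "p_part z"]
      unfolding dot_lmul_matrix by (simp add: inner_commute)
    then show "(g' (T (q_part z)) *v (Az *v C1.u z)) v* Az = p_part (L z) v* Az"
      unfolding L_p[OF qz pz] using vector_eq_rdot by blast
  qed
  then show ?thesis
    using C2.P_inverse(2)[OF LW, of "Az *v C1.u z"] by (simp add: L_q[OF qz pz])
qed

lemma energy_A: "energy g' (L z) = energy g z"
  by (simp add: C1.energy_inner C2.energy_inner u_A momentum_A)

lemma Gl_A: "a \<bullet> (C1.Gl z *v b) = (Az *v a) \<bullet> (C2.Gl (L z) *v (Az *v b))"
  unfolding C1.Gl_mult C2.Gl_mult energy_A
  by (simp add: inner_add_right L_q[OF qz pz] metric_A[OF qz] momentum_A[of b] inner_commute[of _ "p_part _"] momentum_A[of a])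

lemma Gl_A_mult: "C1.Gl z *v a = (C2.Gl (L z) *v (Az *v a)) v* Az"
proof (rule vector_eq_rdot[THEN iffD1], rule allI)
  fix b
  show "(C1.Gl z *v a) \<bullet> b = ((C2.Gl (L z) *v (Az *v a)) v* Az) \<bullet> b"
    using Gl_A[of b a] unfolding dot_lmul_matrix by (simp add: inner_commute)
qed

lemma Hu_A: "Az *v (C1.Hu z *v (x v* Az)) = C2.Hu (L z) *v x"
proof -
  let ?a = "C1.Hu z *v (x v* Az)"
  have "(C2.Gl (L z) *v (Az *v ?a)) v* Az = x v* Az"
    using Gl_A_mult[of ?a] C1.Gl_Hu[OF zW] by simp
  then have "C2.Gl (L z) *v (Az *v ?a) = x" by (rule A_cancel[OF qz])
  then show ?thesis using C2.Hu_Gl[OF LW] by metis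
qed

lemma L_derivative: "(L has_derivative DL) (at z)"
  using L_smooth qz pz by (intro differentiable_has_derivative smooth_on_differentiable) auto

lemma domain_open: "open {z :: real^('n + 'n). q_part z \<in> D \<and> p_part z \<noteq> 0}"
  using L_smooth by (rule smooth_on_open)

lemma q_DL: "q_part (DL X) = Az *v q_part X"
proof -
  have "((\<lambda>z. q_part (L z)) has_derivative (\<lambda>X. q_part (DL X))) (at z)"
    by (rule has_derivative_parts(1)[OF L_derivative])
  moreover have "((\<lambda>z. q_part (L z)) has_derivative (\<lambda>X. Az *v q_part X)) (at z)"
    unfolding A_mult[OF qz] using has_derivative_base[OF T_differentiable[OF qz]]
    by (rule has_derivative_transform_within_open[OF _ domain_open])
      (use qz pz in \<open>simp_all add: L_q\<close>)
  ultimately show ?thesis using has_derivative_unique by (metis (no_types, lifting))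
qed

lemma p_DL:
  "p_part X = p_part (DL X) v* Az + p_part (L z) v* frechet_derivative A (at (q_part z)) (q_part X)"
proof -
  have "((\<lambda>z. p_part (L z) v* A (q_part z)) has_derivative
      (\<lambda>X. p_part (L z) v* frechet_derivative A (at (q_part z)) (q_part X) + p_part (DL X) v* Az)) (at z)"
    by (intro has_derivative_vec_mult has_derivative_parts L_derivative has_derivative_base A_differentiable qz)
  then have "(p_part has_derivative
      (\<lambda>X. p_part (L z) v* frechet_derivative A (at (q_part z)) (q_part X) + p_part (DL X) v* Az)) (at z)"
    by (rule has_derivative_transform_within_open[OF _ domain_open]) (use qz pz in \<open>simp_all add: L_p\<close>)
  then show ?thesis
    using has_derivative_unique[OF bounded_linear_imp_has_derivative[OF p_part_bounded_linear]]
    by (metis (no_types, lifting) add.commute)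
qed

lemma K_A: "C1.K z a = C2.K (L z) (Az *v a) v* Az + p_part (L z) v* frechet_derivative A (at (q_part z)) a"
proof (rule vector_eq_rdot[THEN iffD1], rule allI)
  fix b
  show "C1.K z a \<bullet> b = (C2.K (L z) (Az *v a) v* Az + p_part (L z) v* frechet_derivative A (at (q_part z)) a) \<bullet> b"
    by (simp add: C1.K_inner momentum_A connection_change[OF qz] inner_add_left inner_add_right dot_lmul_matrix
        C2.K_inner L_q[OF qz pz])
qed

text \<open>The second derivatives of \<open>T\<close> enter the differential of \<open>p\<^sub>h = p'\<^sub>k \<partial>x'\<^sup>k / \<partial>x\<^sup>h\<close> and the
  transformation law of the Christoffel symbols in the same way, so that \<open>Dp\<close> is tensorial.\<close>

lemma Dpv_A: "C1.Dpv z X = C2.Dpv (L z) (DL X) v* Az"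
proof -
  have "C1.Dpv z X = p_part X - C1.K z (q_part X)" by (rule C1.Dpv_def)
  then show ?thesis
    using p_DL[of X] by (simp add: C2.Dpv_def K_A q_DL vector_matrix_linear)
qed

lemma G_A: "X \<bullet> (C1.G z *v Y) = DL X \<bullet> (C2.G (L z) *v DL Y)"
  unfolding C1.G_inner[OF zW] C2.G_inner[OF LW] q_DL Gl_A Dpv_A
  by (simp add: dot_lmul_matrix Hu_A)

lemma J_A: "DL (C1.J z *v X) = C2.J (L z) *v DL X"
proof (rule C2.parts_eqI)
  show "q_part (DL (C1.J z *v X)) = q_part (C2.J (L z) *v DL X)"
    unfolding q_DL C1.q_J[OF zW] C2.q_J[OF LW] Dpv_A by (simp add: matrix_vector_minus Hu_A)
  have "C2.Dpv (L z) (DL (C1.J z *v X)) v* Az = C2.Dpv (L z) (C2.J (L z) *v DL X) v* Az"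
    unfolding Dpv_A[symmetric] C1.Dpv_J[OF zW] C2.Dpv_J[OF LW] q_DL Gl_A_mult ..
  then show "C2.Dpv (L z) (DL (C1.J z *v X)) = C2.Dpv (L z) (C2.J (L z) *v DL X)"
    by (rule A_cancel[OF qz])
qed

lemma DL_matrix: "matrix DL *v X = DL X"
  by (rule fun_cong[OF matrix_vector_mul(2)[OF has_derivative_linear[OF L_derivative]]])

lemma metric_change:
  "C1.G z = transpose (matrix DL) ** C2.G (L z) ** matrix DL"
  by (rule matrix_eq_inner)
    (simp add: G_A inner_matrix_transpose[of _ "transpose (matrix DL)"] DL_matrix
      del: transpose_matrix_vector flip: matrix_vector_mul_assoc)

lemma structure_change: "matrix DL ** C1.J z = C2.J (L z) ** matrix DL"
  by (simp add: matrix_eq DL_matrix J_A flip: matrix_vector_mul_assoc)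

end

end

section \<open>Atlases\<close>

locale smooth_atlas_locale =
  fixes N :: "('i, 'a, 'k::finite) atlas"
  assumes atlas: "smooth_atlas N"
begin

lemma chart_inj: "i \<in> index N \<Longrightarrow> inj_on (chart_map N i) (chart_dom N i)"
  and open_coord_range: "i \<in> index N \<Longrightarrow> open (coord_range N i)"
  and open_overlap: "i \<in> index N \<Longrightarrow> j \<in> index N \<Longrightarrow> open (overlap N i j)"
  and smooth_transition: "i \<in> index N \<Longrightarrow> j \<in> index N \<Longrightarrow> smooth_on (overlap N i j) (transition N i j)"
  using atlas by (auto simp: smooth_atlas_def)

lemma transition_chart:
  "i \<in> index N \<Longrightarrow> x \<in> chart_dom N i \<Longrightarrow> transition N i j (chart_map N i x) = chart_map N j x"
  by (simp add: transition_def inv_into_f_f[OF chart_inj])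

lemma chart_in_overlap:
  "x \<in> chart_dom N i \<Longrightarrow> x \<in> chart_dom N j \<Longrightarrow> chart_map N i x \<in> overlap N i j"
  by (auto simp: overlap_def)

lemma transition_in_overlap:
  "i \<in> index N \<Longrightarrow> y \<in> overlap N i j \<Longrightarrow> transition N i j y \<in> overlap N j i"
  by (auto simp: overlap_def transition_chart)

lemma transition_differentiable:
  "i \<in> index N \<Longrightarrow> j \<in> index N \<Longrightarrow> y \<in> overlap N i j \<Longrightarrow> transition N i j differentiable (at y)"
  by (rule smooth_on_differentiable[OF smooth_transition])

lemma jacobian_cocycle:
  assumes i: "i \<in> index N" "x \<in> chart_dom N i" and j: "j \<in> index N" "x \<in> chart_dom N j"
    and k: "k \<in> index N" "x \<in> chart_dom N k"
  shows "transition_jacobian N i k (chart_map N i x) =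
    transition_jacobian N j k (chart_map N j x) ** transition_jacobian N i j (chart_map N i x)"
proof -
  let ?y = "chart_map N i x" and ?S = "overlap N i j \<inter> overlap N i k"
  have y: "?y \<in> ?S" using i j k by (auto simp: overlap_def)
  have S: "open ?S" using i j k by (intro open_Int open_overlap)
  have eq: "transition N i k z = transition N j k (transition N i j z)" if "z \<in> ?S" for z
    using that i j inj_onD[OF chart_inj[OF i(1)]] by (force simp: overlap_def transition_chart)
  have d: "transition N i j differentiable (at ?y)"
    "transition N j k differentiable (at (transition N i j ?y))"
    using i j k by (auto intro!: transition_differentiable chart_in_overlap simp: transition_chart)
  have "frechet_derivative (transition N i k) (at ?y) =
      frechet_derivative (transition N j k \<circ> transition N i j) (at ?y)"
    by (rule frechet_derivative_cong_open[OF S y]) (simp add: eq)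
  also have "\<dots> = frechet_derivative (transition N j k) (at (transition N i j ?y))
      \<circ> frechet_derivative (transition N i j) (at ?y)"
    by (rule frechet_derivative_compose[OF d])
  finally show ?thesis
    using i matrix_compose[OF linear_frechet_derivative[OF d(1)] linear_frechet_derivative[OF d(2)]]
    by (simp add: transition_jacobian_def transition_chart)
qed

lemma jacobian_self:
  assumes "i \<in> index N" "x \<in> chart_dom N i"
  shows "transition_jacobian N i i (chart_map N i x) = mat 1"
proof -
  have "frechet_derivative (transition N i i) (at (chart_map N i x)) = frechet_derivative (\<lambda>y. y) (at (chart_map N i x))"
    using assms by (intro frechet_derivative_cong_open[OF open_overlap[of i i]])
      (auto simp: overlap_def transition_chart)
  then show ?thesis by (simp add: transition_jacobian_def matrix_id_mat_1[unfolded id_def])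
qed

lemma jacobian_inverse:
  assumes "i \<in> index N" "x \<in> chart_dom N i" "j \<in> index N" "x \<in> chart_dom N j"
  shows "transition_jacobian N j i (chart_map N j x) ** transition_jacobian N i j (chart_map N i x) = mat 1"
  using jacobian_cocycle[of i x j i] jacobian_self assms by simp

lemma smooth_jacobian:
  "i \<in> index N \<Longrightarrow> j \<in> index N \<Longrightarrow> smooth_on (overlap N i j) (transition_jacobian N i j)"
proof -
  have "transition_jacobian N i j = (\<lambda>y. \<chi> a b. partial_deriv b (transition N i j) y $ a)"
    by (simp add: transition_jacobian_def matrix_def partial_deriv_def fun_eq_iff)
  then show "i \<in> index N \<Longrightarrow> j \<in> index N \<Longrightarrow> ?thesis"
    by (auto intro!: smooth_intros smooth_transition)
qed

lemmas openin_iff = openin_manifold_topology[OF atlas]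

lemma topspace_manifold: "topspace (manifold_topology N) = points N"
proof -
  have "openin (manifold_topology N) (points N)"
    unfolding openin_iff
  proof (intro conjI ballI order_refl)
    fix i assume "i \<in> index N"
    moreover then have "points N \<inter> chart_dom N i = chart_dom N i" by (auto simp: points_def)
    ultimately show "open (chart_map N i ` (points N \<inter> chart_dom N i))"
      using open_coord_range by (simp add: coord_range_def)
  qed
  then show ?thesis
    using openin_iff openin_topspace[of "manifold_topology N"] by (meson openin_subset subset_antisym)
qed

lemma openin_chart_preimage:
  assumes i: "i \<in> index N" and S: "open S"
  shows "openin (manifold_topology N) {x \<in> chart_dom N i. chart_map N i x \<in> S}"
  unfolding openin_iff
proof (intro conjI ballI)
  show "{x \<in> chart_dom N i. chart_map N i x \<in> S} \<subseteq> points N" using i by (auto simp: points_def)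
  fix j assume j: "j \<in> index N"
  have "chart_map N j ` ({x \<in> chart_dom N i. chart_map N i x \<in> S} \<inter> chart_dom N j) =
      transition N j i -` S \<inter> overlap N j i"
    using j by (auto simp: overlap_def transition_chart)
  then show "open (chart_map N j ` ({x \<in> chart_dom N i. chart_map N i x \<in> S} \<inter> chart_dom N j))"
    using smooth_on_continuous[OF smooth_transition[OF j i]] S
    by (simp add: continuous_on_open_vimage[OF open_overlap[OF j i]])
qed

lemma openin_chart_image:
  "openin (manifold_topology N) S \<Longrightarrow> i \<in> index N \<Longrightarrow> open (chart_map N i ` (S \<inter> chart_dom N i))"
  by (simp add: openin_iff)

lemma openin_chart_dom: "i \<in> index N \<Longrightarrow> openin (manifold_topology N) (chart_dom N i)"
  using openin_chart_preimage[of i UNIV] by simp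

text \<open>Each chart domain is a union of sets of a countable base, so it suffices to choose one chart for every
  set of the base that is contained in a chart domain.\<close>

lemma countable_subatlas:
  assumes "second_countable (manifold_topology N)"
  obtains I where "countable I" "I \<subseteq> index N" "points N = (\<Union>i\<in>I. chart_dom N i)"
proof -
  from assms[unfolded second_countable_def] obtain B where B: "countable B"
    "\<forall>S x. openin (manifold_topology N) S \<and> x \<in> S \<longrightarrow> (\<exists>V\<in>B. x \<in> V \<and> V \<subseteq> S)"
    by (elim exE conjE) (rule that)
  define B' where "B' = {V \<in> B. \<exists>i\<in>index N. V \<subseteq> chart_dom N i}"
  define f where "f V = (SOME i. i \<in> index N \<and> V \<subseteq> chart_dom N i)" for V
  have f: "f V \<in> index N \<and> V \<subseteq> chart_dom N (f V)" if "V \<in> B'" for V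
  proof -
    have "\<exists>i. i \<in> index N \<and> V \<subseteq> chart_dom N i" using that by (auto simp: B'_def)
    then show ?thesis unfolding f_def by (rule someI_ex)
  qed
  have "countable (f ` B')" using B(1) by (auto simp: B'_def)
  moreover have "f ` B' \<subseteq> index N" using f by auto
  moreover have "points N = (\<Union>i\<in>f ` B'. chart_dom N i)"
  proof
    show "points N \<subseteq> (\<Union>i\<in>f ` B'. chart_dom N i)"
    proof
      fix x assume "x \<in> points N"
      then obtain i where i: "i \<in> index N" "x \<in> chart_dom N i" by (auto simp: points_def)
      then obtain V where "V \<in> B" "x \<in> V" "V \<subseteq> chart_dom N i"
        using B(2) openin_chart_dom by blast
      then have "V \<in> B'" using i by (auto simp: B'_def)
      then show "x \<in> (\<Union>i\<in>f ` B'. chart_dom N i)" using f \<open>x \<in> V\<close> by blast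
    qed
    show "(\<Union>i\<in>f ` B'. chart_dom N i) \<subseteq> points N" using f by (auto simp: points_def)
  qed
  ultimately show thesis by (rule that)
qed

text \<open>A countable base of the coordinate space is pulled back along countably many charts.\<close>

lemma second_countable_from_subatlas:
  assumes I: "countable I" "I \<subseteq> index N" and cover: "points N = (\<Union>i\<in>I. chart_dom N i)"
  shows "second_countable (manifold_topology N)"
proof -
  obtain C :: "(real^'k) set set" where C: "countable C" "topological_basis C"
    using ex_countable_basis by blast
  let ?f = "\<lambda>(i, S). {x \<in> chart_dom N i. chart_map N i x \<in> S}"
  have 1: "countable (?f ` (I \<times> C))" using I C by auto
  have 2: "\<forall>V\<in>?f ` (I \<times> C). openin (manifold_topology N) V"
    using I C(2) topological_basis_open by (auto intro!: openin_chart_preimage)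
  have 3: "\<exists>V\<in>?f ` (I \<times> C). x \<in> V \<and> V \<subseteq> S" if S: "openin (manifold_topology N) S" "x \<in> S" for S x
  proof -
    have "x \<in> points N" using S openin_subset topspace_manifold by blast
    then obtain i where i: "i \<in> I" "x \<in> chart_dom N i" using cover by auto
    then have "open (chart_map N i ` (S \<inter> chart_dom N i))" "chart_map N i x \<in> chart_map N i ` (S \<inter> chart_dom N i)"
      using S I openin_chart_image by auto
    then obtain c where c: "c \<in> C" "chart_map N i x \<in> c" "c \<subseteq> chart_map N i ` (S \<inter> chart_dom N i)"
      using C(2) topological_basisE by blast
    have "?f (i, c) \<subseteq> S"
      using c(3) i I inj_onD[OF chart_inj] by (fastforce simp: subset_iff image_iff)
    then show ?thesis using i c by (intro bexI[of _ "?f (i, c)"]) auto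
  qed
  show ?thesis
    unfolding second_countable_def
  proof (intro exI[of _ "?f ` (I \<times> C)"] conjI allI impI)
    fix S x
    assume "openin (manifold_topology N) S \<and> x \<in> S"
    then show "\<exists>V\<in>?f ` (I \<times> C). x \<in> V \<and> V \<subseteq> S" using 3 by blast
  qed (rule 1, rule 2)
qed

end

section \<open>The nonzero cotangent bundle as a manifold\<close>

lemma smooth_on_bundle_vec:
  fixes a b :: "real^'k \<Rightarrow> real^'n"
  assumes "smooth_on S a" "smooth_on S b"
  shows "smooth_on S (\<lambda>z. bundle_vec (a z) (b z))"
  unfolding bundle_vec_def
proof (intro smooth_on_vec_lambda)
  fix i :: "'n + 'n"
  show "smooth_on S (\<lambda>z. case i of Inl h \<Rightarrow> a z $ h | Inr h \<Rightarrow> b z $ h)"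
    using assms by (cases i) (auto intro: smooth_intros)
qed

lemma cotangent0_simps:
  "index (cotangent0 M) = index M"
  "chart_dom (cotangent0 M) i = {(x, w). x \<in> chart_dom M i \<and> w \<in> covectors M x \<and> w \<noteq> (\<lambda>_. 0)}"
  "chart_map (cotangent0 M) i (x, w) = bundle_vec (chart_map M i x) (w i)"
  by (simp_all add: cotangent0_def bundle_vec_def)

text \<open>The covector with components \<open>p\<close> in the chart \<open>i\<close>.\<close>

definition covector :: "('i, 'a, 'n::finite) atlas \<Rightarrow> 'i \<Rightarrow> 'a \<Rightarrow> real^'n \<Rightarrow> 'i \<Rightarrow> real^'n" where
  "covector M i x p = (\<lambda>j. if j \<in> index M \<and> x \<in> chart_dom M j
     then p v* transition_jacobian M j i (chart_map M j x) else 0)"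

context smooth_atlas_locale
begin

abbreviation "TN \<equiv> cotangent0 N"

lemma covector_in_covectors:
  assumes "i \<in> index N" "x \<in> chart_dom N i"
  shows "covector N i x p \<in> covectors N x"
  unfolding covectors_def mem_Collect_eq
proof (intro conjI allI impI ballI)
  fix j k
  assume "j \<in> index N" "k \<in> index N" "x \<in> chart_dom N j \<and> x \<in> chart_dom N k"
  then show "covector N i x p j =
      transpose (transition_jacobian N j k (chart_map N j x)) *v covector N i x p k"
    using assms jacobian_cocycle[of j x k i] by (simp add: covector_def vector_matrix_mul_assoc)
qed (auto simp: covector_def)

lemma covector_self:
  "i \<in> index N \<Longrightarrow> x \<in> chart_dom N i \<Longrightarrow> covector N i x p i = p"
  by (simp add: covector_def jacobian_self)

lemma covectors_component:
  assumes "w \<in> covectors N x" "i \<in> index N" "x \<in> chart_dom N i" "j \<in> index N" "x \<in> chart_dom N j"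
  shows "w j = w i v* transition_jacobian N j i (chart_map N j x)"
proof -
  have "w j = transpose (transition_jacobian N j i (chart_map N j x)) *v w i"
    using assms unfolding covectors_def by blast
  then show ?thesis by simp
qed

lemma covector_of_component:
  assumes "w \<in> covectors N x" "i \<in> index N" "x \<in> chart_dom N i"
  shows "w = covector N i x (w i)"
proof
  fix j
  show "w j = covector N i x (w i) j"
  proof (cases "j \<in> index N \<and> x \<in> chart_dom N j")
    case True
    then show ?thesis using covectors_component[OF assms, of j] by (simp add: covector_def)
  next
    case False
    then have "w j = 0" using assms(1) unfolding covectors_def by blast
    then show ?thesis using False by (auto simp: covector_def)
  qed
qed

lemma covector_eq_0_iff:
  assumes "w \<in> covectors N x" "i \<in> index N" "x \<in> chart_dom N i"
  shows "w = (\<lambda>_. 0) \<longleftrightarrow> w i = 0"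
proof
  assume "w i = 0"
  then show "w = (\<lambda>_. 0)"
    using covector_of_component[OF assms]
    by (simp add: covector_def fun_eq_iff bounded_bilinear.zero_left[OF bounded_bilinear_vector_matrix_mult])
qed auto

lemma bundle_chart_image:
  assumes i: "i \<in> index N" and S: "S \<subseteq> chart_dom N i"
  shows "chart_map TN i ` {(x, w). x \<in> S \<and> w \<in> covectors N x \<and> w \<noteq> (\<lambda>_. 0)} =
    {z. q_part z \<in> chart_map N i ` S \<and> p_part z \<noteq> 0}"
proof (intro equalityI subsetI)
  fix z assume "z \<in> chart_map TN i ` {(x, w). x \<in> S \<and> w \<in> covectors N x \<and> w \<noteq> (\<lambda>_. 0)}"
  then show "z \<in> {z. q_part z \<in> chart_map N i ` S \<and> p_part z \<noteq> 0}"
    using S covector_eq_0_iff[OF _ i] by (auto simp: cotangent0_simps)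
next
  fix z assume "z \<in> {z. q_part z \<in> chart_map N i ` S \<and> p_part z \<noteq> 0}"
  then obtain x where x: "x \<in> S" "q_part z = chart_map N i x" "p_part z \<noteq> 0" by auto
  let ?w = "covector N i x (p_part z)"
  have xi: "x \<in> chart_dom N i" using x S by auto
  have "?w \<in> covectors N x" "?w \<noteq> (\<lambda>_. 0)"
    using covector_eq_0_iff[OF covector_in_covectors[OF i xi] i xi] x
    by (simp_all add: covector_in_covectors[OF i xi] covector_self[OF i xi])
  moreover have "z = chart_map TN i (x, ?w)"
    by (simp add: cotangent0_simps covector_self[OF i xi] bundle_vec_parts flip: x(2))
  ultimately show "z \<in> chart_map TN i ` {(x, w). x \<in> S \<and> w \<in> covectors N x \<and> w \<noteq> (\<lambda>_. 0)}"
    using x(1) by blast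
qed

lemma bundle_coord_range:
  "i \<in> index N \<Longrightarrow> coord_range TN i = {z. q_part z \<in> coord_range N i \<and> p_part z \<noteq> 0}"
  using bundle_chart_image[of i "chart_dom N i"] by (simp add: coord_range_def cotangent0_simps)

lemma bundle_overlap:
  assumes "i \<in> index N"
  shows "overlap TN i j = {z. q_part z \<in> overlap N i j \<and> p_part z \<noteq> 0}"
proof -
  have "chart_dom TN i \<inter> chart_dom TN j =
      {(x, w). x \<in> chart_dom N i \<inter> chart_dom N j \<and> w \<in> covectors N x \<and> w \<noteq> (\<lambda>_. 0)}"
    by (auto simp: cotangent0_simps)
  then show ?thesis
    using bundle_chart_image[OF assms, of "chart_dom N i \<inter> chart_dom N j"] by (simp add: overlap_def)
qed

lemma bundle_chart_inj:
  assumes i: "i \<in> index N"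
  shows "inj_on (chart_map TN i) (chart_dom TN i)"
proof (rule inj_onI)
  fix a b assume a: "a \<in> chart_dom TN i" and b: "b \<in> chart_dom TN i" and e: "chart_map TN i a = chart_map TN i b"
  obtain x w x' w' where ab: "a = (x, w)" "b = (x', w')" by fastforce
  from arg_cong[OF e, of q_part] arg_cong[OF e, of p_part]
  have "chart_map N i x = chart_map N i x'" "w i = w' i" by (simp_all add: ab cotangent0_simps)
  moreover then have "x = x'" using a b inj_onD[OF chart_inj[OF i]] by (auto simp: ab cotangent0_simps)
  ultimately show "a = b"
    using a b covector_of_component[of w x i] covector_of_component[of w' x i] i
    by (auto simp: ab cotangent0_simps)
qed

lemma bundle_transition:
  assumes i: "i \<in> index N" and j: "j \<in> index N" and z: "z \<in> overlap TN i j"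
  shows "transition TN i j z = bundle_vec (transition N i j (q_part z))
    (p_part z v* transition_jacobian N j i (transition N i j (q_part z)))"
proof -
  obtain x w where xw: "(x, w) \<in> chart_dom TN i" "(x, w) \<in> chart_dom TN j" "z = chart_map TN i (x, w)"
    using z by (auto simp: overlap_def)
  then have x: "x \<in> chart_dom N i" "x \<in> chart_dom N j" "w \<in> covectors N x" by (auto simp: cotangent0_simps)
  have "transition TN i j z = chart_map TN j (x, w)"
    by (simp add: transition_def xw inv_into_f_f[OF bundle_chart_inj[OF i]])
  moreover have "w j = w i v* transition_jacobian N j i (chart_map N j x)"
    using covectors_component[OF x(3) i x(1) j x(2)] .
  ultimately show ?thesis
    using x i by (simp add: xw(3) cotangent0_simps transition_chart)
qed

lemma bundle_atlas: "smooth_atlas TN"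
  unfolding smooth_atlas_def
proof (intro conjI ballI)
  fix i assume "i \<in> index TN"
  then have i: "i \<in> index N" by (simp add: cotangent0_simps)
  show "inj_on (chart_map TN i) (chart_dom TN i)" by (rule bundle_chart_inj[OF i])
  show "open (coord_range TN i)"
    unfolding bundle_coord_range[OF i] by (rule open_bundle_set[OF open_coord_range[OF i]])
  fix j assume "j \<in> index TN"
  then have j: "j \<in> index N" by (simp add: cotangent0_simps)
  show op: "open (overlap TN i j)"
    unfolding bundle_overlap[OF i] by (rule open_bundle_set[OF open_overlap[OF i j]])
  have q: "smooth_on (overlap TN i j) q_part" and p: "smooth_on (overlap TN i j) p_part"
    using smooth_on_linear[OF _ op] q_part_bounded_linear p_part_bounded_linear by auto
  have T: "smooth_on (overlap TN i j) (\<lambda>z. transition N i j (q_part z))"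
    by (rule smooth_on_compose[OF smooth_transition[OF i j] q]) (auto simp: bundle_overlap[OF i])
  have "smooth_on (overlap TN i j) (\<lambda>z. transition_jacobian N j i (transition N i j (q_part z)))"
    by (rule smooth_on_compose[OF smooth_jacobian[OF j i] T])
      (auto simp: bundle_overlap[OF i] transition_in_overlap[OF i])
  then have "smooth_on (overlap TN i j) (\<lambda>z. bundle_vec (transition N i j (q_part z))
      (p_part z v* transition_jacobian N j i (transition N i j (q_part z))))"
    by (intro smooth_on_bundle_vec T smooth_intros p)
  then show "smooth_on (overlap TN i j) (transition TN i j)"
    by (rule smooth_on_cong) (rule bundle_transition[OF i j])
qed

text \<open>Points over different points of the base are separated by preimages of neighbourhoods in the base,
  and two points of the same fibre lie in a common chart domain. The charts over a countable subatlas of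
  the base form a countable subatlas of the bundle.\<close>

lemma bundle_manifold:
  assumes N: "smooth_manifold N"
  shows "smooth_manifold TN"
proof -
  interpret B: smooth_atlas_locale TN by unfold_locales (rule bundle_atlas)
  have pts: "(x, w) \<in> points TN \<longleftrightarrow> x \<in> points N \<and> w \<in> covectors N x \<and> w \<noteq> (\<lambda>_. 0)" for x w
    by (auto simp: points_def cotangent0_simps)
  have proj: "openin (manifold_topology TN) {a \<in> points TN. fst a \<in> S}"
    if S: "openin (manifold_topology N) S" for S
    unfolding B.openin_iff
  proof (intro conjI ballI)
    fix i assume "i \<in> index TN"
    then have i: "i \<in> index N" by (simp add: cotangent0_simps)
    then have "{a \<in> points TN. fst a \<in> S} \<inter> chart_dom TN i =
        {(x, w). x \<in> S \<inter> chart_dom N i \<and> w \<in> covectors N x \<and> w \<noteq> (\<lambda>_. 0)}"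
      by (auto simp: cotangent0_simps points_def)
    then show "open (chart_map TN i ` ({a \<in> points TN. fst a \<in> S} \<inter> chart_dom TN i))"
      using bundle_chart_image[OF i, of "S \<inter> chart_dom N i"] open_bundle_set[OF openin_chart_image[OF S i]]
      by simp
  qed auto
  have "Hausdorff_space (manifold_topology TN)"
    unfolding Hausdorff_space_def B.topspace_manifold
  proof (intro allI impI, elim conjE)
    fix a b assume a: "a \<in> points TN" and b: "b \<in> points TN" and ab: "a \<noteq> b"
    show "\<exists>U V. openin (manifold_topology TN) U \<and> openin (manifold_topology TN) V \<and> a \<in> U \<and> b \<in> V \<and> disjnt U V"
    proof (cases "fst a = fst b")
      case False
      have "Hausdorff_space (manifold_topology N)" using N by (simp add: smooth_manifold_def)
      moreover have "fst a \<in> points N" "fst b \<in> points N" using a b pts by (metis prod.collapse)+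
      ultimately obtain U V where "openin (manifold_topology N) U" "openin (manifold_topology N) V"
        "fst a \<in> U" "fst b \<in> V" "disjnt U V"
        using False unfolding Hausdorff_space_def topspace_manifold by metis
      then show ?thesis
        using a b by (intro exI[of _ "{a \<in> points TN. fst a \<in> U}"] exI[of _ "{a \<in> points TN. fst a \<in> V}"])
          (auto simp: proj disjnt_iff)
    next
      case True
      obtain x w w' where e: "a = (x, w)" "b = (x, w')" using True by (metis prod.collapse)
      obtain i where i: "i \<in> index N" "x \<in> chart_dom N i" using a pts[of x w] by (auto simp: e points_def)
      have ai: "a \<in> chart_dom TN i" "b \<in> chart_dom TN i"
        using a b i pts by (auto simp: e cotangent0_simps)
      then have "chart_map TN i a \<noteq> chart_map TN i b"
        using ab inj_onD[OF bundle_chart_inj[OF i(1)]] by blast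
      then obtain U V where UV: "open U" "open V" "chart_map TN i a \<in> U" "chart_map TN i b \<in> V" "U \<inter> V = {}"
        using hausdorff by metis
      have "i \<in> index TN" using i by (simp add: cotangent0_simps)
      then show ?thesis
        using B.openin_chart_preimage[OF _ UV(1)] B.openin_chart_preimage[OF _ UV(2)] UV ai
        by (intro exI[of _ "{x \<in> chart_dom TN i. chart_map TN i x \<in> U}"] exI[of _ "{x \<in> chart_dom TN i. chart_map TN i x \<in> V}"])
          (auto simp: disjnt_iff)
    qed
  qed
  moreover have "second_countable (manifold_topology TN)"
  proof -
    obtain I where I: "countable I" "I \<subseteq> index N" "points N = (\<Union>i\<in>I. chart_dom N i)"
      using N countable_subatlas by (auto simp: smooth_manifold_def)
    have "points TN = (\<Union>i\<in>I. chart_dom TN i)"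
    proof (intro set_eqI)
      fix a
      show "a \<in> points TN \<longleftrightarrow> a \<in> (\<Union>i\<in>I. chart_dom TN i)"
        using I(3) pts by (cases a) (auto simp: cotangent0_simps)
    qed
    then show ?thesis
      using I by (intro B.second_countable_from_subatlas) (auto simp: cotangent0_simps)
  qed
  ultimately show ?thesis using bundle_atlas by (simp add: smooth_manifold_def)
qed

end

section \<open>The Kaehler Einstein structure\<close>

lemma metric_G_index: "metric_G c v g i = metric_G c v (\<lambda>_::unit. g i) ()"
  and structure_J_index: "structure_J c v g i = structure_J c v (\<lambda>_::unit. g i) ()"
  by (simp_all add: metric_G_def structure_J_def fun_eq_iff)

theorem theorem4:
  fixes M :: "('i, 'a, 'n::finite) atlas"
    and g :: "'i \<Rightarrow> real^'n \<Rightarrow> real^'n^'n"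
    and c A B :: real
    and v :: "real \<Rightarrow> real"
  assumes "smooth_manifold M"
    and "CARD('n) \<ge> 2"
    and "riemannian_metric M g"
    and "c > 0"
    and "constant_sectional_curvature M g c"
    and "A \<ge> 0"
    and "B \<ge> 0"
    and "\<And>t. t > 0 \<Longrightarrow>
           v t = (real CARD('n) - 2) * sqrt c / (real CARD('n) * sqrt 2) * t powr (-(1/2))
               + A * t powr (-((real CARD('n) + 1) / 2)) + B"
  shows "kaehler_einstein_manifold (cotangent0 M) (metric_G c v g) (structure_J c v g)"
proof -
  let ?n = "real CARD('n)"
  define k where "k = (?n - 2) * sqrt c / (?n * sqrt 2)"
  define m where "m = (?n + 1) / 2"
  define v' where "v' t = k * (- (1/2) * t powr (- (1/2) - 1)) + A * (- m * t powr (- m - 1))" for t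
  have v: "v t = k * t powr (- (1/2)) + A * t powr (- m) + B" if "t > 0" for t
    using assms(8)[OF that] by (simp add: k_def m_def)
  have k: "k \<ge> 0" using assms(2,4) by (simp add: k_def)
  have v_smooth: "smooth_on S (\<lambda>z. v (f z))"
    if "smooth_on S f" "\<And>z. z \<in> S \<Longrightarrow> f z > 0" for S :: "(real^('n + 'n)) set" and f
  proof (rule smooth_on_cong)
    show "smooth_on S (\<lambda>z. k * f z powr (- (1/2)) + A * f z powr (- m) + B)"
      using that by (intro smooth_intros smooth_on_open[OF that(1)]) auto
  qed (use v that in auto)
  have v_deriv: "(v has_real_derivative v' t) (at t)" if "t > 0" for t
  proof -
    have "((\<lambda>t. k * t powr (- (1/2)) + A * t powr (- m) + B) has_real_derivative v' t) (at t)"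
      unfolding v'_def using that by (auto intro!: derivative_eq_intros)
    then show ?thesis
      by (rule has_field_derivative_transform_within_open[of _ _ _ "{0<..}"]) (use that v in auto)
  qed
  have v_nonneg: "v t \<ge> 0" if "t > 0" for t
    using v[OF that] k assms(6,7) by simp
  have v_bound: "c + sqrt (2 * c * t) * v t > 0" if "t > 0" for t
    using v_nonneg[OF that] assms(4) that by (intro add_pos_nonneg) auto
  \<comment> \<open>The term \<open>t\<^sup>-\<^sup>1\<^sup>/\<^sup>2\<close> of \<open>v\<close> compensates the contribution of the base, the coefficient of \<open>A\<close> solves the
    homogeneous equation, and the constant \<open>B\<close> determines the Einstein constant.\<close>
  have ode: "c * (2 - ?n) / sqrt (2 * c * t) + 2 * t * v' t + (?n + 1) * v t = 2 * ((?n + 1) / 2 * B)"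
    if t: "t > 0" for t
  proof -
    have p: "t * t powr (a - 1) = t powr a" for a
      using t by (simp add: powr_diff)
    have "2 * t * v' t = - (k * (t * t powr (- (1/2) - 1))) - 2 * m * A * (t * t powr (- m - 1))"
      by (simp add: v'_def algebra_simps)
    also have "\<dots> = - (k * t powr (- (1/2))) - (?n + 1) * A * t powr (- m)"
      unfolding p by (simp add: m_def)
    finally have d: "2 * t * v' t + (?n + 1) * v t = ?n * (k * t powr (- (1/2))) + (?n + 1) * B"
      by (simp add: v[OF t] algebra_simps)
    have "c / sqrt (2 * c * t) = sqrt c / sqrt 2 * t powr (- (1/2))"
    proof -
      have "c / sqrt (2 * c * t) = (sqrt c * sqrt c) / (sqrt c * (sqrt 2 * sqrt t))"
        using assms(4) by (simp add: real_sqrt_mult mult.left_commute)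
      also have "\<dots> = sqrt c / (sqrt 2 * sqrt t)"
        by (rule mult_divide_mult_cancel_left) (use assms(4) in simp)
      also have "\<dots> = sqrt c / sqrt 2 * (1 / sqrt t)" by simp
      also have "1 / sqrt t = t powr (- (1/2))"
        using t by (simp add: powr_minus_divide powr_half_sqrt)
      finally show ?thesis .
    qed
    then have e1: "c * (2 - ?n) / sqrt (2 * c * t) = (2 - ?n) * (sqrt c / sqrt 2 * t powr (- (1/2)))"
      by (metis mult.commute times_divide_eq_right)
    have e2: "?n * (k * t powr (- (1/2))) = (?n - 2) * (sqrt c / sqrt 2 * t powr (- (1/2)))"
      by (simp add: k_def)
    have "(2 - ?n) * x + ((?n - 2) * x + (?n + 1) * B) = 2 * ((?n + 1) / 2 * B)" for x
      by (simp add: algebra_simps)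
    then show ?thesis unfolding add.assoc d e1 e2 .
  qed
  interpret M: smooth_atlas_locale M
    using assms(1) by unfold_locales (simp add: smooth_manifold_def)
  let ?T = "cotangent0 M"
  have metric: "local_metric (coord_range M i) (g i)" if "i \<in> index M" for i
    using assms(3) that by unfold_locales (auto simp: riemannian_metric_def)
  have chart: "constant_curvature_cotangent (coord_range M i) (g i) c v v'" if i: "i \<in> index M" for i
  proof -
    interpret local_metric "coord_range M i" "g i" by (rule metric[OF i])
    show ?thesis
    proof unfold_locales
      fix y X Y Z assume y: "y \<in> coord_range M i"
      show "curvature_endo (g i) y X Y *v Z = c *\<^sub>R ((Y \<bullet> (g i y *v Z)) *\<^sub>R X - (X \<bullet> (g i y *v Z)) *\<^sub>R Y)"
        using assms(4,5) i y
        by (intro curvature_of_constant_sectional_curvature) (auto simp: constant_sectional_curvature_def)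
    qed (use assms(4) v_smooth v_deriv v_bound in auto)
  qed
  have change: "cotangent_change (coord_range M i) (coord_range M j) (g i) (g j) (overlap M i j)
      (transition M i j) c v v' (transition ?T i j)" if i: "i \<in> index M" and j: "j \<in> index M" for i j
  proof -
    interpret C1: constant_curvature_cotangent "coord_range M i" "g i" c v v' by (rule chart[OF i])
    interpret C2: constant_curvature_cotangent "coord_range M j" "g j" c v v' by (rule chart[OF j])
    have inv: "transition_jacobian M j i (transition M i j y) ** transition_jacobian M i j y = mat 1"
      if y: "y \<in> overlap M i j" for y
      using y M.jacobian_inverse[OF i _ j] by (auto simp: overlap_def M.transition_chart[OF i])
    interpret I: isometric_change "coord_range M i" "coord_range M j" "g i" "g j" "overlap M i j" "transition M i j"
    proof unfold_locales
      show "smooth_on (overlap M i j) (transition M i j)" by (rule M.smooth_transition[OF i j])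
      show "overlap M i j \<subseteq> coord_range M i" by (auto simp: overlap_def coord_range_def)
      show "transition M i j ` overlap M i j \<subseteq> coord_range M j"
        by (auto simp: overlap_def coord_range_def M.transition_chart[OF i])
      fix y assume y: "y \<in> overlap M i j"
      show "invertible (matrix (frechet_derivative (transition M i j) (at y)))"
        using inv[OF y] unfolding invertible_left_inverse transition_jacobian_def by blast
      show "g i y = transpose (matrix (frechet_derivative (transition M i j) (at y))) ** g j (transition M i j y)
          ** matrix (frechet_derivative (transition M i j) (at y))"
        using assms(3) i j y by (simp add: riemannian_metric_def transition_jacobian_def)
    qed
    show ?thesis
    proof unfold_locales
      show "smooth_on {z. q_part z \<in> overlap M i j \<and> p_part z \<noteq> 0} (transition ?T i j)"
        using M.bundle_atlas i j
        by (simp add: smooth_atlas_def cotangent0_simps flip: M.bundle_overlap)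
      fix z :: "real^('n + 'n)" assume q: "q_part z \<in> overlap M i j" and p: "p_part z \<noteq> 0"
      then have z: "z \<in> overlap ?T i j" by (simp add: M.bundle_overlap[OF i])
      show "q_part (transition ?T i j z) = transition M i j (q_part z)"
        by (simp add: M.bundle_transition[OF i j z])
      show "p_part (transition ?T i j z) v* I.A (q_part z) = p_part z"
        using inv[OF q]
        by (simp add: M.bundle_transition[OF i j z] vector_matrix_mul_assoc I.A_def transition_jacobian_def)
    qed
  qed
  have W: "coord_range ?T i = cotangent_metric.W (coord_range M i)" if i: "i \<in> index M" for i
  proof -
    interpret constant_curvature_cotangent "coord_range M i" "g i" c v v' by (rule chart[OF i])
    show ?thesis by (simp add: W_def M.bundle_coord_range[OF i])
  qed
  have transformation:
    "metric_G c v g i y = transpose (transition_jacobian ?T i j y) ** metric_G c v g j (transition ?T i j y)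
      ** transition_jacobian ?T i j y"
    "transition_jacobian ?T i j y ** structure_J c v g i y =
      structure_J c v g j (transition ?T i j y) ** transition_jacobian ?T i j y"
    if i: "i \<in> index M" and j: "j \<in> index M" and y: "y \<in> overlap ?T i j" for i j y
  proof -
    interpret C: cotangent_change "coord_range M i" "coord_range M j" "g i" "g j" "overlap M i j"
      "transition M i j" c v v' "transition ?T i j" by (rule change[OF i j])
    have y: "q_part y \<in> overlap M i j" "p_part y \<noteq> 0" using y by (simp_all add: M.bundle_overlap[OF i])
    show "metric_G c v g i y = transpose (transition_jacobian ?T i j y) ** metric_G c v g j (transition ?T i j y)
      ** transition_jacobian ?T i j y"
      unfolding metric_G_index[of c v g] transition_jacobian_def by (rule C.metric_change[OF y])
    show "transition_jacobian ?T i j y ** structure_J c v g i y =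
      structure_J c v g j (transition ?T i j y) ** transition_jacobian ?T i j y"
      unfolding structure_J_index[of c v g] transition_jacobian_def by (rule C.structure_change[OF y])
  qed
  have index: "index ?T = index M" by (simp add: cotangent0_simps)
  have kaehler: "local_kaehler (coord_range ?T i) (metric_G c v g i) (structure_J c v g i)" if i: "i \<in> index M" for i
    unfolding metric_G_index[of c v g] structure_J_index[of c v g] W[OF i]
    by (rule constant_curvature_cotangent.local_kaehler[OF chart[OF i]])
  note K = local_kaehler.axioms(1)[OF kaehler]
  have metric_T: "riemannian_metric ?T (metric_G c v g)"
    unfolding riemannian_metric_def index
    using local_metric.smooth[OF K] local_metric.symmetric[OF K] local_metric.positive[OF K] transformation(1)
    by blast
  have "almost_complex_structure ?T (structure_J c v g)"
    unfolding almost_complex_structure_def index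
    using local_kaehler.smooth_J[OF kaehler] local_kaehler.J_square[OF kaehler] transformation(2) by blast
  moreover have "integrable_structure ?T (structure_J c v g)"
    unfolding integrable_structure_def index using local_kaehler.integrable[OF kaehler] by blast
  moreover have "hermitian_metric ?T (metric_G c v g) (structure_J c v g)"
    unfolding hermitian_metric_def index using metric_T local_kaehler.hermitian[OF kaehler] by blast
  moreover have "closed_two_form ?T (\<lambda>i. fundamental_form (metric_G c v g i) (structure_J c v g i))"
    unfolding closed_two_form_def index using local_kaehler.closed[OF kaehler] by blast
  moreover have "einstein_metric ?T (metric_G c v g)"
    unfolding einstein_metric_def index
  proof (intro exI ballI)
    fix i y assume i: "i \<in> index M" and y: "y \<in> coord_range ?T i"
    show "ricci (metric_G c v g i) y = (- ((?n + 1) / 2 * B)) *\<^sub>R metric_G c v g i y"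
      unfolding metric_G_index[of c v g]
      by (rule constant_curvature_cotangent.ricci_eq_metric[OF chart[OF i] y[unfolded W[OF i]] ode])
  qed
  ultimately show ?thesis
    using M.bundle_manifold[OF assms(1)] by (simp add: kaehler_einstein_manifold_def kaehler_manifold_def)
qed

end
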